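(* Let $z\in\mathbb{C}\setminus\mathbb{R}$ and $z'=\bar z$, and let $\mathscr{P}_{z,z'}$ be the determinantal point process on $\mathbb{R}^*$ with the Whittaker kernel $\mathcal{K}_{z,z'}$. Then for any Borel subset $B\subset\mathbb{R}^*$ having a positive distance from the origin, the difference $\#(B\cap X\cap\mathbb{R}_+)-\#(B\cap X\cap\mathbb{R}_-)$ is $\mathscr{P}_{z,z'}$-almost surely determined by $X\cap(\mathbb{R}^*\setminus B)$; that is, there exists a measurable function $N_B^{out}:\mathrm{Conf}(\mathbb{R}^* )\to\mathbb{Z}$ such that for $\mathscr{P}_{z,z'}$-almost every $X\in\mathrm{Conf}(\mathbb{R}^* )$, $$\#(B\cap X\cap\mathbb{R}_+)-\#(B\cap X\cap\mathbb{R}_-)=N_B^{out}(X\setminus B).$$ In particular, if $B\subset\mathbb{R}_+$ has a positive distance from the origin, then $\#(B\cap X)$ is $\mathscr{P}_{z,z'}$-almost surely determined by $X\cap(\mathbb{R}^*\setminus B)$; the same holds if $B\subset\mathbb{R}_-$.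
   Context: $\mathbb{R}^*=\mathbb{R}\setminus\{0\}=\mathbb{R}_+\sqcup\mathbb{R}_-$ is the disjoint union of the open positive and negative semi-axes. $\mathrm{Conf}(\mathbb{R}^* )$ is the set of subsets $X\subset\mathbb{R}^*$ with $\#(X\cap B)<\infty$ for every compact $B\subset\mathbb{R}^*$, with the Borel structure generated by the maps $X\mapsto\#(X\cap B)$, $B$ relatively compact Borel. A point process on $\mathbb{R}^*$ is a Borel probability measure on $\mathrm{Conf}(\mathbb{R}^* )$. It is determinantal with correlation kernel $K$ if for all $k\ge1$ and all disjoint relatively compact Borel sets $D_1,\dots,D_k\subset\mathbb{R}^*$, $\mathbb{E}\prod_{i=1}^k\#(X\cap D_i)=\int_{D_1\times\cdots\times D_k}\det(K(x_i,x_j))_{1\le i,j\le k}\,dx_1\cdots dx_k$. Whittaker kernels. Let $z,z'\in\mathbb{C}$ satisfy either $z'=\bar z$, $z\in\mathbb{C}\setminus\mathbb{Z}$; or $z,z'\in\mathbb{R}$ and $m<z,z'<m+1$ for some $m\in\mathbb{Z}$. For $x>0$ set $$\mathcal{P}_\pm(x)=\frac{(zz')^{1/4}}{(\Gamma(1\pm z)\Gamma(1\pm z')x)^{1/2}}W_{\frac{\pm(z+z')+1}{2},\frac{z-z'}{2}}(x),\quad \mathcal{Q}_\pm(x)=\frac{(zz')^{3/4}}{(\Gamma(1\pm z)\Gamma(1\pm z')x)^{1/2}}W_{\frac{\pm(z+z')-1}{2},\frac{z-z'}{2}}(x),$$ where $\Gamma$ is the Euler Gamma function and $W_{a,b}$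 the Whittaker function. The Whittaker kernel $\mathcal{K}_{z,z'}(x,y)$ is $\frac{\mathcal{P}_+(x)\mathcal{Q}_+(y)-\mathcal{Q}_+(x)\mathcal{P}_+(y)}{x-y}$ for $x,y>0$; $\frac{\mathcal{P}_+(x)\mathcal{P}_-(-y)+\mathcal{Q}_+(x)\mathcal{Q}_-(-y)}{x-y}$ for $x>0,y<0$; $\frac{\mathcal{P}_-(-x)\mathcal{P}_+(y)+\mathcal{Q}_-(-x)\mathcal{Q}_+(y)}{x-y}$ for $x<0,y>0$; $\frac{\mathcal{P}_-(-x)\mathcal{Q}_-(-y)-\mathcal{Q}_-(-x)\mathcal{P}_-(-y)}{y-x}$ for $x,y<0$ (extended by continuity to the diagonal). By Borodin and Olshanski, it is the correlation kernel of a determinantal point process on $\mathbb{R}^*$, denoted $\mathscr{P}_{z,z'}$. *)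

theory Defs
  imports "HOL-Probability.Probability" "Jordan_Normal_Form.Determinant"
begin

section \<open>Point processes on the punctured line\<close>

abbreviation Rstar :: "real set" where
  "Rstar \<equiv> UNIV - {0}"

definition Conf :: "real set set" where
  "Conf = {X. X \<subseteq> Rstar \<and> (\<forall>C. compact C \<and> C \<subseteq> Rstar \<longrightarrow> finite (X \<inter> C))}"

text \<open>Relative compactness is meant in the punctured line, so the sets below are bounded and
  bounded away from 0.\<close>

definition rc_borel :: "real set set" where
  "rc_borel = {B \<in> sets borel. \<exists>C. compact C \<and> C \<subseteq> Rstar \<and> B \<subseteq> C}"

definition conf_space :: "real set measure" where
  "conf_space = sigma Conf {(\<lambda>X. card (X \<inter> B)) -` A \<inter> Conf | A B. B \<in> rc_borel}"

definition point_process :: "real set measure \<Rightarrow> bool" where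
  "point_process P \<longleftrightarrow> prob_space P \<and> sets P = sets conf_space"

text \<open>The two integrability conditions only say that both sides of the correlation identity are
  genuine finite integrals; the Bochner integral of a non-integrable function is 0. The name
  \<open>det\<close> is qualified because HOL-Analysis has another one, for matrices indexed by types.\<close>

definition determinantal :: "real set measure \<Rightarrow> (real \<Rightarrow> real \<Rightarrow> complex) \<Rightarrow> bool" where
  "determinantal P K \<longleftrightarrow> point_process P \<and>
     (\<forall>k\<ge>1. \<forall>D. (\<forall>i<k. D i \<in> rc_borel) \<and> disjoint_family_on D {..<k} \<longrightarrow>
        integrable P (\<lambda>X. \<Prod>i<k. real (card (X \<inter> D i))) \<and>
        set_integrable (\<Pi>\<^sub>M i\<in>{..<k}. lborel) (\<Pi>\<^sub>E i\<in>{..<k}. D i)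
          (\<lambda>x. Determinant.det (mat k k (\<lambda>(i, j). K (x i) (x j)))) \<and>
        complex_of_real (\<integral>X. (\<Prod>i<k. real (card (X \<inter> D i))) \<partial>P) =
          set_lebesgue_integral (\<Pi>\<^sub>M i\<in>{..<k}. lborel) (\<Pi>\<^sub>E i\<in>{..<k}. D i)
            (\<lambda>x. Determinant.det (mat k k (\<lambda>(i, j). K (x i) (x j)))))"


section \<open>Whittaker functions\<close>

definition kummer_M :: "complex \<Rightarrow> complex \<Rightarrow> complex \<Rightarrow> complex" where
  "kummer_M a b x = (\<Sum>n. pochhammer a n / (pochhammer b n * fact n) * x ^ n)"

definition whittaker_M :: "complex \<Rightarrow> complex \<Rightarrow> real \<Rightarrow> complex" where
  "whittaker_M a b x = exp (- of_real x / 2) * of_real x powr (1/2 + b)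
     * kummer_M (1/2 + b - a) (1 + 2 * b) (of_real x)"

definition whittaker_W_generic :: "complex \<Rightarrow> complex \<Rightarrow> real \<Rightarrow> complex" where
  "whittaker_W_generic a b x =
     Gamma (- 2 * b) / Gamma (1/2 - b - a) * whittaker_M a b x
     + Gamma (2 * b) / Gamma (1/2 + b - a) * whittaker_M a (- b) x"

text \<open>\<open>whittaker_W a b x\<close> is \<open>W\<^bsub>a,b\<^esub>(x)\<close> for \<open>x > 0\<close>. The connection formula above determines it
  when \<open>2 b\<close> is not an integer (see DLMF 13.14.33). The remaining values are limits in \<open>b\<close>, since
  \<open>W\<^bsub>a,b\<^esub>(x)\<close> is entire in \<open>b\<close>. At the poles of the Gamma function in a denominator, the
  conventions \<open>Gamma = 0\<close> and division by zero give the intended value 0.\<close>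

definition whittaker_W :: "complex \<Rightarrow> complex \<Rightarrow> real \<Rightarrow> complex" where
  "whittaker_W a b x =
     (if 2 * b \<notin> \<int> then whittaker_W_generic a b x
      else Lim (at b) (\<lambda>c. whittaker_W_generic a c x))"


section \<open>The Whittaker kernel\<close>

text \<open>The sign \<open>\<plusminus>\<close> in \<open>P\<^sub>\<plusminus>\<close> and \<open>Q\<^sub>\<plusminus>\<close> is the argument \<open>s\<close>, equal to 1 or -1. For admissible
  \<open>z\<close>, \<open>z'\<close> both \<open>z z'\<close> and \<open>\<Gamma>(1 \<plusminus> z) \<Gamma>(1 \<plusminus> z')\<close> are positive reals, so that the principal
  powers are the positive ones.\<close>

definition whittaker_P :: "complex \<Rightarrow> complex \<Rightarrow> complex \<Rightarrow> real \<Rightarrow> complex" where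
  "whittaker_P s z z' x =
     (z * z') powr (1/4) / (Gamma (1 + s * z) * Gamma (1 + s * z') * of_real x) powr (1/2)
     * whittaker_W ((s * (z + z') + 1) / 2) ((z - z') / 2) x"

definition whittaker_Q :: "complex \<Rightarrow> complex \<Rightarrow> complex \<Rightarrow> real \<Rightarrow> complex" where
  "whittaker_Q s z z' x =
     (z * z') powr (3/4) / (Gamma (1 + s * z) * Gamma (1 + s * z') * of_real x) powr (1/2)
     * whittaker_W ((s * (z + z') - 1) / 2) ((z - z') / 2) x"

definition whittaker_kernel_off :: "complex \<Rightarrow> complex \<Rightarrow> real \<Rightarrow> real \<Rightarrow> complex" where
  "whittaker_kernel_off z z' x y =
     (let P1 = whittaker_P 1 z z'; Q1 = whittaker_Q 1 z z';
          P2 = whittaker_P (-1) z z'; Q2 = whittaker_Q (-1) z z'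
      in if x > 0 \<and> y > 0 then (P1 x * Q1 y - Q1 x * P1 y) / of_real (x - y)
         else if x > 0 \<and> y < 0 then (P1 x * P2 (- y) + Q1 x * Q2 (- y)) / of_real (x - y)
         else if x < 0 \<and> y > 0 then (P2 (- x) * P1 y + Q2 (- x) * Q1 y) / of_real (x - y)
         else (P2 (- x) * Q2 (- y) - Q2 (- x) * P2 (- y)) / of_real (y - x))"

definition whittaker_kernel :: "complex \<Rightarrow> complex \<Rightarrow> real \<Rightarrow> real \<Rightarrow> complex" where
  "whittaker_kernel z z' x y =
     (if x \<noteq> y then whittaker_kernel_off z z' x y
      else Lim (at (x, x) within {(s, t). s \<noteq> t}) (\<lambda>(s, t). whittaker_kernel_off z z' s t))"

end

theory Submission
  imports Defs "HOL-Real_Asymp.Real_Asymp"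
begin

text \<open>Write \<open>a = Re z\<close>, \<open>\<beta> = Im z\<close> and \<open>\<rho> = |z|\<close>. Counting the points on the
  positive half-line with the sign \<open>+\<close> and those on the negative one with the sign \<open>-\<close>, one asks for
  test functions \<open>f\<close> that equal 1 on \<open>{\<delta> \<le> |x|}\<close> while the signed linear statistic
  \<open>\<Sum>\<^sub>x sgn x f(x)\<close> has a variance as small as one likes. If there is a sequence of them with variance
  tending to 0, then along a subsequence the statistic minus its mean tends to 0 almost surely, and the
  part of it that comes from \<open>X - B\<close> determines the charge of \<open>B \<inter> X\<close>.

  On the punctured line the kernel has the form \<open>K(x, y) = sgn y k(x, y)\<close> for a real symmetric
  \<open>k(x, y) = (p(x) q(y) - q(x) p(y)) / (x - y)\<close>, where on each half-line \<open>p\<close> and \<open>q\<close> are, up to sign,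
  the functions \<open>P\<^sub>\<plusminus>\<close> and \<open>Q\<^sub>\<plusminus>\<close>. Hence the two-point function is
  \<open>K(x, x) K(y, y) - sgn x sgn y k(x, y)\<^sup>2\<close>, and if moreover
  \<open>\<integral> k(x, y)\<^sup>2 dy = K(x, x)\<close>, then the variance is \<open>1/2 \<integral>\<integral> (f(x) - f(y))\<^sup>2 k(x, y)\<^sup>2 dx dy\<close>. Since
  \<open>k(x, y)\<^sup>2\<close> is at most of the order of \<open>(|x| + |y|)\<^sup>-\<^sup>2\<close> near 0 and decays at infinity, a function that falls
  from 1 to 0 slowly on the logarithmic scale makes this small. Here \<open>f\<close> is the mean of the indicators
  of \<open>n\<close> annuli whose inner radii form a geometric sequence of ratio \<open>n\<close>: their charges have bounded
  variances and covariances of order \<open>1/n\<close> (\<open>charge_average_variance\<close>), so the variance of the mean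
  is of order \<open>1/n\<close>. The conclusion is \<open>charge_rigidity\<close>, which is stated for any kernel with these
  properties.

  The main analytic point is the reproducing identity \<open>\<integral> k(x, y)\<^sup>2 dy = K(x, x)\<close>. The pair \<open>(p, q)\<close>
  solves the first-order system \<open>x p' = (a - x/2) p + \<rho> q\<close>, \<open>x q' = - (a - x/2) q - \<rho> p\<close>, and therefore
  the dilation derivative of \<open>t k(tx, ty)\<close> is a sum of two products of a function of \<open>tx\<close> and a function
  of \<open>ty\<close>. So the pairings of \<open>k(t, \<cdot>)\<close> with \<open>p\<close> and \<open>q\<close> solve nearly the same system as \<open>(p, q)\<close>, and
  the derivative of \<open>t \<integral> k(t, y)\<^sup>2 dy\<close> is expressed by them. It follows that
  \<open>t \<integral> k(t, y)\<^sup>2 dy = c t k(t, t)\<close> for a constant \<open>c\<close> (\<open>kk_proportional\<close>). To find \<open>c\<close>, let \<open>t\<close> tend to 0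
  along a geometric sequence that leaves \<open>t\<^sup>i\<^sup>\<beta>\<close> unchanged. The functions \<open>p\<close> and \<open>q\<close> then become pure
  waves in \<open>\<beta> ln |x|\<close>, the left-hand side becomes an integral that is evaluated in closed form, and
  \<open>c = 1\<close> is an identity between the amplitudes of the waves on the two half-lines
  (\<open>reproducing_pos\<close>). For the Whittaker functions this identity is a consequence of the reflection formula
  of the Gamma function (\<open>amplitude_connection\<close>).

  Decay of \<open>p\<close> and \<open>q\<close> at infinity is not read off from the series that define them. It is forced by
  the existence of the process: the intensity \<open>K(x, x)\<close> is nonnegative, and a solution of the system that
  does not decay would make it negative for large \<open>x\<close> (\<open>whittaker_system_decay\<close>).\<close>


section \<open>First-order systems of Whittaker type\<close>

text \<open>The first-order form of the Whittaker equations: on the positive half-line it is satisfied by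
  \<open>P\<^sub>+\<close> and \<open>Q\<^sub>+\<close>, with \<open>a = Re z\<close> and \<open>\<rho> = |z|\<close>.\<close>

definition whittaker_system ::
  "real \<Rightarrow> real \<Rightarrow> (real \<Rightarrow> real) \<Rightarrow> (real \<Rightarrow> real) \<Rightarrow> real set \<Rightarrow> bool" where
  "whittaker_system a \<rho> p q S \<longleftrightarrow> (\<forall>x\<in>S.
     (p has_real_derivative ((a / x - 1/2) * p x + \<rho> / x * q x)) (at x) \<and>
     (q has_real_derivative (- (a / x - 1/2) * q x - \<rho> / x * p x)) (at x))"

text \<open>This is \<open>x (p' q - q' p)\<close> for a solution of the system, that is, \<open>x\<close> times the diagonal value of
  \<open>(p(x) q(y) - q(x) p(y)) / (x - y)\<close>.\<close>

definition scaled_density :: "real \<Rightarrow> real \<Rightarrow> (real \<Rightarrow> real) \<Rightarrow> (real \<Rightarrow> real) \<Rightarrow> real \<Rightarrow> real" where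
  "scaled_density a \<rho> p q x = \<rho> * (p x)\<^sup>2 + 2 * (a - x / 2) * p x * q x + \<rho> * (q x)\<^sup>2"

lemma whittaker_systemD:
  assumes "whittaker_system a \<rho> p q S" "x \<in> S"
  shows "(p has_real_derivative ((a / x - 1/2) * p x + \<rho> / x * q x)) (at x)"
    and "(q has_real_derivative (- (a / x - 1/2) * q x - \<rho> / x * p x)) (at x)"
  using assms by (auto simp: whittaker_system_def)

text \<open>This symmetry reduces every statement about the negative half-line to one about the positive
  half-line.\<close>

lemma whittaker_system_mirror:
  assumes "whittaker_system a \<rho> p q S"
  shows "whittaker_system (- a) \<rho> (\<lambda>x. q (- x)) (\<lambda>x. - p (- x)) (uminus ` S)"
  unfolding whittaker_system_def
proof (intro ballI conjI)
  fix x assume "x \<in> uminus ` S"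
  then have S: "- x \<in> S" by auto
  note d = whittaker_systemD[OF assms S]
  show "((\<lambda>x. q (- x)) has_real_derivative
      (- a / x - 1 / 2) * q (- x) + \<rho> / x * - p (- x)) (at x)"
    by (rule DERIV_cong[OF DERIV_chain2[OF d(2) DERIV_minus[OF DERIV_ident]]])
      (simp add: algebra_simps)
  show "((\<lambda>x. - p (- x)) has_real_derivative
      - (- a / x - 1 / 2) * - p (- x) - \<rho> / x * q (- x)) (at x)"
    by (rule DERIV_cong[OF DERIV_minus[OF DERIV_chain2[OF d(1) DERIV_minus[OF DERIV_ident]]]])
      (simp add: algebra_simps)
qed

lemma scaled_density_deriv:
  assumes "whittaker_system a \<rho> p q S" "x \<in> S" "x \<noteq> 0"
  shows "(scaled_density a \<rho> p q has_real_derivative - (p x * q x)) (at x)"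
  unfolding scaled_density_def[abs_def]
  apply (rule derivative_eq_intros whittaker_systemD[OF assms(1,2)] refl | simp)+
  using assms(3) by (simp add: field_simps power2_eq_square)

text \<open>The cross terms cancel in the derivative of \<open>p\<^sup>2 + q\<^sup>2\<close>, so this quantity changes at a bounded
  logarithmic rate on compact intervals and cannot reach 0.\<close>

lemma whittaker_system_unique:
  assumes sys: "whittaker_system a \<rho> p q {0<..}" and "t0 > 0" "p t0 = 0" "q t0 = 0" "t > 0"
  shows "p t = 0 \<and> q t = 0"
proof -
  define E where "E x = (p x)\<^sup>2 + (q x)\<^sup>2" for x
  \<comment> \<open>The weight is an integrating factor: G 1 is increasing and G (-1) is decreasing.\<close>
  define G where "G s x = exp (s * x) * (x powr (2 * s * \<bar>a\<bar>)) * E x" for s x :: real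
  have dE: "(E has_real_derivative 2 * (a / x - 1/2) * ((p x)\<^sup>2 - (q x)\<^sup>2)) (at x)" if "x > 0" for x
  proof -
    have "x \<in> {0<..}" using that by simp
    note d = whittaker_systemD[OF sys this]
    show ?thesis
      unfolding E_def[abs_def]
      apply (rule derivative_eq_intros d refl)+
      using that by (simp add: field_simps power2_eq_square)
  qed
  have bE: "\<bar>2 * (a / x - 1/2) * ((p x)\<^sup>2 - (q x)\<^sup>2)\<bar> \<le> (1 + 2 * \<bar>a\<bar> / x) * E x" if "x > 0" for x
  proof -
    have "\<bar>2 * (a / x - 1/2)\<bar> \<le> 1 + 2 * \<bar>a\<bar> / x"
      using that by (simp add: abs_if field_simps)
    moreover have "\<bar>(p x)\<^sup>2 - (q x)\<^sup>2\<bar> \<le> E x" by (simp add: E_def abs_if)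
    ultimately show ?thesis unfolding abs_mult[of "2 * (a / x - 1/2)"]
      by (intro mult_mono) (auto simp: E_def)
  qed
  have dG: "(G s has_real_derivative exp (s * x) * (x powr (2 * s * \<bar>a\<bar>)) *
      (s * (1 + 2 * \<bar>a\<bar> / x) * E x + 2 * (a / x - 1/2) * ((p x)\<^sup>2 - (q x)\<^sup>2))) (at x)"
    if "x > 0" for x s
  proof -
    have 1: "((\<lambda>x. x powr (2 * s * \<bar>a\<bar>)) has_real_derivative
        2 * s * \<bar>a\<bar> / x * x powr (2 * s * \<bar>a\<bar>)) (at x)"
      by (rule DERIV_cong[OF has_real_derivative_powr[OF that]])
        (use that in \<open>simp add: powr_diff\<close>)
    have 2: "((\<lambda>x. exp (s * x)) has_real_derivative exp (s * x) * s) (at x)"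
      by (rule DERIV_cong[OF DERIV_chain2[OF DERIV_exp DERIV_cmult[OF DERIV_ident]]]) simp
    show ?thesis unfolding G_def[abs_def]
      by (rule DERIV_cong[OF DERIV_mult[OF DERIV_mult[OF 2 1] dE[OF that]]])
        (simp add: algebra_simps)
  qed
  have up: "G 1 x \<le> G 1 y" if "0 < x" "x \<le> y" for x y
  proof (rule DERIV_nonneg_imp_nondecreasing[OF that(2)])
    fix w assume "x \<le> w" "w \<le> y"
    then have w: "w > 0" using that by simp
    have b: "0 \<le> 1 * (1 + 2 * \<bar>a\<bar> / w) * E w + 2 * (a / w - 1/2) * ((p w)\<^sup>2 - (q w)\<^sup>2)"
      using bE[OF w] by linarith
    show "\<exists>z. (G 1 has_real_derivative z) (at w) \<and> 0 \<le> z"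
      by (rule exI, rule conjI, rule dG[OF w]) (intro mult_nonneg_nonneg b, auto)
  qed
  have down: "G (-1) y \<le> G (-1) x" if "0 < x" "x \<le> y" for x y
  proof (rule DERIV_nonpos_imp_nonincreasing[OF that(2)])
    fix w assume "x \<le> w" "w \<le> y"
    then have w: "w > 0" using that by simp
    have b: "(-1) * (1 + 2 * \<bar>a\<bar> / w) * E w + 2 * (a / w - 1/2) * ((p w)\<^sup>2 - (q w)\<^sup>2) \<le> 0"
      using bE[OF w] by linarith
    show "\<exists>z. (G (-1) has_real_derivative z) (at w) \<and> z \<le> 0"
      by (rule exI, rule conjI, rule dG[OF w]) (intro mult_nonneg_nonpos b, auto)
  qed
  have E0: "E t0 = 0" using assms by (simp add: E_def)
  have "E t \<le> 0"
  proof (cases "t \<le> t0")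
    case True
    from up[OF \<open>t > 0\<close> True] show ?thesis using E0 \<open>t > 0\<close> by (simp add: G_def mult_le_0_iff)
  next
    case False
    then have "t0 \<le> t" by simp
    from down[OF \<open>t0 > 0\<close> this] show ?thesis using E0 \<open>t > 0\<close> by (simp add: G_def mult_le_0_iff)
  qed
  then show ?thesis unfolding E_def
    by (metis add_nonneg_eq_0_iff antisym sum_power2_ge_zero zero_eq_power2 zero_le_power2)
qed

text \<open>The sign condition selects the recessive solution. Where \<open>|q| > |p|\<close> far out, the difference
  \<open>q\<^sup>2 - p\<^sup>2\<close> grows exponentially, because \<open>q\<close> behaves like \<open>exp (x/2)\<close>. Since the derivative of \<open>p q\<close> is
  \<open>\<rho> (q\<^sup>2 - p\<^sup>2) / x\<close>, the product tends to infinity, and since the scaled density has derivative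
  \<open>- p q\<close>, it would become negative. So \<open>|q| \<le> |p|\<close> far out, and then the equation of \<open>p\<close> alone gives
  the rate.\<close>

lemma whittaker_system_decay:
  assumes sys: "whittaker_system a \<rho> p q {0<..}" and "\<rho> > 0"
    and nn: "\<And>x. x > 0 \<Longrightarrow> scaled_density a \<rho> p q x \<ge> 0"
  shows "\<exists>C X. X > 0 \<and> C \<ge> 0 \<and> (\<forall>x\<ge>X. \<bar>p x\<bar> \<le> C * exp (- x / 4) \<and> \<bar>q x\<bar> \<le> C * exp (- x / 4))"
proof -
  \<comment> \<open>Beyond X the coefficients of order 1/x are dominated by the constant ones.\<close>
  define X where "X = 1 + 4 * \<bar>a\<bar> + 4 * \<rho>"
  have X: "X > 0" using \<open>\<rho> > 0\<close> by (simp add: X_def)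
  have small: "2 * \<bar>a\<bar> / x + 2 * \<rho> / x \<le> 1/2" if "x \<ge> X" for x
    using that X \<open>\<rho> > 0\<close> by (simp add: X_def field_simps)
  have amgm: "2 * \<bar>p x * q x\<bar> \<le> (p x)\<^sup>2 + (q x)\<^sup>2" for x
    using sum_squares_bound[of "\<bar>p x\<bar>" "\<bar>q x\<bar>"] by (simp add: abs_mult)
  define F where "F x = (q x)\<^sup>2 - (p x)\<^sup>2" for x
  define F' where "F' x = 2 * (1/2 - a / x) * ((p x)\<^sup>2 + (q x)\<^sup>2) - 4 * \<rho> / x * (p x * q x)" for x
  have dF: "(F has_real_derivative F' x) (at x)" if "x > 0" for x
  proof -
    have "x \<in> {0<..}" using that by simp
    note d = whittaker_systemD[OF sys this]
    show ?thesis
      unfolding F_def[abs_def] F'_def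
      apply (rule derivative_eq_intros d refl)+
      using that by (simp add: field_simps power2_eq_square)
  qed
  have dpq: "((\<lambda>x. p x * q x) has_real_derivative \<rho> / x * F x) (at x)" if "x > 0" for x
  proof -
    have "x \<in> {0<..}" using that by simp
    note d = whittaker_systemD[OF sys this]
    show ?thesis
      unfolding F_def
      apply (rule derivative_eq_intros d refl)+
      using that by (simp add: field_simps power2_eq_square)
  qed
  have bF: "F' x \<ge> F x / 2" if "x \<ge> X" for x
  proof -
    have x0: "x > 0" using that X by simp
    let ?S = "(p x)\<^sup>2 + (q x)\<^sup>2"
    have "4 * \<rho> / x * (p x * q x) \<le> 2 * \<rho> / x * (2 * \<bar>p x * q x\<bar>)"
      using x0 \<open>\<rho> > 0\<close> by (simp add: field_simps mult_left_mono)
    also have "\<dots> \<le> 2 * \<rho> / x * ?S"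
      using x0 \<open>\<rho> > 0\<close> amgm by (intro mult_left_mono) auto
    finally have 1: "4 * \<rho> / x * (p x * q x) \<le> 2 * \<rho> / x * ?S" .
    have "2 * (1/2 - a / x) \<ge> 1 - 2 * \<bar>a\<bar> / x"
      using x0 by (simp add: field_simps)
    then have "2 * (1/2 - a / x) * ?S \<ge> (1 - 2 * \<bar>a\<bar> / x) * ?S"
      by (intro mult_right_mono) auto
    with 1 have "F' x \<ge> (1 - (2 * \<bar>a\<bar> / x + 2 * \<rho> / x)) * ?S"
      unfolding F'_def by (simp add: algebra_simps)
    moreover have "(1 - (2 * \<bar>a\<bar> / x + 2 * \<rho> / x)) * ?S \<ge> 1/2 * ?S"
      using small[OF that] by (intro mult_right_mono) auto
    moreover have "1/2 * ?S \<ge> F x / 2" by (simp add: F_def)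
    ultimately show ?thesis by linarith
  qed
  have Fneg: "F x \<le> 0" if "x \<ge> X" for x
  proof (rule ccontr)
    assume "\<not> F x \<le> 0"
    define c where "c = exp (- x / 2) * F x"
    have c: "c > 0" using \<open>\<not> F x \<le> 0\<close> by (simp add: c_def)
    have x0: "x > 0" using that X by simp
    have "exp (- x / 2) * F x \<le> exp (- y / 2) * F y" if "x \<le> y" for y
    proof (rule DERIV_nonneg_imp_nondecreasing[OF that])
      fix w assume w: "x \<le> w" "w \<le> y"
      have "((\<lambda>w. exp (- w / 2) * F w) has_real_derivative
          exp (- w / 2) * (F' w - F w / 2)) (at w)"
      proof -
        have "w > 0" using w x0 by simp
        note d = dF[OF this]
        show ?thesis
          apply (rule derivative_eq_intros d refl | simp)+
          by (simp add: algebra_simps)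
      qed
      moreover have "exp (- w / 2) * (F' w - F w / 2) \<ge> 0"
        using bF[of w] w \<open>x \<ge> X\<close> by simp
      ultimately show "\<exists>z. ((\<lambda>w. exp (- w / 2) * F w) has_real_derivative z) (at w) \<and> 0 \<le> z"
        by blast
    qed
    then have Fgrow: "F y \<ge> c * (y / 2)" if "y \<ge> x" for y
    proof -
      have "c \<le> exp (- y / 2) * F y" using that \<open>\<And>y. x \<le> y \<Longrightarrow> _\<close> by (simp add: c_def)
      then have "c * exp (y / 2) \<le> F y" by (simp add: exp_minus field_simps)
      moreover have "y / 2 \<le> exp (y / 2)" using exp_ge_add_one_self[of "y/2"] by linarith
      then have "c * (y / 2) \<le> c * exp (y / 2)" using c by (intro mult_left_mono) auto
      ultimately show ?thesis by linarith
    qed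
    \<comment> \<open>By the bound for F the derivative \<rho> * F w / w of p * q is at least e.\<close>
    define e where "e = \<rho> * c / 2"
    have e: "e > 0" using c \<open>\<rho> > 0\<close> by (simp add: e_def)
    have "p x * q x - e * x \<le> p y * q y - e * y" if "x \<le> y" for y
    proof (rule DERIV_nonneg_imp_nondecreasing[OF that])
      fix w assume w: "x \<le> w" "w \<le> y"
      have "((\<lambda>w. p w * q w - e * w) has_real_derivative (\<rho> / w * F w - e)) (at w)"
        using w x0 by (intro DERIV_diff dpq DERIV_cmult_Id) auto
      moreover have "\<rho> / w * F w \<ge> \<rho> / w * (c * (w / 2))"
        using Fgrow[of w] w x0 \<open>\<rho> > 0\<close> by (intro mult_left_mono) auto
      moreover have "\<rho> / w * (c * (w / 2)) = e" using w x0 by (simp add: e_def)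
      ultimately show "\<exists>z. ((\<lambda>w. p w * q w - e * w) has_real_derivative z) (at w) \<and> 0 \<le> z"
        by (intro exI[of _ "\<rho> / w * F w - e"] conjI) linarith+
    qed
    then have pq: "p y * q y \<ge> p x * q x + e * (y - x)" if "y \<ge> x" for y
      using that by (fastforce simp: algebra_simps)
    define y where "y = max x (x + (1 - p x * q x) / e)"
    have yx: "y \<ge> x" by (simp add: y_def)
    have pq1: "p w * q w \<ge> 1" if "w \<ge> y" for w
    proof -
      have "w - x \<ge> (1 - p x * q x) / e" using that by (simp add: y_def)
      then have "e * (w - x) \<ge> 1 - p x * q x" using e by (simp add: field_simps)
      with pq[of w] that yx show ?thesis by linarith
    qed
    let ?H = "scaled_density a \<rho> p q"
    have "?H w + w \<le> ?H y + y" if "y \<le> w" for w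
    proof (rule DERIV_nonpos_imp_nonincreasing[OF that])
      fix v assume v: "y \<le> v" "v \<le> w"
      have "v > 0" using v yx x0 by simp
      then have "((\<lambda>w. ?H w + w) has_real_derivative - (p v * q v) + 1) (at v)"
        by (intro DERIV_add scaled_density_deriv[OF sys]) auto
      then show "\<exists>z. ((\<lambda>w. ?H w + w) has_real_derivative z) (at v) \<and> z \<le> 0"
        using pq1[OF v(1)] by force
    qed
    from this[of "?H y + y + 1"] nn[of y] nn[of "?H y + y + 1"] yx x0 show False by auto
  qed
  have p_dec: "exp (x / 2) * (p x)\<^sup>2 \<le> exp (X / 2) * (p X)\<^sup>2" if "X \<le> x" for x
  proof (rule DERIV_nonpos_imp_nonincreasing[OF that])
    fix w assume w: "X \<le> w" "w \<le> x"
    have w0: "w > 0" using w X by simp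
    have d: "((\<lambda>w. exp (w / 2) * (p w)\<^sup>2) has_real_derivative
        exp (w / 2) * ((2 * (a / w) - 1/2) * (p w)\<^sup>2 + 2 * \<rho> / w * (p w * q w))) (at w)"
    proof -
      have "w \<in> {0<..}" using w0 by simp
      note d = whittaker_systemD[OF sys this]
      show ?thesis
        apply (rule derivative_eq_intros d refl | simp)+
        using w0 by (simp add: field_simps power2_eq_square)
    qed
    have "\<bar>q w\<bar> \<le> \<bar>p w\<bar>" using Fneg[OF w(1)] by (simp add: F_def abs_le_square_iff)
    then have "\<bar>p w * q w\<bar> \<le> (p w)\<^sup>2"
      unfolding abs_mult power2_eq_square by (metis abs_ge_zero abs_mult_self_eq mult_left_mono)
    then have "2 * \<rho> / w * (p w * q w) \<le> 2 * \<rho> / w * (p w)\<^sup>2"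
      using w0 \<open>\<rho> > 0\<close> by (intro mult_left_mono) auto
    moreover have "(2 * (a / w) - 1/2) * (p w)\<^sup>2 \<le> (2 * \<bar>a\<bar> / w - 1/2) * (p w)\<^sup>2"
      using w0 by (intro mult_right_mono) (auto simp: field_simps)
    ultimately have "(2 * (a / w) - 1/2) * (p w)\<^sup>2 + 2 * \<rho> / w * (p w * q w)
        \<le> (2 * \<bar>a\<bar> / w + 2 * \<rho> / w - 1/2) * (p w)\<^sup>2"
      by (simp add: algebra_simps)
    also have "\<dots> \<le> 0" using small[OF w(1)] by (intro mult_nonpos_nonneg) auto
    finally have b: "(2 * (a / w) - 1/2) * (p w)\<^sup>2 + 2 * \<rho> / w * (p w * q w) \<le> 0" .
    show "\<exists>z. ((\<lambda>w. exp (w / 2) * (p w)\<^sup>2) has_real_derivative z) (at w) \<and> z \<le> 0"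
      by (rule exI, rule conjI, rule d) (intro mult_nonneg_nonpos b, auto)
  qed
  define C where "C = sqrt (exp (X / 2) * (p X)\<^sup>2)"
  have "\<bar>p x\<bar> \<le> C * exp (- x / 4) \<and> \<bar>q x\<bar> \<le> C * exp (- x / 4)" if "x \<ge> X" for x
  proof -
    have "(C * exp (- x / 4))\<^sup>2 = exp (X / 2) * (p X)\<^sup>2 * exp (- x / 2)"
      by (simp add: C_def power_mult_distrib flip: exp_double)
    moreover have "(p x)\<^sup>2 \<le> exp (X / 2) * (p X)\<^sup>2 * exp (- x / 2)"
      using p_dec[OF that] by (simp add: exp_minus field_simps)
    ultimately have "(p x)\<^sup>2 \<le> (C * exp (- x / 4))\<^sup>2" by simp
    then have "\<bar>p x\<bar> \<le> \<bar>C * exp (- x / 4)\<bar>" by (rule abs_le_square_iff[THEN iffD2])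
    then have "\<bar>p x\<bar> \<le> C * exp (- x / 4)" by (simp add: C_def abs_mult)
    moreover have "\<bar>q x\<bar> \<le> \<bar>p x\<bar>" using Fneg[OF that] by (simp add: F_def abs_le_square_iff)
    ultimately show ?thesis by linarith
  qed
  then show ?thesis using X by (intro exI[of _ C] exI[of _ X]) (simp add: C_def)
qed


section \<open>The integrable kernel of a decaying solution\<close>

text \<open>Differentiation under the integral sign. The exceptional null set does not depend on the
  parameter, as is the case below, where it is a single point.\<close>

lemma has_real_derivative_integral_dominated:
  fixes f f' :: "real \<Rightarrow> 'a \<Rightarrow> real"
  assumes t0: "l < t0" "t0 < r"
    and int: "\<And>t. l < t \<Longrightarrow> t < r \<Longrightarrow> integrable M (f t)"
    and der: "AE y in M. (\<forall>t. l < t \<and> t < r \<longrightarrow>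
                 ((\<lambda>t. f t y) has_real_derivative f' t y) (at t) \<and> \<bar>f' t y\<bar> \<le> w y)"
    and w: "integrable M w" and meas: "f' t0 \<in> borel_measurable M"
  shows "((\<lambda>t. \<integral>y. f t y \<partial>M) has_real_derivative (\<integral>y. f' t0 y \<partial>M)) (at t0)"
    and "integrable M (f' t0)"
proof -
  show "integrable M (f' t0)"
    by (rule Bochner_Integration.integrable_bound[OF w meas])
      (use der in eventually_elim, use t0 in \<open>auto intro: order_trans[OF _ abs_ge_self]\<close>)
  show "((\<lambda>t. \<integral>y. f t y \<partial>M) has_real_derivative (\<integral>y. f' t0 y \<partial>M)) (at t0)"
    unfolding has_field_derivative_iff
  proof (subst tendsto_at_iff_sequentially, intro allI impI)
    fix X :: "nat \<Rightarrow> real" assume X: "\<forall>i. X i \<in> UNIV - {t0}" "X \<longlonglongrightarrow> t0"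
    have "\<forall>\<^sub>F n in sequentially. l < X n \<and> X n < r"
      using order_tendstoD[OF X(2)] t0 by (intro eventually_conj) auto
    then obtain N where N: "\<And>n. n \<ge> N \<Longrightarrow> l < X n \<and> X n < r"
      by (auto simp: eventually_sequentially)
    define Y where "Y n = X (n + N)" for n
    have Y: "l < Y n" "Y n < r" "Y n \<noteq> t0" for n using N[of "n + N"] X by (auto simp: Y_def)
    have Ylim: "Y \<longlonglongrightarrow> t0" unfolding Y_def using X(2) by (rule LIMSEQ_ignore_initial_segment)
    have "(\<lambda>n. \<integral>y. (f (Y n) y - f t0 y) / (Y n - t0) \<partial>M) \<longlonglongrightarrow> (\<integral>y. f' t0 y \<partial>M)"
    proof (rule integral_dominated_convergence[where w = w])
      show "(\<lambda>y. (f (Y n) y - f t0 y) / (Y n - t0)) \<in> borel_measurable M" for n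
        using int[OF Y(1,2)[of n]] int[OF t0] by auto
      show "AE y in M. (\<lambda>n. (f (Y n) y - f t0 y) / (Y n - t0)) \<longlonglongrightarrow> f' t0 y"
        using der
      proof eventually_elim
        case (elim y)
        then have "((\<lambda>t. f t y) has_real_derivative f' t0 y) (at t0)" using t0 by blast
        then have "((\<lambda>t. (f t y - f t0 y) / (t - t0)) \<longlongrightarrow> f' t0 y) (at t0)"
          by (simp add: has_field_derivative_iff)
        then show ?case using Ylim Y(3)
          unfolding tendsto_at_iff_sequentially by (auto simp: o_def)
      qed
      show "AE y in M. norm ((f (Y n) y - f t0 y) / (Y n - t0)) \<le> w y" for n
        using der
      proof eventually_elim
        case (elim y)
        have mvt: "\<exists>z. u < z \<and> z < v \<and> f v y - f u y = (v - u) * f' z y"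
          if "l < u" "u < v" "v < r" for u v
          by (rule MVT2[OF that(2)]) (use elim that in auto)
        have "\<bar>f v y - f u y\<bar> \<le> (v - u) * w y" if "l < u" "u < v" "v < r" for u v
        proof -
          from mvt[OF that] obtain z where z: "u < z" "z < v" "f v y - f u y = (v - u) * f' z y"
            by blast
          then show ?thesis using elim[rule_format, of z] that by (simp add: abs_mult)
        qed
        from this[of "Y n" t0] this[of t0 "Y n"] Y[of n] t0
        have "\<bar>f (Y n) y - f t0 y\<bar> \<le> \<bar>Y n - t0\<bar> * w y"
          by (cases "Y n < t0") (auto simp: abs_minus_commute)
        then show ?case using Y(3)[of n] by (simp add: abs_divide field_simps)
      qed
    qed (use meas w in auto)
    also have "(\<lambda>n. \<integral>y. (f (Y n) y - f t0 y) / (Y n - t0) \<partial>M)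
        = (\<lambda>n. ((\<integral>y. f (Y n) y \<partial>M) - (\<integral>y. f t0 y \<partial>M)) / (Y n - t0))"
      using int[OF Y(1,2)] int[OF t0] by (auto simp: fun_eq_iff)
    finally have "(\<lambda>n. (\<lambda>t. ((\<integral>y. f t y \<partial>M) - (\<integral>y. f t0 y \<partial>M)) / (t - t0)) (X (n + N)))
        \<longlonglongrightarrow> (\<integral>y. f' t0 y \<partial>M)" by (simp add: Y_def)
    from LIMSEQ_offset[OF this]
    show "((\<lambda>t. ((\<integral>y. f t y \<partial>M) - (\<integral>y. f t0 y \<partial>M)) / (t - t0)) \<circ> X)
        \<longlonglongrightarrow> (\<integral>y. f' t0 y \<partial>M)" by (simp add: o_def)
  qed
qed

definition whittaker_k :: "real \<Rightarrow> real \<Rightarrow> (real \<Rightarrow> real) \<Rightarrow> (real \<Rightarrow> real) \<Rightarrow> real \<Rightarrow> real \<Rightarrow> real" where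
  "whittaker_k a \<rho> p q x y =
     (if x = y then scaled_density a \<rho> p q x / x else (p x * q y - q x * p y) / (x - y))"

text \<open>A solution on the punctured line, with no relation yet between its values on the two half-lines.\<close>

locale decaying_pair =
  fixes a \<rho> M :: real and p q :: "real \<Rightarrow> real"
  assumes sys: "whittaker_system a \<rho> p q (- {0})"
    and M_nonneg: "M \<ge> 0"
    and p_bound: "\<And>x. x \<noteq> 0 \<Longrightarrow> \<bar>p x\<bar> \<le> M * exp (- \<bar>x\<bar> / 4)"
    and q_bound: "\<And>x. x \<noteq> 0 \<Longrightarrow> \<bar>q x\<bar> \<le> M * exp (- \<bar>x\<bar> / 4)"
begin

abbreviation k where "k \<equiv> whittaker_k a \<rho> p q"
abbreviation H where "H \<equiv> scaled_density a \<rho> p q"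

lemma p_deriv: "x \<noteq> 0 \<Longrightarrow> (p has_real_derivative ((a / x - 1/2) * p x + \<rho> / x * q x)) (at x)"
  and q_deriv: "x \<noteq> 0 \<Longrightarrow> (q has_real_derivative (- (a / x - 1/2) * q x - \<rho> / x * p x)) (at x)"
  using whittaker_systemD[OF sys] by auto

lemma H_deriv: "x \<noteq> 0 \<Longrightarrow> (H has_real_derivative - (p x * q x)) (at x)"
  using scaled_density_deriv[OF sys] by auto

lemma p_measurable[measurable]: "p \<in> borel_measurable borel"
  and q_measurable[measurable]: "q \<in> borel_measurable borel"
proof -
  have "continuous_on (- {0}) p" "continuous_on (- {0}) q"
    using p_deriv q_deriv by (auto intro!: DERIV_isCont continuous_at_imp_continuous_on)
  then show "p \<in> borel_measurable borel" "q \<in> borel_measurable borel"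
    by (auto intro: borel_measurable_continuous_countable_exceptions[of "{0}"])
qed

lemma k_measurable[measurable]: "(\<lambda>w. k (fst w) (snd w)) \<in> borel_measurable (borel \<Otimes>\<^sub>M borel)"
  unfolding whittaker_k_def scaled_density_def by measurable

lemma k_measurable'[measurable]:
  assumes [measurable]: "f \<in> borel_measurable N" "g \<in> borel_measurable N"
  shows "(\<lambda>w. k (f w) (g w)) \<in> borel_measurable N"
  unfolding whittaker_k_def scaled_density_def by measurable

lemma k_sym: "k x y = k y x"
  by (simp add: whittaker_k_def) (simp add: divide_simps algebra_simps)

text \<open>The reason why everything is computable: the factor \<open>1 / (x - y)\<close> is homogeneous, and in the
  derivative of \<open>p(tx) q(ty) - q(tx) p(ty)\<close> all terms cancel except those from \<open>- (x/2) p\<close> and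
  \<open>(x/2) q\<close> in the system, which contribute the factor \<open>x - y\<close>.\<close>

lemma kernel_dilation_deriv:
  assumes "x \<noteq> 0" "y \<noteq> 0" "t > 0"
  shows "((\<lambda>t. t * k (t * x) (t * y)) has_real_derivative
      - (p (t * x) * q (t * y) + q (t * x) * p (t * y)) / 2) (at t)"
proof (cases "x = y")
  case True
  have "((\<lambda>t. H (t * x) / x) has_real_derivative - (p (t * x) * q (t * x)) * x / x) (at t)"
  proof -
    have "((\<lambda>t. t * x) has_real_derivative x) (at t)"
      by (rule DERIV_cong[OF DERIV_cmult_right[OF DERIV_ident]]) simp
    then show ?thesis using assms by (intro DERIV_cdivide DERIV_chain2[OF H_deriv]) auto
  qed
  moreover have "\<forall>\<^sub>F t in nhds t. t * k (t * x) (t * y) = H (t * x) / x"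
  proof (rule eventually_nhds_in_open[of "{0<..}", THEN eventually_mono])
    show "t * k (t * x) (t * y) = H (t * x) / x" if "t \<in> {0<..}" for t
      using that True by (simp add: whittaker_k_def)
  qed (use assms in auto)
  ultimately show ?thesis using True assms
    by (subst DERIV_cong_ev[OF refl _ refl]) auto
next
  case False
  have d: "((\<lambda>t. p (t * x)) has_real_derivative
      ((a / t - x / 2) * p (t * x) + \<rho> / t * q (t * x))) (at t)"
    "((\<lambda>t. q (t * x)) has_real_derivative
      (- (a / t - x / 2) * q (t * x) - \<rho> / t * p (t * x))) (at t)"
    if "x \<noteq> 0" for x
  proof -
    have l: "((\<lambda>t. t * x) has_real_derivative x) (at t)"
      by (rule DERIV_cong[OF DERIV_cmult_right[OF DERIV_ident]]) simp
    show "((\<lambda>t. p (t * x)) has_real_derivative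
        ((a / t - x / 2) * p (t * x) + \<rho> / t * q (t * x))) (at t)"
      by (rule DERIV_cong[OF DERIV_chain2[OF p_deriv l]])
        (use that assms in \<open>simp_all add: field_simps\<close>)
    show "((\<lambda>t. q (t * x)) has_real_derivative
        (- (a / t - x / 2) * q (t * x) - \<rho> / t * p (t * x))) (at t)"
      by (rule DERIV_cong[OF DERIV_chain2[OF q_deriv l]])
        (use that assms in \<open>simp_all add: field_simps\<close>)
  qed
  have "((\<lambda>t. (p (t * x) * q (t * y) - q (t * x) * p (t * y)) / (x - y)) has_real_derivative
      - (p (t * x) * q (t * y) + q (t * x) * p (t * y)) / 2) (at t)"
  proof (rule DERIV_cong[OF DERIV_cdivide[OF DERIV_diff[OF
          DERIV_mult[OF d(1)[OF assms(1)] d(2)[OF assms(2)]]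
          DERIV_mult[OF d(2)[OF assms(1)] d(1)[OF assms(2)]]]]])
    have e: "u / (x - y) = v" if "u = v * (x - y)" for u v using that False by simp
    show "(((a / t - x / 2) * p (t * x) + \<rho> / t * q (t * x)) * q (t * y)
       + (- (a / t - y / 2) * q (t * y) - \<rho> / t * p (t * y)) * p (t * x)
       - ((- (a / t - x / 2) * q (t * x) - \<rho> / t * p (t * x)) * p (t * y)
          + ((a / t - y / 2) * p (t * y) + \<rho> / t * q (t * y)) * q (t * x))) / (x - y)
      = - (p (t * x) * q (t * y) + q (t * x) * p (t * y)) / 2"
      by (rule e) (simp add: algebra_simps)
  qed
  moreover have "\<forall>\<^sub>F t in nhds t. t * k (t * x) (t * y)
      = (p (t * x) * q (t * y) - q (t * x) * p (t * y)) / (x - y)"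
  proof (rule eventually_nhds_in_open[of "{0<..}", THEN eventually_mono])
    show "t * k (t * x) (t * y) = (p (t * x) * q (t * y) - q (t * x) * p (t * y)) / (x - y)"
      if "t \<in> {0<..}" for t
    proof -
      have "t * x - t * y = t * (x - y)" by (simp add: algebra_simps)
      with that False show ?thesis by (simp add: whittaker_k_def)
    qed
  qed (use assms in auto)
  ultimately show ?thesis
    by (subst DERIV_cong_ev[OF refl _ refl]) auto
qed


text \<open>The term \<open>x p q\<close> costs one factor \<open>exp (- |x|/4)\<close> of the two that are available.\<close>

lemma H_bound:
  assumes "x \<noteq> 0"
  shows "\<bar>H x\<bar> \<le> (2 * \<bar>\<rho>\<bar> + 2 * \<bar>a\<bar> + 4) * M\<^sup>2 * exp (- \<bar>x\<bar> / 4)"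
proof -
  let ?e = "exp (- \<bar>x\<bar> / 4)"
  have e: "?e \<le> 1" by simp
  have sq: "\<bar>u * v\<bar> \<le> M\<^sup>2 * ?e * ?e" if "\<bar>u\<bar> \<le> M * ?e" "\<bar>v\<bar> \<le> M * ?e" for u v
    using mult_mono[OF that] M_nonneg by (simp add: abs_mult power2_eq_square algebra_simps)
  have le: "M\<^sup>2 * ?e * ?e \<le> M\<^sup>2 * ?e"
    by (rule mult_left_le) auto
  note b = p_bound[OF assms] q_bound[OF assms]
  have pq: "\<bar>p x * q x\<bar> \<le> M\<^sup>2 * ?e * ?e" by (rule sq[OF b])
  have "\<bar>x\<bar> / 4 \<le> exp (\<bar>x\<bar> / 4)" using exp_ge_add_one_self[of "\<bar>x\<bar> / 4"] by linarith
  then have "\<bar>x\<bar> * ?e \<le> 4" by (simp add: exp_minus field_simps)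
  then have "\<bar>x\<bar> * ?e * (M\<^sup>2 * ?e) \<le> 4 * (M\<^sup>2 * ?e)"
    by (intro mult_right_mono) auto
  moreover have "\<bar>x\<bar> * \<bar>p x * q x\<bar> \<le> \<bar>x\<bar> * (M\<^sup>2 * ?e * ?e)" using pq by (intro mult_left_mono) auto
  ultimately have 1: "\<bar>x * p x * q x\<bar> \<le> 4 * (M\<^sup>2 * ?e)" by (simp add: abs_mult algebra_simps)
  have 2: "\<bar>\<rho> * (p x)\<^sup>2\<bar> \<le> \<bar>\<rho>\<bar> * (M\<^sup>2 * ?e)" "\<bar>\<rho> * (q x)\<^sup>2\<bar> \<le> \<bar>\<rho>\<bar> * (M\<^sup>2 * ?e)"
    "\<bar>2 * a * (p x * q x)\<bar> \<le> 2 * \<bar>a\<bar> * (M\<^sup>2 * ?e)"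
    using sq[OF b(1) b(1)] sq[OF b(2) b(2)] pq le
    by (auto simp: abs_mult power2_eq_square intro!: mult_left_mono)
  have "H x = \<rho> * (p x)\<^sup>2 + \<rho> * (q x)\<^sup>2 + 2 * a * (p x * q x) - x * p x * q x"
    by (simp add: scaled_density_def algebra_simps)
  then have "\<bar>H x\<bar> \<le> \<bar>\<rho> * (p x)\<^sup>2\<bar> + \<bar>\<rho> * (q x)\<^sup>2\<bar> + \<bar>2 * a * (p x * q x)\<bar> + \<bar>x * p x * q x\<bar>"
    by linarith
  also have "\<dots> \<le> (2 * \<bar>\<rho>\<bar> + 2 * \<bar>a\<bar> + 4) * M\<^sup>2 * ?e"
    using 1 2 by (simp add: algebra_simps)
  finally show ?thesis .
qed

lemma exp_decay_dilate: "(x::real) \<noteq> 0 \<Longrightarrow> ((\<lambda>t. C * exp (- \<bar>t * x\<bar> / 4)) \<longlongrightarrow> 0) at_top"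
proof -
  assume "x \<noteq> 0"
  then have "filterlim (\<lambda>t. \<bar>x\<bar> / 4 * t) at_top at_top"
    by (intro filterlim_tendsto_pos_mult_at_top[OF tendsto_const]) (auto intro: filterlim_ident)
  then have "((\<lambda>t. exp (- (\<bar>x\<bar> / 4 * t))) \<longlongrightarrow> 0) at_top"
    by (intro filterlim_compose[OF exp_at_bot] filterlim_compose[OF filterlim_uminus_at_bot_at_top])
  then have "((\<lambda>t. C * exp (- (\<bar>x\<bar> / 4 * t))) \<longlongrightarrow> C * 0) at_top"
    by (intro tendsto_mult tendsto_const)
  then have "((\<lambda>t. C * exp (- (\<bar>x\<bar> / 4 * t))) \<longlongrightarrow> 0) at_top" by simp
  then show ?thesis
    by (rule Lim_transform_eventually)
      (auto intro!: eventually_mono[OF eventually_ge_at_top[of 0]] simp: abs_mult mult_ac)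
qed

lemma pq_dilation_tendsto:
  assumes "x \<noteq> 0"
  shows "((\<lambda>t. p (t * x)) \<longlongrightarrow> 0) at_top" "((\<lambda>t. q (t * x)) \<longlongrightarrow> 0) at_top"
    "((\<lambda>t. H (t * x)) \<longlongrightarrow> 0) at_top"
proof -
  have "((\<lambda>t. f (t * x)) \<longlongrightarrow> 0) at_top"
    if "\<And>x. x \<noteq> 0 \<Longrightarrow> \<bar>f x\<bar> \<le> C * exp (- \<bar>x\<bar> / 4)" for f :: "real \<Rightarrow> real" and C
    by (rule Lim_null_comparison[OF _ exp_decay_dilate[OF assms, of C]],
        rule eventually_mono[OF eventually_gt_at_top[of 0]])
      (use that assms in simp)
  from this[OF p_bound] this[OF q_bound] this[OF H_bound]
  show "((\<lambda>t. p (t * x)) \<longlongrightarrow> 0) at_top" "((\<lambda>t. q (t * x)) \<longlongrightarrow> 0) at_top"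
    "((\<lambda>t. H (t * x)) \<longlongrightarrow> 0) at_top" by auto
qed

lemma kernel_dilation_tendsto:
  assumes "x \<noteq> 0" "y \<noteq> 0"
  shows "((\<lambda>t. t * k (t * x) (t * y)) \<longlongrightarrow> 0) at_top"
proof (cases "x = y")
  case True
  have "((\<lambda>t. H (t * x) / x) \<longlongrightarrow> 0 / x) at_top"
    by (intro tendsto_divide pq_dilation_tendsto tendsto_const assms)
  then have "((\<lambda>t. H (t * x) / x) \<longlongrightarrow> 0) at_top" by simp
  then show ?thesis
    by (rule Lim_transform_eventually, intro eventually_mono[OF eventually_gt_at_top[of 0]])
      (use assms in \<open>simp add: True whittaker_k_def\<close>)
next
  case False
  have "((\<lambda>t. (p (t * x) * q (t * y) - q (t * x) * p (t * y)) / (x - y)) \<longlongrightarrow> (0 * 0 - 0 * 0) / (x - y)) at_top"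
    using False by (intro tendsto_divide tendsto_diff tendsto_mult pq_dilation_tendsto tendsto_const assms) auto
  then have "((\<lambda>t. (p (t * x) * q (t * y) - q (t * x) * p (t * y)) / (x - y)) \<longlongrightarrow> 0) at_top" by simp
  then show ?thesis
  proof (rule Lim_transform_eventually)
    show "\<forall>\<^sub>F t in at_top. (p (t * x) * q (t * y) - q (t * x) * p (t * y)) / (x - y)
        = t * k (t * x) (t * y)"
    proof (rule eventually_mono[OF eventually_gt_at_top[of 0]])
      fix t :: real assume "t > 0"
      moreover have "t * x - t * y = t * (x - y)" by (simp add: algebra_simps)
      ultimately show "(p (t * x) * q (t * y) - q (t * x) * p (t * y)) / (x - y)
        = t * k (t * x) (t * y)"
        using False by (simp add: whittaker_k_def)
    qed
  qed
qed

text \<open>The singular-looking quotient is the integral of the dilation derivative from \<open>t = 1\<close> to infinity,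
  which needs no distinction between \<open>x\<close> near \<open>y\<close> and \<open>x\<close> far from \<open>y\<close>. The integration is done by
  comparing with the function \<open>E\<close>, whose derivative is minus the bound of the dilation derivative.\<close>

lemma kernel_bound:
  assumes "x \<noteq> 0" "y \<noteq> 0"
  shows "\<bar>k x y\<bar> \<le> 4 * M\<^sup>2 / (\<bar>x\<bar> + \<bar>y\<bar>) * exp (- (\<bar>x\<bar> + \<bar>y\<bar>) / 4)"
proof -
  define s where "s = \<bar>x\<bar> + \<bar>y\<bar>"
  have s: "s > 0" using assms by (simp add: s_def)
  define E where "E t = 4 * M\<^sup>2 / s * exp (- (t * s) / 4)" for t
  define \<phi> where "\<phi> t = t * k (t * x) (t * y)" for t
  define \<phi>' where "\<phi>' t = - (p (t * x) * q (t * y) + q (t * x) * p (t * y)) / 2" for t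
  have d\<phi>: "(\<phi> has_real_derivative \<phi>' t) (at t)" if "t > 0" for t
    unfolding \<phi>_def[abs_def] \<phi>'_def using kernel_dilation_deriv[OF assms that] .
  have dE: "(E has_real_derivative - (M\<^sup>2 * exp (- (t * s) / 4))) (at t)" for t
  proof -
    have "((\<lambda>t. - (t * s) / 4) has_real_derivative - s / 4) (at t)"
      by (auto intro!: derivative_eq_intros)
    from DERIV_cmult[OF DERIV_chain2[OF DERIV_exp this], of "4 * M\<^sup>2 / s"]
    show ?thesis unfolding E_def[abs_def] by (rule DERIV_cong) (use s in simp)
  qed
  have b: "\<bar>\<phi>' t\<bar> \<le> M\<^sup>2 * exp (- (t * s) / 4)" if "t > 0" for t
  proof -
    have e: "exp (- \<bar>t * x\<bar> / 4) * exp (- \<bar>t * y\<bar> / 4) = exp (- (t * s) / 4)"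
      using that by (simp add: s_def abs_mult algebra_simps add_divide_distrib flip: exp_add)
    have "\<bar>p (t * x) * q (t * y)\<bar> \<le> (M * exp (- \<bar>t * x\<bar> / 4)) * (M * exp (- \<bar>t * y\<bar> / 4))"
      "\<bar>q (t * x) * p (t * y)\<bar> \<le> (M * exp (- \<bar>t * x\<bar> / 4)) * (M * exp (- \<bar>t * y\<bar> / 4))"
      unfolding abs_mult[of "p _"] abs_mult[of "q _"] using that assms M_nonneg
      by (intro mult_mono p_bound q_bound; simp)+
    moreover have "(M * exp (- \<bar>t * x\<bar> / 4)) * (M * exp (- \<bar>t * y\<bar> / 4)) = M\<^sup>2 * exp (- (t * s) / 4)"
      unfolding e[symmetric] by (simp add: power2_eq_square)
    ultimately have "\<bar>p (t * x) * q (t * y) + q (t * x) * p (t * y)\<bar> \<le> 2 * (M\<^sup>2 * exp (- (t * s) / 4))"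
      by linarith
    then show ?thesis by (simp add: \<phi>'_def)
  qed
  have lim: "(\<phi> \<longlongrightarrow> 0) at_top" unfolding \<phi>_def[abs_def] by (rule kernel_dilation_tendsto[OF assms])
  have limE: "(E \<longlongrightarrow> 0) at_top"
    using exp_decay_dilate[of s "4 * M\<^sup>2 / s"] s unfolding E_def[abs_def]
    by (rule_tac Lim_transform_eventually)
      (auto intro!: eventually_mono[OF eventually_ge_at_top[of 0]])
  have 1: "\<phi> t + E t \<le> \<phi> 1 + E 1" "\<phi> 1 - E 1 \<le> \<phi> t - E t" if "1 \<le> t" for t :: real
  proof -
    show "\<phi> t + E t \<le> \<phi> 1 + E 1"
    proof (rule DERIV_nonpos_imp_nonincreasing[OF that], rule exI, rule conjI)
      fix x :: real assume "1 \<le> x"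
      then have x: "x > 0" by simp
      show "((\<lambda>t. \<phi> t + E t) has_real_derivative (\<phi>' x + - (M\<^sup>2 * exp (- (x * s) / 4)))) (at x)"
        by (intro DERIV_add d\<phi> dE x)
      show "\<phi>' x + - (M\<^sup>2 * exp (- (x * s) / 4)) \<le> 0" using b[OF x] by linarith
    qed
    show "\<phi> 1 - E 1 \<le> \<phi> t - E t"
    proof (rule DERIV_nonneg_imp_nondecreasing[OF that], rule exI, rule conjI)
      fix x :: real assume "1 \<le> x"
      then have x: "x > 0" by simp
      show "((\<lambda>t. \<phi> t - E t) has_real_derivative (\<phi>' x - - (M\<^sup>2 * exp (- (x * s) / 4)))) (at x)"
        by (intro DERIV_diff d\<phi> dE x)
      show "0 \<le> \<phi>' x - - (M\<^sup>2 * exp (- (x * s) / 4))" using b[OF x] by linarith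
    qed
  qed
  have "0 + 0 \<le> \<phi> 1 + E 1"
    by (rule tendsto_upperbound[OF tendsto_add[OF lim limE]])
      (auto intro!: eventually_mono[OF eventually_ge_at_top[of 1]] 1)
  moreover have "\<phi> 1 - E 1 \<le> 0 - 0"
    by (rule tendsto_lowerbound[OF tendsto_diff[OF lim limE]])
      (auto intro!: eventually_mono[OF eventually_ge_at_top[of 1]] 1)
  ultimately have "\<bar>\<phi> 1\<bar> \<le> E 1" by linarith
  then show ?thesis by (simp add: \<phi>_def E_def s_def)
qed

end


section \<open>Pairings with the kernel under dilation\<close>

lemma inverse_square_integral:
  "set_integrable lborel {0<..} (\<lambda>y::real. 1 / (1 + \<bar>y\<bar>)\<^sup>2)"
  "(LBINT y:{0<..}. 1 / (1 + \<bar>y::real\<bar>)\<^sup>2) = 1"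
proof -
  have "(\<integral>\<^sup>+y. ennreal (1 / (1 + y)\<^sup>2) * indicator {0::real ..} y \<partial>lborel) = ennreal (0 - (- 1 / (1 + 0)))"
  proof (rule nn_integral_FTC_atLeast)
    show "((\<lambda>y. - 1 / (1 + y)) has_real_derivative 1 / (1 + y)\<^sup>2) (at y)" if "0 \<le> y" for y :: real
      using that by (auto intro!: derivative_eq_intros simp: power2_eq_square)
    show "((\<lambda>y::real. - 1 / (1 + y)) \<longlongrightarrow> 0) at_top" by real_asymp
  qed auto
  moreover have "(\<integral>\<^sup>+y. ennreal (1 / (1 + y)\<^sup>2) * indicator {0::real ..} y \<partial>lborel)
     = (\<integral>\<^sup>+y. ennreal (indicator {0<..} y *\<^sub>R (1 / (1 + \<bar>y\<bar>)\<^sup>2)) \<partial>lborel)"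
    by (rule nn_integral_cong_AE)
      (use AE_lborel_singleton[of 0] in \<open>auto elim!: eventually_mono simp: indicator_def\<close>)
  ultimately have e: "(\<integral>\<^sup>+y. ennreal (indicator {0<..} y *\<^sub>R (1 / (1 + \<bar>y :: real\<bar>)\<^sup>2)) \<partial>lborel) = ennreal 1"
    by simp
  show "set_integrable lborel {0<..} (\<lambda>y::real. 1 / (1 + \<bar>y\<bar>)\<^sup>2)"
    unfolding set_integrable_def by (rule integrableI_nn_integral_finite[OF _ _ e]) auto
  show "(LBINT y:{0<..}. 1 / (1 + \<bar>y::real\<bar>)\<^sup>2) = 1"
    unfolding set_lebesgue_integral_def
    by (rule integral_eq_nn_integral[THEN trans]) (use e in auto)
qed

lemma integrable_inverse_square: "integrable lborel (\<lambda>y::real. 1 / (1 + \<bar>y\<bar>)\<^sup>2)"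
proof (rule Bochner_Integration.integrable_bound)
  let ?f = "\<lambda>y::real. indicator {0<..} y *\<^sub>R (1 / (1 + \<bar>y\<bar>)\<^sup>2)"
  have f: "integrable lborel ?f" using inverse_square_integral(1) by (simp add: set_integrable_def)
  show "integrable lborel (\<lambda>y. ?f y + ?f (0 + (- 1) * y))"
    by (intro Bochner_Integration.integrable_add f lborel_integrable_real_affine[OF f]) simp
  show "AE y in lborel. norm (1 / (1 + \<bar>y\<bar>)\<^sup>2) \<le> norm (?f y + ?f (0 + (- 1) * y))"
    using AE_lborel_singleton[of 0] by eventually_elim (auto simp: indicator_def)
qed simp

text \<open>The family of dominating functions for the pairings below and their derivatives.\<close>

lemma integrable_linear_exp:
  fixes A B c :: real
  assumes "c > 0"
  shows "integrable lborel (\<lambda>y::real. (A + B * \<bar>y\<bar>) * exp (- c * \<bar>y\<bar>))"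
proof (rule Bochner_Integration.integrable_bound)
  \<comment> \<open>The cube of v \<le> exp v at v = c * u / 3 gives u ^ 3 * exp (- c * u) \<le> (3 / c) ^ 3.\<close>
  define L where "L = (\<bar>A\<bar> + \<bar>B\<bar>) * ((3 / c) ^ 3 * exp c)"
  show "integrable lborel (\<lambda>y::real. L * (1 / (1 + \<bar>y\<bar>)\<^sup>2))"
    by (intro integrable_mult_right integrable_inverse_square)
  show "AE y in lborel. norm ((A + B * \<bar>y\<bar>) * exp (- c * \<bar>y\<bar>)) \<le> norm (L * (1 / (1 + \<bar>y\<bar>)\<^sup>2))"
  proof (intro AE_I2)
    fix y :: real
    define u where "u = 1 + \<bar>y\<bar>"
    have u: "u \<ge> 1" by (simp add: u_def)
    have "c * u / 3 \<le> exp (c * u / 3)" using exp_ge_add_one_self[of "c * u / 3"] by linarith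
    then have "(c * u / 3) ^ 3 \<le> exp (c * u / 3) ^ 3"
      using u assms by (intro power_mono) auto
    also have "\<dots> = exp (c * u)" by (simp flip: exp_of_nat_mult)
    finally have "u ^ 3 \<le> (3 / c) ^ 3 * exp (c * u)"
      using assms by (simp add: power_divide power_mult_distrib field_simps)
    also have "exp (c * u) = exp c * exp (c * \<bar>y\<bar>)" by (simp add: u_def algebra_simps flip: exp_add)
    finally have "u ^ 3 * exp (- c * \<bar>y\<bar>) \<le> (3 / c) ^ 3 * exp c"
      by (simp add: exp_minus field_simps)
    then have 1: "u * exp (- c * \<bar>y\<bar>) * u\<^sup>2 \<le> (3 / c) ^ 3 * exp c"
      by (simp add: power2_eq_square power3_eq_cube algebra_simps)
    have "\<bar>A + B * \<bar>y\<bar>\<bar> \<le> \<bar>A\<bar> * 1 + \<bar>B\<bar> * \<bar>y\<bar>" using abs_triangle_ineq[of A "B * \<bar>y\<bar>"] by (simp add: abs_mult)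
    also have "\<dots> \<le> \<bar>A\<bar> * u + \<bar>B\<bar> * u"
      by (intro add_mono mult_left_mono) (auto simp: u_def)
    finally have "\<bar>A + B * \<bar>y\<bar>\<bar> * exp (- c * \<bar>y\<bar>) * u\<^sup>2 \<le> (\<bar>A\<bar> + \<bar>B\<bar>) * u * exp (- c * \<bar>y\<bar>) * u\<^sup>2"
      by (intro mult_right_mono) (auto simp: algebra_simps)
    also have "\<dots> = (\<bar>A\<bar> + \<bar>B\<bar>) * (u * exp (- c * \<bar>y\<bar>) * u\<^sup>2)" by (simp add: algebra_simps)
    also have "\<dots> \<le> L" unfolding L_def using 1 by (intro mult_left_mono) auto
    finally have "\<bar>A + B * \<bar>y\<bar>\<bar> * exp (- c * \<bar>y\<bar>) \<le> L * (1 / u\<^sup>2)"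
      using u by (simp add: field_simps)
    moreover have "L \<ge> 0" using assms by (auto simp: L_def)
    ultimately show "norm ((A + B * \<bar>y\<bar>) * exp (- c * \<bar>y\<bar>)) \<le> norm (L * (1 / (1 + \<bar>y\<bar>)\<^sup>2))"
      by (simp add: abs_mult u_def)
  qed
qed auto

lemma lborel_integral_dilate:
  fixes f :: "real \<Rightarrow> real"
  assumes "t > 0"
  shows "(\<integral>y. f y \<partial>lborel) = t * (\<integral>y. f (t * y) \<partial>lborel)"
  using lborel_integral_real_affine[of t f 0] assms by simp

lemma integral_linear3:
  fixes f g h :: "'a \<Rightarrow> real"
  assumes "integrable M f" "integrable M g" "integrable M h"
  shows "(\<integral>x. u * f x + v * g x - w * h x \<partial>M) = u * (\<integral>x. f x \<partial>M) + v * (\<integral>x. g x \<partial>M) - w * (\<integral>x. h x \<partial>M)"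
  using assms by simp

context decaying_pair begin

definition kp where "kp t = (\<integral>y. k t y * p y \<partial>lborel)"
definition kq where "kq t = (\<integral>y. k t y * q y \<partial>lborel)"
definition kk where "kk t = (\<integral>y. (k t y)\<^sup>2 \<partial>lborel)"

text \<open>Bounds that are uniform for \<open>t\<close> in a neighbourhood of a given positive number: the rate \<open>c\<close> is
  chosen once for the neighbourhood.\<close>

lemma dilated_bounds:
  assumes "t > 0" "y \<noteq> 0"
  shows "\<bar>t * k t (t * y)\<bar> \<le> 4 * M\<^sup>2 / (1 + \<bar>y\<bar>) * exp (- t / 4)"
    and "\<bar>t * k t (t * y)\<bar> \<le> 4 * M\<^sup>2"
    and "c \<le> t / 4 \<Longrightarrow> \<bar>p (t * y)\<bar> \<le> M * exp (- c * \<bar>y\<bar>)"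
    and "c \<le> t / 4 \<Longrightarrow> \<bar>q (t * y)\<bar> \<le> M * exp (- c * \<bar>y\<bar>)"
    and "\<bar>p t\<bar> \<le> M" and "\<bar>q t\<bar> \<le> M"
    and "c \<le> t / 4 \<Longrightarrow> \<bar>(p t * q (t * y) + q t * p (t * y)) / 2\<bar> \<le> M\<^sup>2 * exp (- c * \<bar>y\<bar>)"
proof -
  have "\<bar>k t (t * y)\<bar> \<le> 4 * M\<^sup>2 / (\<bar>t\<bar> + \<bar>t * y\<bar>) * exp (- (\<bar>t\<bar> + \<bar>t * y\<bar>) / 4)"
    using assms by (intro kernel_bound) auto
  also have "\<dots> \<le> 4 * M\<^sup>2 / (\<bar>t\<bar> + \<bar>t * y\<bar>) * exp (- t / 4)"
    using assms by (intro mult_left_mono) auto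
  also have "4 * M\<^sup>2 / (\<bar>t\<bar> + \<bar>t * y\<bar>) = 4 * M\<^sup>2 / (1 + \<bar>y\<bar>) / t"
    using assms by (simp add: abs_mult field_simps)
  finally have "t * \<bar>k t (t * y)\<bar> \<le> t * (4 * M\<^sup>2 / (1 + \<bar>y\<bar>) / t * exp (- t / 4))"
    using assms by (intro mult_left_mono) auto
  then show 1: "\<bar>t * k t (t * y)\<bar> \<le> 4 * M\<^sup>2 / (1 + \<bar>y\<bar>) * exp (- t / 4)"
    using assms by (simp add: abs_mult)
  also have "\<dots> \<le> 4 * M\<^sup>2 * 1"
    using assms by (intro mult_mono) (auto simp: field_simps intro: add_nonneg_pos)
  finally show "\<bar>t * k t (t * y)\<bar> \<le> 4 * M\<^sup>2" by simp
  have e: "exp (- \<bar>t * y\<bar> / 4) \<le> exp (- c * \<bar>y\<bar>)" if "c \<le> t / 4"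
    using mult_right_mono[OF that, of "\<bar>y\<bar>"] assms by (simp add: abs_mult)
  show pb: "\<bar>p (t * y)\<bar> \<le> M * exp (- c * \<bar>y\<bar>)" and qb: "\<bar>q (t * y)\<bar> \<le> M * exp (- c * \<bar>y\<bar>)" if "c \<le> t / 4"
    using p_bound[of "t * y"] q_bound[of "t * y"] assms mult_left_mono[OF e[OF that] M_nonneg] by auto
  have "M * exp (- \<bar>t\<bar> / 4) \<le> M" using M_nonneg by (simp add: mult_left_le)
  then show pt: "\<bar>p t\<bar> \<le> M" and qt: "\<bar>q t\<bar> \<le> M"
    using p_bound[of t] q_bound[of t] assms by auto
  show "\<bar>(p t * q (t * y) + q t * p (t * y)) / 2\<bar> \<le> M\<^sup>2 * exp (- c * \<bar>y\<bar>)" if "c \<le> t / 4"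
  proof -
    have "\<bar>p t * q (t * y)\<bar> \<le> M * (M * exp (- c * \<bar>y\<bar>))" "\<bar>q t * p (t * y)\<bar> \<le> M * (M * exp (- c * \<bar>y\<bar>))"
      unfolding abs_mult using pt qt pb[OF that] qb[OF that] M_nonneg by (intro mult_mono; simp)+
    then have "\<bar>p t * q (t * y) + q t * p (t * y)\<bar> \<le> 2 * (M * (M * exp (- c * \<bar>y\<bar>)))" by linarith
    then show ?thesis by (simp add: power2_eq_square)
  qed
qed

lemma integrable_of_bound:
  assumes [measurable]: "f \<in> borel_measurable borel" and "c > 0"
    and "\<And>y. y \<noteq> 0 \<Longrightarrow> \<bar>f y\<bar> \<le> (A + B * \<bar>y\<bar>) * exp (- c * \<bar>y\<bar>)"
  shows "integrable lborel (f :: real \<Rightarrow> real)"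
proof (rule Bochner_Integration.integrable_bound[OF integrable_linear_exp[OF \<open>c > 0\<close>, of A B]])
  show "AE y in lborel. norm (f y) \<le> norm ((A + B * \<bar>y\<bar>) * exp (- c * \<bar>y\<bar>))"
    using AE_lborel_singleton[of 0]
  proof eventually_elim
    case (elim y)
    then show ?case using order_trans[OF assms(3)[OF elim] abs_ge_self] by simp
  qed
qed simp

lemma dilated_pairing_integrable:
  assumes "t > 0" and [measurable]: "r \<in> borel_measurable borel"
    and r: "\<And>x. x \<noteq> 0 \<Longrightarrow> \<bar>r x\<bar> \<le> M * exp (- \<bar>x\<bar> / 4)"
  shows "integrable lborel (\<lambda>y. (t * k t (t * y)) * r (t * y))"
    and "integrable lborel (\<lambda>y. r (t * y) * r (t * y))"
proof -
  have r: "\<bar>r (t * y)\<bar> \<le> M * exp (- (t / 4) * \<bar>y\<bar>)" if "y \<noteq> 0" for y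
    using r[of "t * y"] that assms(1) by (simp add: abs_mult algebra_simps)
  show "integrable lborel (\<lambda>y. (t * k t (t * y)) * r (t * y))"
  proof (rule integrable_of_bound[where c = "t / 4" and A = "4 * M\<^sup>2 * M" and B = 0])
    fix y :: real assume y: "y \<noteq> 0"
    have "\<bar>t * k t (t * y)\<bar> * \<bar>r (t * y)\<bar> \<le> 4 * M\<^sup>2 * (M * exp (- (t / 4) * \<bar>y\<bar>))"
      using M_nonneg by (intro mult_mono dilated_bounds(2) r y assms) auto
    then show "\<bar>(t * k t (t * y)) * r (t * y)\<bar> \<le> (4 * M\<^sup>2 * M + 0 * \<bar>y\<bar>) * exp (- (t / 4) * \<bar>y\<bar>)"
      by (simp add: abs_mult algebra_simps)
  qed (use assms in auto)
  show "integrable lborel (\<lambda>y. r (t * y) * r (t * y))"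
  proof (rule integrable_of_bound[where c = "t / 4" and A = "M * M" and B = 0])
    fix y :: real assume y: "y \<noteq> 0"
    have "\<bar>r (t * y)\<bar> * \<bar>r (t * y)\<bar> \<le> (M * exp (- (t / 4) * \<bar>y\<bar>)) * (M * 1)"
      using M_nonneg r[OF y] order_trans[OF r[OF y] mult_left_mono[of _ 1 M]] \<open>t > 0\<close>
      by (intro mult_mono) auto
    then show "\<bar>r (t * y) * r (t * y)\<bar> \<le> (M * M + 0 * \<bar>y\<bar>) * exp (- (t / 4) * \<bar>y\<bar>)"
      by (simp add: abs_mult algebra_simps)
  qed (use assms in auto)
qed

lemma kernel_pairing_dilate:
  assumes "t > 0"
  shows "kp t = (\<integral>y. (t * k t (t * y)) * p (t * y) \<partial>lborel)"
    and "kq t = (\<integral>y. (t * k t (t * y)) * q (t * y) \<partial>lborel)"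
    and "t * kk t = (\<integral>y. (t * k t (t * y))\<^sup>2 \<partial>lborel)"
  using lborel_integral_dilate[OF assms, of "\<lambda>y. k t y * p y"]
    lborel_integral_dilate[OF assms, of "\<lambda>y. k t y * q y"]
    lborel_integral_dilate[OF assms, of "\<lambda>y. (k t y)\<^sup>2"]
  by (simp_all add: kp_def kq_def kk_def mult.assoc power_mult_distrib)
    (simp add: power2_eq_square)

text \<open>After the substitution of \<open>ty\<close> for \<open>y\<close> the pairing depends on \<open>t\<close> only through dilations, so both
  factors have an explicit derivative. The form of the derivative of \<open>r\<close> covers \<open>r = p\<close> and \<open>r = q\<close>.\<close>

lemma pairing_dilation_deriv:
  assumes t0: "t0 > 0" and r_meas[measurable]: "r \<in> borel_measurable borel"
    and r: "\<And>x. x \<noteq> 0 \<Longrightarrow> \<bar>r x\<bar> \<le> M * exp (- \<bar>x\<bar> / 4)"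
    and r_deriv: "\<And>x. x \<noteq> 0 \<Longrightarrow> (r has_real_derivative ((a1 / x + b1) * p x + (a2 / x + b2) * q x)) (at x)"
  defines "f' \<equiv> \<lambda>t y. - (p t * q (t * y) + q t * p (t * y)) / 2 * r (t * y)
      + ((a1 / t + b1 * y) * p (t * y) + (a2 / t + b2 * y) * q (t * y)) * (t * k t (t * y))"
  shows "((\<lambda>t. \<integral>y. (t * k t (t * y)) * r (t * y) \<partial>lborel) has_real_derivative
      (\<integral>y. f' t0 y \<partial>lborel)) (at t0)"
proof (rule has_real_derivative_integral_dominated(1))
  define c where "c = t0 / 8"
  define A where "A = M\<^sup>2 * M + (\<bar>a1\<bar> + \<bar>a2\<bar>) * (2 / t0) * M * (4 * M\<^sup>2)"
  define B where "B = (\<bar>b1\<bar> + \<bar>b2\<bar>) * M * (4 * M\<^sup>2)"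
  have c: "c > 0" using t0 by (simp add: c_def)
  show "t0 / 2 < t0" "t0 < 2 * t0" using t0 by auto
  show "integrable lborel (\<lambda>y. (t * k t (t * y)) * r (t * y))" if "t0 / 2 < t" "t < 2 * t0" for t
    using that t0 r by (intro dilated_pairing_integrable) auto
  show "integrable lborel (\<lambda>y. (A + B * \<bar>y\<bar>) * exp (- c * \<bar>y\<bar>))"
    by (rule integrable_linear_exp[OF c])
  show "f' t0 \<in> borel_measurable lborel" unfolding f'_def by measurable
  show "AE y in lborel. \<forall>t. t0 / 2 < t \<and> t < 2 * t0 \<longrightarrow>
      ((\<lambda>t. (t * k t (t * y)) * r (t * y)) has_real_derivative f' t y) (at t) \<and>
      \<bar>f' t y\<bar> \<le> (A + B * \<bar>y\<bar>) * exp (- c * \<bar>y\<bar>)"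
    using AE_lborel_singleton[of 0]
  proof eventually_elim
    case (elim y)
    show ?case
    proof (intro allI impI conjI)
      fix t assume "t0 / 2 < t \<and> t < 2 * t0"
      then have t: "t > 0" "c \<le> t / 4" "t0 / 2 < t" using t0 by (auto simp: c_def)
      have l: "((\<lambda>t. t * y) has_real_derivative y) (at t)"
        by (rule DERIV_cong[OF DERIV_cmult_right[OF DERIV_ident]]) simp
      have "((\<lambda>t. r (t * y)) has_real_derivative
          ((a1 / t + b1 * y) * p (t * y) + (a2 / t + b2 * y) * q (t * y))) (at t)"
        by (rule DERIV_cong[OF DERIV_chain2[OF r_deriv l]])
          (use elim t in \<open>simp_all add: field_simps\<close>)
      from DERIV_mult[OF kernel_dilation_deriv[of 1 y t] this]
      show "((\<lambda>t. (t * k t (t * y)) * r (t * y)) has_real_derivative f' t y) (at t)"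
        using elim t by (simp add: f'_def)
      note b = dilated_bounds[OF t(1) elim]
      let ?e = "exp (- c * \<bar>y\<bar>)"
      have rb: "\<bar>r (t * y)\<bar> \<le> M"
        using r[of "t * y"] elim t mult_left_mono[of "exp (- \<bar>t * y\<bar> / 4)" 1 M] M_nonneg by auto
      have 1: "\<bar>- (p t * q (t * y) + q t * p (t * y)) / 2 * r (t * y)\<bar> \<le> (M\<^sup>2 * ?e) * M"
        unfolding abs_mult using b(7)[OF t(2)] rb by (intro mult_mono) auto
      have at: "\<bar>u / t\<bar> \<le> \<bar>u\<bar> * (2 / t0)" for u
      proof -
        have "1 / t \<le> 2 / t0" using t t0 by (simp add: field_simps)
        from mult_left_mono[OF this, of "\<bar>u\<bar>"] show ?thesis using t by simp
      qed
      have lin: "\<bar>(u / t + v * y) * w\<bar> \<le> (\<bar>u\<bar> * (2 / t0) + \<bar>v\<bar> * \<bar>y\<bar>) * (M * ?e)"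
        if "\<bar>w\<bar> \<le> M * ?e" for u v w
      proof -
        have "\<bar>u / t + v * y\<bar> \<le> \<bar>u\<bar> * (2 / t0) + \<bar>v\<bar> * \<bar>y\<bar>"
          using abs_triangle_ineq[of "u / t" "v * y"] at[of u] by (simp add: abs_mult)
        then show ?thesis unfolding abs_mult[of "_ + _"] using that t0
          by (intro mult_mono) auto
      qed
      have "\<bar>(a1 / t + b1 * y) * p (t * y) + (a2 / t + b2 * y) * q (t * y)\<bar>
          \<le> (\<bar>a1\<bar> * (2 / t0) + \<bar>b1\<bar> * \<bar>y\<bar>) * (M * ?e) + (\<bar>a2\<bar> * (2 / t0) + \<bar>b2\<bar> * \<bar>y\<bar>) * (M * ?e)"
        by (intro order_trans[OF abs_triangle_ineq] add_mono lin b(3,4) t)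
      then have 2: "\<bar>((a1 / t + b1 * y) * p (t * y) + (a2 / t + b2 * y) * q (t * y)) * (t * k t (t * y))\<bar>
          \<le> ((\<bar>a1\<bar> * (2 / t0) + \<bar>b1\<bar> * \<bar>y\<bar>) * (M * ?e) + (\<bar>a2\<bar> * (2 / t0) + \<bar>b2\<bar> * \<bar>y\<bar>) * (M * ?e)) * (4 * M\<^sup>2)"
        unfolding abs_mult[of "_ + _"] using b(2) t0 M_nonneg
        by (intro mult_mono add_nonneg_nonneg mult_nonneg_nonneg) auto
      have "\<bar>f' t y\<bar> \<le> (M\<^sup>2 * ?e) * M + ((\<bar>a1\<bar> * (2 / t0) + \<bar>b1\<bar> * \<bar>y\<bar>) * (M * ?e)
          + (\<bar>a2\<bar> * (2 / t0) + \<bar>b2\<bar> * \<bar>y\<bar>) * (M * ?e)) * (4 * M\<^sup>2)"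
        unfolding f'_def by (rule order_trans[OF abs_triangle_ineq add_mono[OF 1 2]])
      also have "\<dots> = (A + B * \<bar>y\<bar>) * ?e"
        unfolding A_def B_def by (simp add: algebra_simps add_divide_distrib)
      finally show "\<bar>f' t y\<bar> \<le> (A + B * \<bar>y\<bar>) * exp (- c * \<bar>y\<bar>)" .
    qed
  qed
qed

definition pp where "pp = (\<integral>y. p y * p y \<partial>lborel)"
definition qq where "qq = (\<integral>y. q y * q y \<partial>lborel)"

text \<open>Multiplication by \<open>y\<close> commutes with the kernel up to an operator of rank two. It removes the
  factors \<open>y\<close> that the terms \<open>\<plusminus> x/2\<close> of the system put into the derivatives.\<close>

lemma dilated_kernel_mult:
  assumes "t > 0"
  shows "(t * k t (t * y)) * y = t * k t (t * y) - (p t * q (t * y) - q t * p (t * y))"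
proof (cases "y = 1")
  case False
  then have "t - t * y \<noteq> 0" using assms by simp
  then have "t * k t (t * y) * (1 - y) = p t * q (t * y) - q t * p (t * y)"
    by (simp add: whittaker_k_def) (simp add: algebra_simps divide_simps)
  then show ?thesis by (simp add: algebra_simps)
qed auto

text \<open>The pairings with \<open>p\<close> and \<open>q\<close> solve the system of \<open>(p, q)\<close> except for inhomogeneous terms, whose
  coefficients are the integrals of \<open>p\<^sup>2\<close> and \<open>q\<^sup>2\<close>.\<close>

lemma kp_deriv:
  assumes t: "t > 0"
  shows "(kp has_real_derivative ((a / t - 1/2) * kp t + \<rho> / t * kq t - pp / t * q t)) (at t)"
proof -
  define f' where "f' y = - (p t * q (t * y) + q t * p (t * y)) / 2 * p (t * y)
      + ((a / t + (- 1/2) * y) * p (t * y) + (\<rho> / t + 0 * y) * q (t * y)) * (t * k t (t * y))" for y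
  have d: "((\<lambda>t. \<integral>y. (t * k t (t * y)) * p (t * y) \<partial>lborel) has_real_derivative (\<integral>y. f' y \<partial>lborel)) (at t)"
    unfolding f'_def by (rule pairing_dilation_deriv[OF t]) (use p_bound p_deriv in \<open>auto simp: algebra_simps\<close>)
  have e: "f' y = (a / t - 1/2) * (t * k t (t * y) * p (t * y)) + \<rho> / t * (t * k t (t * y) * q (t * y))
      - q t * (p (t * y) * p (t * y))" for y
  proof -
    have "f' y = - (p t * q (t * y) + q t * p (t * y)) / 2 * p (t * y)
      + (a / t * p (t * y) + \<rho> / t * q (t * y)) * (t * k t (t * y)) - 1/2 * p (t * y) * (t * k t (t * y) * y)"
      unfolding f'_def by (simp add: algebra_simps)
    also have "\<dots> = (a / t - 1/2) * (t * k t (t * y) * p (t * y)) + \<rho> / t * (t * k t (t * y) * q (t * y))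
      - q t * (p (t * y) * p (t * y))"
      unfolding dilated_kernel_mult[OF t] by (simp add: field_simps)
    finally show ?thesis .
  qed
  have int: "integrable lborel (\<lambda>y. t * k t (t * y) * p (t * y))" "integrable lborel (\<lambda>y. t * k t (t * y) * q (t * y))"
    "integrable lborel (\<lambda>y. p (t * y) * p (t * y))"
    using dilated_pairing_integrable[OF t, of p] dilated_pairing_integrable[OF t, of q] p_bound q_bound by auto
  have "(\<integral>y. p (t * y) * p (t * y) \<partial>lborel) = pp / t"
    using lborel_integral_dilate[OF t, of "\<lambda>y. p y * p y"] t by (simp add: pp_def)
  then have "(\<integral>y. f' y \<partial>lborel) = (a / t - 1/2) * kp t + \<rho> / t * kq t - q t * (pp / t)"
    unfolding e kernel_pairing_dilate[OF t] by (simp only: integral_linear3[OF int])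
  moreover have "\<forall>\<^sub>F s in nhds t. kp s = (\<integral>y. (s * k s (s * y)) * p (s * y) \<partial>lborel)"
    by (rule eventually_nhds_in_open[of "{0<..}", THEN eventually_mono])
      (use t kernel_pairing_dilate in auto)
  ultimately show ?thesis using d
    by (subst DERIV_cong_ev[OF refl _ refl]) (auto simp: mult_ac)
qed

lemma kq_deriv:
  assumes t: "t > 0"
  shows "(kq has_real_derivative (- (a / t - 1/2) * kq t - \<rho> / t * kp t - qq / t * p t)) (at t)"
proof -
  define f' where "f' y = - (p t * q (t * y) + q t * p (t * y)) / 2 * q (t * y)
      + ((- \<rho> / t + 0 * y) * p (t * y) + (- a / t + (1/2) * y) * q (t * y)) * (t * k t (t * y))" for y
  have d: "((\<lambda>t. \<integral>y. (t * k t (t * y)) * q (t * y) \<partial>lborel) has_real_derivative (\<integral>y. f' y \<partial>lborel)) (at t)"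
    unfolding f'_def by (rule pairing_dilation_deriv[OF t]) (use q_bound q_deriv in \<open>auto simp: algebra_simps\<close>)
  have e: "f' y = - (a / t - 1/2) * (t * k t (t * y) * q (t * y)) + (- \<rho> / t) * (t * k t (t * y) * p (t * y))
      - p t * (q (t * y) * q (t * y))" for y
  proof -
    have "f' y = - (p t * q (t * y) + q t * p (t * y)) / 2 * q (t * y)
      - (\<rho> / t * p (t * y) + a / t * q (t * y)) * (t * k t (t * y)) + 1/2 * q (t * y) * (t * k t (t * y) * y)"
      unfolding f'_def by (simp add: algebra_simps)
    also have "\<dots> = - (a / t - 1/2) * (t * k t (t * y) * q (t * y)) - \<rho> / t * (t * k t (t * y) * p (t * y))
      - p t * (q (t * y) * q (t * y))"
      unfolding dilated_kernel_mult[OF t] by (simp add: field_simps)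
    finally show ?thesis by simp
  qed
  have int: "integrable lborel (\<lambda>y. t * k t (t * y) * q (t * y))" "integrable lborel (\<lambda>y. t * k t (t * y) * p (t * y))"
    "integrable lborel (\<lambda>y. q (t * y) * q (t * y))"
    using dilated_pairing_integrable[OF t, of p] dilated_pairing_integrable[OF t, of q] p_bound q_bound by auto
  have "(\<integral>y. q (t * y) * q (t * y) \<partial>lborel) = qq / t"
    using lborel_integral_dilate[OF t, of "\<lambda>y. q y * q y"] t by (simp add: qq_def)
  then have "(\<integral>y. f' y \<partial>lborel) = - (a / t - 1/2) * kq t + (- \<rho> / t) * kp t - p t * (qq / t)"
    unfolding e kernel_pairing_dilate[OF t] by (simp only: integral_linear3[OF int])
  moreover have "\<forall>\<^sub>F s in nhds t. kq s = (\<integral>y. (s * k s (s * y)) * q (s * y) \<partial>lborel)"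
    by (rule eventually_nhds_in_open[of "{0<..}", THEN eventually_mono])
      (use t kernel_pairing_dilate in auto)
  ultimately show ?thesis using d
    by (subst DERIV_cong_ev[OF refl _ refl]) (auto simp: mult_ac)
qed

end

lemma DERIV_zero_tendsto_imp_eq:
  fixes f :: "real \<Rightarrow> real"
  assumes "\<And>t. t > 0 \<Longrightarrow> (f has_real_derivative 0) (at t)" "(f \<longlongrightarrow> l) at_top" "t > 0"
  shows "f t = l"
proof -
  have const: "f s = f t" if "s > t" for s
    by (rule DERIV_isconst_end[OF that])
      (use assms that in \<open>auto intro!: DERIV_isCont[where D = 0] continuous_at_imp_continuous_on\<close>)
  have "(f \<longlongrightarrow> f t) at_top"
    by (rule tendsto_eventually, rule eventually_mono[OF eventually_gt_at_top[of t]], rule const)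
  from tendsto_unique[OF _ this assms(2)] show ?thesis by simp
qed

context decaying_pair begin

text \<open>The factor \<open>exp (- t/2)\<close> makes the total mass vanish as \<open>t\<close> tends to infinity, which fixes the
  constant of integration later.\<close>

lemma dilated_kernel_square_integrable:
  assumes "t > 0"
  shows "integrable lborel (\<lambda>y. (t * k t (t * y))\<^sup>2)"
    and "(\<integral>y. (t * k t (t * y))\<^sup>2 \<partial>lborel)
      \<le> 16 * M ^ 4 * (\<integral>y. 1 / (1 + \<bar>y\<bar>)\<^sup>2 \<partial>lborel) * exp (- t / 2)"
proof -
  have le: "AE y in lborel. (t * k t (t * y))\<^sup>2 \<le> 16 * M ^ 4 * exp (- t / 2) * (1 / (1 + \<bar>y\<bar>)\<^sup>2)"
    using AE_lborel_singleton[of 0]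
  proof eventually_elim
    case (elim y)
    have "\<bar>t * k t (t * y)\<bar>\<^sup>2 \<le> (4 * M\<^sup>2 / (1 + \<bar>y\<bar>) * exp (- t / 4))\<^sup>2"
      by (intro power_mono dilated_bounds(1) assms elim) auto
    moreover have "exp (- t / 4) ^ 2 = exp (- t / 2)" by (simp flip: exp_of_nat_mult)
    ultimately show ?case by (simp add: power_mult_distrib power_divide)
  qed
  have int: "integrable lborel (\<lambda>y::real. 16 * M ^ 4 * exp (- t / 2) * (1 / (1 + \<bar>y\<bar>)\<^sup>2))"
    by (intro integrable_mult_right integrable_inverse_square)
  show int2: "integrable lborel (\<lambda>y. (t * k t (t * y))\<^sup>2)"
    by (rule Bochner_Integration.integrable_bound[OF int])
      (use le in \<open>auto elim!: eventually_mono intro: order_trans\<close>)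
  from integral_mono_AE[OF int2 int le]
  show "(\<integral>y. (t * k t (t * y))\<^sup>2 \<partial>lborel)
      \<le> 16 * M ^ 4 * (\<integral>y. 1 / (1 + \<bar>y\<bar>)\<^sup>2 \<partial>lborel) * exp (- t / 2)"
    unfolding integral_mult_right_zero by (simp only: mult_ac)
qed

lemma kk_deriv:
  assumes t0: "t0 > 0"
  shows "((\<lambda>t. t * kk t) has_real_derivative - (p t0 * kq t0 + q t0 * kp t0)) (at t0)"
proof -
  define f' where "f' t y = - (2 * (t * k t (t * y)) * ((p t * q (t * y) + q t * p (t * y)) / 2))" for t y
  define c where "c = t0 / 8"
  have c: "c > 0" using t0 by (simp add: c_def)
  have d: "((\<lambda>t. \<integral>y. (t * k t (t * y))\<^sup>2 \<partial>lborel) has_real_derivative (\<integral>y. f' t0 y \<partial>lborel)) (at t0)"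
  proof (rule has_real_derivative_integral_dominated(1))
    show "t0 / 2 < t0" "t0 < 2 * t0" using t0 by auto
    show "integrable lborel (\<lambda>y. (t * k t (t * y))\<^sup>2)" if "t0 / 2 < t" "t < 2 * t0" for t
      using that t0 by (intro dilated_kernel_square_integrable) auto
    show "integrable lborel (\<lambda>y. (8 * M ^ 4 + 0 * \<bar>y\<bar>) * exp (- c * \<bar>y\<bar>))"
      by (rule integrable_linear_exp[OF c])
    show "f' t0 \<in> borel_measurable lborel" unfolding f'_def by measurable
    show "AE y in lborel. \<forall>t. t0 / 2 < t \<and> t < 2 * t0 \<longrightarrow>
        ((\<lambda>t. (t * k t (t * y))\<^sup>2) has_real_derivative f' t y) (at t) \<and>
        \<bar>f' t y\<bar> \<le> (8 * M ^ 4 + 0 * \<bar>y\<bar>) * exp (- c * \<bar>y\<bar>)"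
      using AE_lborel_singleton[of 0]
    proof eventually_elim
      case (elim y)
      show ?case
      proof (intro allI impI conjI)
        fix t assume "t0 / 2 < t \<and> t < 2 * t0"
        then have t: "t > 0" "c \<le> t / 4" using t0 by (auto simp: c_def)
        have "((\<lambda>t. t * k t (t * y)) has_real_derivative
            - (p t * q (t * y) + q t * p (t * y)) / 2) (at t)"
          using kernel_dilation_deriv[of 1 y t] elim t by simp
        from DERIV_power[OF this, of 2]
        show "((\<lambda>t. (t * k t (t * y))\<^sup>2) has_real_derivative f' t y) (at t)"
          by (rule DERIV_cong) (simp add: f'_def field_simps)
        have "\<bar>f' t y\<bar> = 2 * (\<bar>t * k t (t * y)\<bar> * \<bar>(p t * q (t * y) + q t * p (t * y)) / 2\<bar>)"
          by (simp add: f'_def abs_mult)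
        also have "\<dots> \<le> 2 * ((4 * M\<^sup>2) * (M\<^sup>2 * exp (- c * \<bar>y\<bar>)))"
          by (intro mult_left_mono mult_mono dilated_bounds t elim) auto
        also have "\<dots> = (8 * M ^ 4 + 0 * \<bar>y\<bar>) * exp (- c * \<bar>y\<bar>)"
          by (simp flip: power_add)
        finally show "\<bar>f' t y\<bar> \<le> (8 * M ^ 4 + 0 * \<bar>y\<bar>) * exp (- c * \<bar>y\<bar>)" .
      qed
    qed
  qed
  have int: "integrable lborel (\<lambda>y. t0 * k t0 (t0 * y) * p (t0 * y))" "integrable lborel (\<lambda>y. t0 * k t0 (t0 * y) * q (t0 * y))"
    using dilated_pairing_integrable[OF t0, of p] dilated_pairing_integrable[OF t0, of q] p_bound q_bound by auto
  have e: "f' t0 y = - p t0 * (t0 * k t0 (t0 * y) * q (t0 * y)) + (- q t0) * (t0 * k t0 (t0 * y) * p (t0 * y))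
      - 0 * (t0 * k t0 (t0 * y) * p (t0 * y))" for y
    unfolding f'_def by (simp add: algebra_simps)
  have "(\<integral>y. f' t0 y \<partial>lborel) = - p t0 * kq t0 + (- q t0) * kp t0 - 0 * kp t0"
    unfolding e kernel_pairing_dilate[OF t0] by (simp only: integral_linear3[OF int(2,1,1)])
  then have "(\<integral>y. f' t0 y \<partial>lborel) = - (p t0 * kq t0 + q t0 * kp t0)" by simp
  moreover have "\<forall>\<^sub>F s in nhds t0. s * kk s = (\<integral>y. (s * k s (s * y))\<^sup>2 \<partial>lborel)"
    by (rule eventually_nhds_in_open[of "{0<..}", THEN eventually_mono])
      (use t0 kernel_pairing_dilate in auto)
  ultimately show ?thesis using d
    by (subst DERIV_cong_ev[OF refl _ refl]) auto
qed

lemma kk_tendsto: "((\<lambda>t. t * kk t) \<longlongrightarrow> 0) at_top"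
proof (rule Lim_null_comparison)
  let ?C = "16 * M ^ 4 * (\<integral>y. 1 / (1 + \<bar>y :: real\<bar>)\<^sup>2 \<partial>lborel)"
  show "\<forall>\<^sub>F t in at_top. norm (t * kk t) \<le> ?C * exp (- \<bar>t * 2\<bar> / 4)"
  proof (rule eventually_mono[OF eventually_gt_at_top[of 0]])
    fix t :: real assume t: "t > 0"
    have "t * kk t \<ge> 0" using t by (simp add: kk_def)
    then show "norm (t * kk t) \<le> ?C * exp (- \<bar>t * 2\<bar> / 4)"
      using dilated_kernel_square_integrable(2)[OF t] kernel_pairing_dilate(3)[OF t] t by simp
  qed
qed (rule exp_decay_dilate, simp)

lemma pairing_bound:
  assumes "t \<ge> 1" and [measurable]: "r \<in> borel_measurable borel"
    and r: "\<And>x. x \<noteq> 0 \<Longrightarrow> \<bar>r x\<bar> \<le> M * exp (- \<bar>x\<bar> / 4)"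
  shows "\<bar>\<integral>y. k t y * r y \<partial>lborel\<bar> \<le> (\<integral>y. (4 * M\<^sup>2 * M + 0 * \<bar>y\<bar>) * exp (- (1/4) * \<bar>y\<bar>) \<partial>lborel)"
proof -
  have b: "\<bar>k t y * r y\<bar> \<le> (4 * M\<^sup>2 * M + 0 * \<bar>y\<bar>) * exp (- (1/4) * \<bar>y\<bar>)" if "y \<noteq> 0" for y
  proof -
    have "\<bar>k t y\<bar> \<le> 4 * M\<^sup>2 / (\<bar>t\<bar> + \<bar>y\<bar>) * exp (- (\<bar>t\<bar> + \<bar>y\<bar>) / 4)"
      using that assms(1) by (intro kernel_bound) auto
    also have "\<dots> \<le> 4 * M\<^sup>2 / 1 * 1"
      using that assms(1) by (intro mult_mono frac_le) auto
    finally have "\<bar>k t y\<bar> * \<bar>r y\<bar> \<le> (4 * M\<^sup>2 / 1 * 1) * (M * exp (- \<bar>y\<bar> / 4))"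
      using r[OF that] by (intro mult_mono) auto
    then show ?thesis by (simp add: abs_mult)
  qed
  have int: "integrable lborel (\<lambda>y. k t y * r y)"
    by (rule integrable_of_bound[OF _ _ b]) auto
  have "\<bar>\<integral>y. k t y * r y \<partial>lborel\<bar> \<le> (\<integral>y. \<bar>k t y * r y\<bar> \<partial>lborel)"
    by (rule integral_abs_bound)
  also have "\<dots> \<le> (\<integral>y. (4 * M\<^sup>2 * M + 0 * \<bar>y\<bar>) * exp (- (1/4) * \<bar>y\<bar>) \<partial>lborel)"
  proof (rule integral_mono_AE)
    show "integrable lborel (\<lambda>y. \<bar>k t y * r y\<bar>)" using int by (rule integrable_abs)
    show "integrable lborel (\<lambda>y. (4 * M\<^sup>2 * M + 0 * \<bar>y\<bar>) * exp (- (1/4) * \<bar>y\<bar>))"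
      by (rule integrable_linear_exp) simp
    show "AE y in lborel. \<bar>k t y * r y\<bar> \<le> (4 * M\<^sup>2 * M + 0 * \<bar>y\<bar>) * exp (- (1/4) * \<bar>y\<bar>)"
      using AE_lborel_singleton[of 0] by eventually_elim (rule b)
  qed
  finally show ?thesis .
qed

text \<open>If the two squared norms agree, subtracting a multiple of \<open>q\<close> from the second pairing turns the
  pairings into an exact solution of the system. Its Wronskian with \<open>(p, q)\<close> is constant because the system
  is traceless, and vanishes at infinity; so by uniqueness the solution is a multiple of \<open>(p, q)\<close>. Then the derivatives
  of both sides are multiples of \<open>p q\<close>, and both sides vanish at infinity.\<close>

lemma kk_proportional:
  assumes \<rho>: "\<rho> > 0" and eq: "pp = qq"
  shows "\<exists>c. \<forall>t>0. t * kk t = c * H t"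
proof (cases "\<exists>t>0. p t \<noteq> 0 \<or> q t \<noteq> 0")
  case False
  then have z: "p t = 0" "q t = 0" if "t > 0" for t using that by auto
  have "kk t = 0" if "t > 0" for t
  proof -
    have "k t y = 0" for y using z[OF that]
      by (cases "t = y") (simp_all add: whittaker_k_def scaled_density_def)
    then show ?thesis by (simp add: kk_def)
  qed
  then show ?thesis by (intro exI[of _ 0]) auto
next
  case True
  then obtain t1 where t1: "t1 > 0" "p t1 \<noteq> 0 \<or> q t1 \<noteq> 0" by auto
  define m where "m = pp"
  \<comment> \<open>The shift by a multiple of q absorbs the inhomogeneous terms of both equations at once.\<close>
  define u where "u t = kq t - m / \<rho> * q t" for t
  have du: "(u has_real_derivative (- (a / t - 1/2) * u t - \<rho> / t * kp t)) (at t)" if "t > 0" for t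
    unfolding u_def[abs_def]
    by (rule DERIV_cong[OF DERIV_diff[OF kq_deriv[OF that] DERIV_cmult[OF q_deriv]]])
      (use that \<rho> eq in \<open>simp_all add: m_def field_simps\<close>)
  have dk: "(kp has_real_derivative ((a / t - 1/2) * kp t + \<rho> / t * u t)) (at t)" if "t > 0" for t
    by (rule DERIV_cong[OF kp_deriv[OF that]])
      (use that \<rho> eq in \<open>simp_all add: m_def u_def field_simps\<close>)
  have W: "p t * u t - q t * kp t = 0" if "t > 0" for t
  proof (rule DERIV_zero_tendsto_imp_eq[OF _ _ that])
    fix t :: real assume t: "t > 0"
    then have "t \<noteq> 0" by simp
    show "((\<lambda>t. p t * u t - q t * kp t) has_real_derivative 0) (at t)"
      by (rule DERIV_cong[OF DERIV_diff[OF DERIV_mult[OF p_deriv[OF \<open>t \<noteq> 0\<close>] du[OF t]]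
            DERIV_mult[OF q_deriv[OF \<open>t \<noteq> 0\<close>] dk[OF t]]]])
        (simp add: algebra_simps)
  next
    define C where "C = (\<integral>y. (4 * M\<^sup>2 * M + 0 * \<bar>y\<bar>) * exp (- (1/4) * \<bar>y\<bar>) \<partial>lborel)"
    have kb: "\<bar>kp t\<bar> \<le> C" "\<bar>kq t\<bar> \<le> C" if "t \<ge> 1" for t
      unfolding kp_def kq_def C_def using that p_bound q_bound by (intro pairing_bound; simp)+
    have bl: "((\<lambda>t. f t * g t) \<longlongrightarrow> 0) at_top"
      if "(f \<longlongrightarrow> 0) at_top" "\<And>t. t \<ge> 1 \<Longrightarrow> \<bar>g t\<bar> \<le> C" for f g :: "real \<Rightarrow> real"
    proof (rule Lim_null_comparison)
      show "\<forall>\<^sub>F t in at_top. norm (f t * g t) \<le> \<bar>f t\<bar> * C"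
        by (rule eventually_mono[OF eventually_ge_at_top[of 1]])
          (use that(2) in \<open>auto simp: abs_mult intro: mult_left_mono\<close>)
      show "((\<lambda>t. \<bar>f t\<bar> * C) \<longlongrightarrow> 0) at_top"
        using tendsto_mult[OF tendsto_rabs[OF that(1)] tendsto_const[of C]] by simp
    qed
    have lim: "(p \<longlongrightarrow> 0) at_top" "(q \<longlongrightarrow> 0) at_top"
      using pq_dilation_tendsto[of 1] by auto
    have "((\<lambda>t. p t * kq t - m / \<rho> * (p t * q t) - q t * kp t) \<longlongrightarrow> 0 - m / \<rho> * (0 * 0) - 0) at_top"
      by (intro tendsto_diff tendsto_mult tendsto_const bl kb lim)
    then show "((\<lambda>t. p t * u t - q t * kp t) \<longlongrightarrow> 0) at_top"
      by (simp add: u_def algebra_simps)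
  qed
  \<comment> \<open>The factor is read off at one point; uniqueness extends it to the half-line.\<close>
  define c where "c = (if p t1 \<noteq> 0 then kp t1 / p t1 else u t1 / q t1)"
  have c: "kp t1 - c * p t1 = 0" "u t1 - c * q t1 = 0"
    using W[OF t1(1)] t1(2) by (auto simp: c_def field_simps split: if_splits)
  have "whittaker_system a \<rho> (\<lambda>t. kp t - c * p t) (\<lambda>t. u t - c * q t) {0<..}"
    unfolding whittaker_system_def
  proof (intro ballI conjI)
    fix t :: real assume "t \<in> {0<..}"
    then have t: "t > 0" "t \<noteq> 0" by auto
    show "((\<lambda>t. kp t - c * p t) has_real_derivative
        (a / t - 1 / 2) * (kp t - c * p t) + \<rho> / t * (u t - c * q t)) (at t)"
      by (rule DERIV_cong[OF DERIV_diff[OF dk[OF t(1)] DERIV_cmult[OF p_deriv[OF t(2)]]]])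
        (simp add: algebra_simps)
    show "((\<lambda>t. u t - c * q t) has_real_derivative
        - (a / t - 1 / 2) * (u t - c * q t) - \<rho> / t * (kp t - c * p t)) (at t)"
      by (rule DERIV_cong[OF DERIV_diff[OF du[OF t(1)] DERIV_cmult[OF q_deriv[OF t(2)]]]])
        (simp add: algebra_simps)
  qed
  from whittaker_system_unique[OF this t1(1) c]
  have sol: "kp t = c * p t" "u t = c * q t" if "t > 0" for t using that by auto
  \<comment> \<open>From p * kq + q * kp = (2 * c + m / \<rho>) * p * q.\<close>
  define c' where "c' = 2 * c + m / \<rho>"
  have "t * kk t - c' * H t = 0" if "t > 0" for t
  proof (rule DERIV_zero_tendsto_imp_eq[OF _ _ that])
    fix t :: real assume t: "t > 0"
    have kq: "kq t = c * q t + m / \<rho> * q t" using sol(2)[OF t] by (simp add: u_def)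
    show "((\<lambda>t. t * kk t - c' * H t) has_real_derivative 0) (at t)"
      by (rule DERIV_cong[OF DERIV_diff[OF kk_deriv[OF t] DERIV_cmult[OF H_deriv]]])
        (use t in \<open>simp_all add: kq sol(1)[OF t] c'_def algebra_simps\<close>)
  next
    have "((\<lambda>t. t * kk t - c' * H t) \<longlongrightarrow> 0 - c' * 0) at_top"
      using pq_dilation_tendsto(3)[of 1] by (intro tendsto_diff tendsto_mult tendsto_const kk_tendsto) auto
    then show "((\<lambda>t. t * kk t - c' * H t) \<longlongrightarrow> 0) at_top" by simp
  qed
  then show ?thesis by (intro exI[of _ c']) simp
qed

text \<open>If \<open>p\<close> and \<open>q\<close> have limits under dilation along a sequence, so has the integral, by dominated
  convergence: the kernel bound is homogeneous of degree \<open>-1\<close> apart from the exponential factor.\<close>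

lemma kk_limit_at_zero:
  assumes s: "\<And>n. s n > 0"
    and lim: "\<And>y. y \<noteq> 0 \<Longrightarrow> (\<lambda>n. p (s n * y)) \<longlonglongrightarrow> p0 y" "\<And>y. y \<noteq> 0 \<Longrightarrow> (\<lambda>n. q (s n * y)) \<longlonglongrightarrow> q0 y"
    and [measurable]: "p0 \<in> borel_measurable borel" "q0 \<in> borel_measurable borel"
  shows "(\<lambda>n. s n * kk (s n)) \<longlonglongrightarrow> (\<integral>y. ((p0 1 * q0 y - q0 1 * p0 y) / (1 - y))\<^sup>2 \<partial>lborel)"
    and "integrable lborel (\<lambda>y. ((p0 1 * q0 y - q0 1 * p0 y) / (1 - y))\<^sup>2)"
proof -
  define w where "w = (\<lambda>y::real. 16 * M ^ 4 * (1 / (1 + \<bar>y\<bar>)\<^sup>2))"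
  have w: "integrable lborel w" unfolding w_def
    by (intro integrable_mult_right integrable_inverse_square)
  have lim': "AE y in lborel. (\<lambda>n. (s n * k (s n) (s n * y))\<^sup>2) \<longlonglongrightarrow> ((p0 1 * q0 y - q0 1 * p0 y) / (1 - y))\<^sup>2"
    using AE_lborel_singleton[of 0] AE_lborel_singleton[of 1]
  proof eventually_elim
    case (elim y)
    have e: "s n * k (s n) (s n * y) = (p (s n * 1) * q (s n * y) - q (s n * 1) * p (s n * y)) / (1 - y)" for n
    proof -
      have "s n - s n * y = s n * (1 - y)" by (simp add: algebra_simps)
      then show ?thesis using s[of n] elim(2) by (simp add: whittaker_k_def)
    qed
    show ?case unfolding e using elim by (intro tendsto_intros lim) auto
  qed
  have b: "AE y in lborel. norm ((s n * k (s n) (s n * y))\<^sup>2) \<le> w y" for n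
    using AE_lborel_singleton[of 0]
  proof eventually_elim
    case (elim y)
    have "4 * M\<^sup>2 / (1 + \<bar>y\<bar>) * exp (- s n / 4) \<le> 4 * M\<^sup>2 / (1 + \<bar>y\<bar>)"
      using s[of n] by (intro mult_left_le) auto
    then have "\<bar>s n * k (s n) (s n * y)\<bar> \<le> 4 * M\<^sup>2 / (1 + \<bar>y\<bar>)"
      using dilated_bounds(1)[OF s elim] by (rule order_trans[rotated])
    then have "\<bar>s n * k (s n) (s n * y)\<bar>\<^sup>2 \<le> (4 * M\<^sup>2 / (1 + \<bar>y\<bar>))\<^sup>2"
      by (intro power_mono) auto
    then show ?case by (simp add: w_def power_divide power_mult_distrib)
  qed
  have "(\<lambda>n. \<integral>y. (s n * k (s n) (s n * y))\<^sup>2 \<partial>lborel) \<longlonglongrightarrow> (\<integral>y. ((p0 1 * q0 y - q0 1 * p0 y) / (1 - y))\<^sup>2 \<partial>lborel)"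
    by (rule integral_dominated_convergence[OF _ _ w lim' b]) measurable
  then show "(\<lambda>n. s n * kk (s n)) \<longlonglongrightarrow> (\<integral>y. ((p0 1 * q0 y - q0 1 * p0 y) / (1 - y))\<^sup>2 \<partial>lborel)"
    unfolding kernel_pairing_dilate(3)[OF s] .
  show "integrable lborel (\<lambda>y. ((p0 1 * q0 y - q0 1 * p0 y) / (1 - y))\<^sup>2)"
    by (rule integrable_dominated_convergence[OF _ _ w lim' b]) measurable
qed

lemma product_tendsto_zero: "((\<lambda>x. x * (p x * q x)) \<longlongrightarrow> 0) (at 0)"
proof (rule Lim_null_comparison)
  show "\<forall>\<^sub>F x in at 0. norm (x * (p x * q x)) \<le> \<bar>x\<bar> * (M * M)"
    unfolding eventually_at_filter
  proof (intro always_eventually allI impI)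
    fix x :: real assume "x \<noteq> 0"
    moreover have "M * exp (- \<bar>x\<bar> / 4) \<le> M" using M_nonneg by (simp add: mult_left_le)
    ultimately have "\<bar>p x\<bar> * \<bar>q x\<bar> \<le> M * M"
      using p_bound[of x] q_bound[of x] M_nonneg by (intro mult_mono) auto
    then show "norm (x * (p x * q x)) \<le> \<bar>x\<bar> * (M * M)"
      by (simp add: abs_mult mult.assoc mult_left_mono)
  qed
  show "((\<lambda>x. \<bar>x\<bar> * (M * M)) \<longlongrightarrow> 0) (at 0)"
    by (auto intro!: tendsto_eq_intros)
qed

text \<open>The integrals of \<open>p\<^sup>2\<close> and \<open>q\<^sup>2\<close> over the punctured line agree because the quadratic form
  \<open>\<rho> p\<^sup>2 + 2 a p q + \<rho> q\<^sup>2\<close>, whose derivative is \<open>\<rho> (q\<^sup>2 - p\<^sup>2)\<close>, has the same limit on both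
  sides of 0 and vanishes at infinity.\<close>

lemma pp_eq_qq:
  assumes \<rho>: "\<rho> > 0"
    and lim: "((\<lambda>x. H x) \<longlongrightarrow> h) (at_right 0)" "((\<lambda>x. H x) \<longlongrightarrow> h) (at_left 0)"
  shows "pp = qq"
proof -
  \<comment> \<open>L is the scaled density without the term that has the factor x and vanishes at 0.\<close>
  define L where "L x = \<rho> * (p x)\<^sup>2 + 2 * a * p x * q x + \<rho> * (q x)\<^sup>2" for x
  have L_H: "L x = H x + x * p x * q x" for x
    by (simp add: L_def scaled_density_def algebra_simps)
  define g where "g x = \<rho> * ((q x)\<^sup>2 - (p x)\<^sup>2)" for x
  have [measurable]: "g \<in> borel_measurable borel" unfolding g_def by measurable
  have dL: "(L has_real_derivative g x) (at x)" if "x \<noteq> 0" for x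
    unfolding L_H[abs_def] g_def
    by (rule DERIV_cong[OF DERIV_add[OF H_deriv[OF that] DERIV_mult[OF
          DERIV_mult[OF DERIV_ident p_deriv[OF that]] q_deriv[OF that]]]])
      (use that in \<open>simp add: field_simps power2_eq_square\<close>)
  have xpq: "((\<lambda>x. x * p x * q x) \<longlongrightarrow> 0) (at 0)"
    using product_tendsto_zero by (simp add: mult.assoc)
  have sq: "integrable lborel (\<lambda>y. p y * p y)" "integrable lborel (\<lambda>y. q y * q y)"
    using dilated_pairing_integrable(2)[of 1 p] dilated_pairing_integrable(2)[of 1 q] p_bound q_bound by auto
  have L0: "(L \<longlongrightarrow> h) (at_right 0)" "(L \<longlongrightarrow> h) (at_left 0)"
    using tendsto_add[OF lim(1) tendsto_mono[OF at_le xpq, of "{0<..}"]]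
      tendsto_add[OF lim(2) tendsto_mono[OF at_le xpq, of "{..<0}"]]
    unfolding L_H[abs_def] by simp_all
  have Linf: "((\<lambda>t. L (t * x)) \<longlongrightarrow> 0) at_top" if "x \<noteq> 0" for x
  proof -
    have "((\<lambda>t. L (t * x)) \<longlongrightarrow> \<rho> * 0\<^sup>2 + 2 * a * 0 * 0 + \<rho> * 0\<^sup>2) at_top"
      unfolding L_def by (intro tendsto_intros pq_dilation_tendsto that)
    then show ?thesis by simp
  qed
  have FTC: "(\<integral>x. indicator {u..v} x *\<^sub>R g x \<partial>lborel) = L v - L u" if "u \<le> v" "0 \<notin> {u..v}" for u v
  proof (rule integral_FTC_atLeastAtMost[OF that(1)])
    show "(L has_vector_derivative g x) (at x within {u..v})" if "u \<le> x" "x \<le> v" for x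
      using dL[of x] that \<open>0 \<notin> {u..v}\<close>
      by (auto simp: has_real_derivative_iff_has_vector_derivative intro: has_vector_derivative_at_within)
    have "isCont p x" "isCont q x" if "x \<in> {u..v}" for x
      using that \<open>0 \<notin> {u..v}\<close> by (metis p_deriv q_deriv DERIV_isCont)+
    then show "continuous_on {u..v} g"
      unfolding g_def by (auto intro!: continuous_at_imp_continuous_on continuous_intros)
  qed
  define f where "f n x = (indicator {1 / real (Suc n)..real (Suc n)} x
      + indicator {- real (Suc n)..- (1 / real (Suc n))} x) * g x" for n x
  have g_int: "integrable lborel g"
    unfolding g_def power2_eq_square using sq by auto
  have "(\<lambda>n. \<integral>x. f n x \<partial>lborel) \<longlonglongrightarrow> (\<integral>x. g x \<partial>lborel)"
  proof (rule integral_dominated_convergence)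
    show "integrable lborel (\<lambda>x. \<bar>g x\<bar>)" using g_int by (rule integrable_abs)
    show "AE x in lborel. (\<lambda>n. f n x) \<longlonglongrightarrow> g x"
      using AE_lborel_singleton[of 0]
    proof eventually_elim
      case (elim x)
      have "\<forall>\<^sub>F n in sequentially. 1 / real (Suc n) < \<bar>x\<bar>"
        using order_tendstoD(2)[OF LIMSEQ_Suc[OF lim_1_over_n], of "\<bar>x\<bar>"] elim by simp
      moreover have "\<forall>\<^sub>F n in sequentially. \<bar>x\<bar> \<le> real (Suc n)"
        using eventually_ge_at_top[of "nat \<lceil>\<bar>x\<bar>\<rceil>"] by eventually_elim linarith
      ultimately have "\<forall>\<^sub>F n in sequentially. f n x = g x"
      proof eventually_elim
        case (elim n)
        define e where "e = 1 / real (Suc n)"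
        have "e > 0" by (simp add: e_def)
        with elim show ?case unfolding f_def indicator_def e_def[symmetric]
          by (cases "x > 0") auto
      qed
      then show ?case by (rule tendsto_eventually)
    qed
    show "AE x in lborel. norm (f n x) \<le> \<bar>g x\<bar>" for n
    proof (intro AE_I2)
      fix x :: real
      define e where "e = 1 / real (Suc n)"
      have "e > 0" by (simp add: e_def)
      then show "norm (f n x) \<le> \<bar>g x\<bar>"
        unfolding f_def indicator_def e_def[symmetric] by (cases "x > 0") (auto simp: abs_mult)
    qed
  qed (auto simp: f_def)
  moreover have "(\<integral>x. f n x \<partial>lborel) = (L (real (Suc n)) - L (1 / real (Suc n)))
      + (L (- (1 / real (Suc n))) - L (- real (Suc n)))" for n
  proof -
    have le: "1 / real (Suc n) \<le> real (Suc n)" by (simp add: divide_le_eq mult_ge1_I)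
    have "(\<integral>x. f n x \<partial>lborel) = (\<integral>x. indicator {1 / real (Suc n)..real (Suc n)} x *\<^sub>R g x \<partial>lborel)
      + (\<integral>x. indicator {- real (Suc n)..- (1 / real (Suc n))} x *\<^sub>R g x \<partial>lborel)"
      unfolding f_def distrib_right real_scaleR_def
      by (rule Bochner_Integration.integral_add)
        (auto intro!: integrable_real_mult_indicator[OF _ g_int, unfolded mult.commute[of "g _"]])
    then show ?thesis
      using le FTC[of "1 / real (Suc n)" "real (Suc n)"] FTC[of "- real (Suc n)" "- (1 / real (Suc n))"]
      by (auto simp del: of_nat_Suc)
  qed
  moreover have "(\<lambda>n. (L (real (Suc n)) - L (1 / real (Suc n)))
      + (L (- (1 / real (Suc n))) - L (- real (Suc n)))) \<longlonglongrightarrow> (0 - h) + (h - 0)"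
  proof (intro tendsto_add tendsto_diff)
    have N: "filterlim (\<lambda>n. real (Suc n)) at_top sequentially"
      by (rule filterlim_compose[OF filterlim_real_sequentially filterlim_Suc])
    have R: "filterlim (\<lambda>n. 1 / real (Suc n)) (at_right 0) sequentially"
      using LIMSEQ_Suc[OF lim_1_over_n] by (auto simp: filterlim_at)
    then have R': "filterlim (\<lambda>n. - (1 / real (Suc n))) (at_left 0) sequentially"
      using tendsto_minus[OF LIMSEQ_Suc[OF lim_1_over_n]] by (auto simp: filterlim_at)
    show "(\<lambda>n. L (real (Suc n))) \<longlonglongrightarrow> 0" using filterlim_compose[OF Linf[of 1] N] by simp
    show "(\<lambda>n. L (- real (Suc n))) \<longlonglongrightarrow> 0" using filterlim_compose[OF Linf[of "-1"] N] by simp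
    show "(\<lambda>n. L (1 / real (Suc n))) \<longlonglongrightarrow> h" by (rule filterlim_compose[OF L0(1) R])
    show "(\<lambda>n. L (- (1 / real (Suc n)))) \<longlonglongrightarrow> h" by (rule filterlim_compose[OF L0(2) R'])
  qed
  ultimately have "(\<integral>x. g x \<partial>lborel) = 0" using LIMSEQ_unique by fastforce
  moreover have "(\<integral>x. g x \<partial>lborel) = \<rho> * (qq - pp)"
    unfolding g_def power2_eq_square qq_def pp_def using sq by simp
  ultimately show ?thesis using \<rho> by simp
qed

end


section \<open>Two integrals of logarithmic waves\<close>

lemma set_integrable_lborel_iff:
  fixes f :: "real \<Rightarrow> 'b::euclidean_space"
  assumes "f \<in> borel_measurable borel" "A \<in> sets borel"
  shows "set_integrable lborel A f \<longleftrightarrow> f absolutely_integrable_on A"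
  unfolding set_integrable_def
  by (subst integrable_completion[symmetric]) (use assms in auto)

text \<open>The substitution \<open>y = s\<^sup>2\<close> in Lebesgue integrals; it will halve the frequency of a logarithmic
  wave.\<close>

lemma square_substitution:
  fixes f :: "real \<Rightarrow> real"
  assumes [measurable]: "f \<in> borel_measurable borel"
  shows "set_integrable lborel {0<..} (\<lambda>s. 2 * s * f (s\<^sup>2)) \<longleftrightarrow> set_integrable lborel {0<..} f"
    and "set_integrable lborel {0<..} f \<Longrightarrow>
      (LBINT s:{0<..}. 2 * s * f (s\<^sup>2)) = (LBINT y:{0<..}. f y)"
proof -
  have img: "(\<lambda>s::real. s\<^sup>2) ` {0<..} = {0<..}"
  proof (rule subset_antisym; rule subsetI)
    fix x :: real assume "x \<in> {0<..}"
    then show "x \<in> (\<lambda>s. s\<^sup>2) ` {0<..}" by (intro image_eqI[of _ _ "sqrt x"]) auto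
  qed auto
  have inj: "inj_on (\<lambda>s::real. s\<^sup>2) {0<..}"
    by (auto simp: inj_on_def power2_eq_iff)
  have cv: "(\<lambda>s. \<bar>2 * s\<bar> * f (s\<^sup>2)) absolutely_integrable_on {0<..} \<and>
      integral {0<..} (\<lambda>s. \<bar>2 * s\<bar> * f (s\<^sup>2)) = b
    \<longleftrightarrow> f absolutely_integrable_on ((\<lambda>s. s\<^sup>2) ` {0<..}) \<and> integral ((\<lambda>s. s\<^sup>2) ` {0<..}) f = b" for b
    by (rule has_absolute_integral_change_of_variables_1'[OF _ _ inj])
      (auto intro!: derivative_eq_intros)
  have eq: "(\<lambda>s. \<bar>2 * s\<bar> * f (s\<^sup>2)) absolutely_integrable_on {0<..} \<longleftrightarrow>
     (\<lambda>s. 2 * s * f (s\<^sup>2)) absolutely_integrable_on {0<..}"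
    by (rule set_integrable_cong) auto
  have eqi: "integral {0<..} (\<lambda>s. \<bar>2 * s\<bar> * f (s\<^sup>2)) = integral {0<..} (\<lambda>s. 2 * s * f (s\<^sup>2))"
    by (rule Henstock_Kurzweil_Integration.integral_cong) auto
  have m: "(\<lambda>s. 2 * s * f (s\<^sup>2)) \<in> borel_measurable borel" by measurable
  show 1: "set_integrable lborel {0<..} (\<lambda>s. 2 * s * f (s\<^sup>2)) \<longleftrightarrow> set_integrable lborel {0<..} f"
    using cv[unfolded img eq] by (auto simp: set_integrable_lborel_iff[OF m] set_integrable_lborel_iff[OF assms])
  assume f: "set_integrable lborel {0<..} f"
  have "integral {0<..} (\<lambda>s. 2 * s * f (s\<^sup>2)) = integral {0<..} f"
    using cv[unfolded img eq eqi, of "integral {0<..} f"] f set_integrable_lborel_iff[OF assms] by auto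
  then show "(LBINT s:{0<..}. 2 * s * f (s\<^sup>2)) = (LBINT y:{0<..}. f y)"
    using set_borel_integral_eq_integral(2)[OF f] set_borel_integral_eq_integral(2)[OF 1[THEN iffD2, OF f]] by simp
qed

text \<open>This is \<open>|u| \<le> |sinh u|\<close> in the variable \<open>r = exp u\<close>.\<close>

lemma ln_double_le:
  fixes r :: real
  assumes "r > 0"
  shows "2 * \<bar>ln r\<bar> \<le> \<bar>r - 1 / r\<bar>"
proof -
  have *: "2 * ln r \<le> r - 1 / r" if "r \<ge> 1" for r :: real
  proof -
    have "1 - 1 / 1 - 2 * ln 1 \<le> r - 1 / r - 2 * ln r"
    proof (rule DERIV_nonneg_imp_nondecreasing[OF that], rule exI, rule conjI)
      fix x :: real assume "1 \<le> x"
      then show "((\<lambda>r. r - 1 / r - 2 * ln r) has_real_derivative (1 + 1 / x\<^sup>2 - 2 / x)) (at x)"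
        by (auto intro!: derivative_eq_intros simp: power2_eq_square)
      have "1 + 1 / x\<^sup>2 - 2 / x = (1 - 1 / x)\<^sup>2" using \<open>1 \<le> x\<close>
        by (simp add: power2_eq_square field_simps)
      then show "0 \<le> 1 + 1 / x\<^sup>2 - 2 / x" by simp
    qed
    then show ?thesis by simp
  qed
  show ?thesis
  proof (cases "r \<ge> 1")
    case True
    then show ?thesis using *[of r] by (simp add: divide_le_eq mult_ge1_I abs_of_nonneg)
  next
    case False
    then have "1 / r \<ge> 1" using assms by simp
    from *[OF this] False assms show ?thesis by (simp add: ln_div abs_if)
  qed
qed

text \<open>With \<open>y = r\<^sup>4\<close> the numerator is controlled by the previous lemma and \<open>1 - y\<close> factors. The bound is
  integrable at 0 and at infinity and shows no singularity at 1.\<close>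

lemma log_ratio_bound:
  fixes y :: real
  assumes "y > 0"
  shows "(ln y / (1 - y))\<^sup>2 \<le> 4 / (sqrt y * (1 + sqrt y)\<^sup>2)"
proof (cases "y = 1")
  case False
  define r where "r = sqrt (sqrt y)"
  have r: "r > 0" "r \<noteq> 1" using assms False by (auto simp: r_def)
  have sy: "sqrt y = r\<^sup>2" using assms by (simp add: r_def)
  have y: "y = r ^ 4"
  proof -
    have "y = (sqrt y)\<^sup>2" using assms by simp
    also have "\<dots> = r ^ 4" unfolding sy by (simp flip: power_mult)
    finally show ?thesis .
  qed
  have d: "1 - y = - (r\<^sup>2 - 1) * (1 + r\<^sup>2)" "r - 1 / r = (r\<^sup>2 - 1) / r"
    unfolding y using r by (auto simp: field_simps power2_eq_square power4_eq_xxxx)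
  have nz: "r\<^sup>2 - 1 \<noteq> 0" using r by (simp add: power2_eq_1_iff)
  have "\<bar>ln y\<bar> = 2 * (2 * \<bar>ln r\<bar>)" unfolding y using r by (simp add: ln_realpow)
  also have "\<dots> \<le> 2 * \<bar>r - 1 / r\<bar>" using ln_double_le[OF r(1)] by simp
  finally have "(ln y)\<^sup>2 \<le> (2 * (r - 1 / r))\<^sup>2"
    by (intro abs_le_square_iff[THEN iffD1]) (simp only: abs_mult abs_numeral)
  also have "\<dots> = 4 * (r\<^sup>2 - 1)\<^sup>2 / r\<^sup>2" unfolding power_mult_distrib d power_divide by simp
  finally have "(ln y)\<^sup>2 / (1 - y)\<^sup>2 \<le> (4 * (r\<^sup>2 - 1)\<^sup>2 / r\<^sup>2) / (1 - y)\<^sup>2"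
    by (intro divide_right_mono) auto
  also have q: "(1 - y)\<^sup>2 = (r\<^sup>2 - 1)\<^sup>2 * (1 + r\<^sup>2)\<^sup>2"
    unfolding d(1) power_mult_distrib power2_minus ..
  also have "4 * (r\<^sup>2 - 1)\<^sup>2 / r\<^sup>2 / ((r\<^sup>2 - 1)\<^sup>2 * (1 + r\<^sup>2)\<^sup>2) = 4 / (r\<^sup>2 * (1 + r\<^sup>2)\<^sup>2)"
    using nz by simp
  finally show ?thesis by (simp add: power_divide sy q)
qed (use assms in auto)

lemma log_ratio_bound_integrable:
  "set_integrable lborel {0<..} (\<lambda>y::real. 4 / (sqrt y * (1 + sqrt y)\<^sup>2))"
proof -
  have "set_integrable lborel {0<..} (\<lambda>s::real. 2 * s * (4 / (sqrt (s\<^sup>2) * (1 + sqrt (s\<^sup>2))\<^sup>2)))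
      \<longleftrightarrow> set_integrable lborel {0<..} (\<lambda>s::real. 8 * (1 / (1 + \<bar>s\<bar>)\<^sup>2))"
    by (rule set_integrable_cong) auto
  moreover have "set_integrable lborel {0<..} (\<lambda>s::real. 8 * (1 / (1 + \<bar>s\<bar>)\<^sup>2))"
    unfolding set_integrable_def
    by (intro integrable_mult_indicator integrable_mult_right integrable_inverse_square) auto
  ultimately show ?thesis by (subst square_substitution(1)[symmetric]) auto
qed

text \<open>The integral that comes from points on the same half-line.\<close>

definition sine_log_integral :: "real \<Rightarrow> real" where
  "sine_log_integral \<beta> = (LBINT y:{0<..}. (sin (\<beta> * ln y) / (1 - y))\<^sup>2)"

text \<open>The quadratic bound in \<open>\<beta>\<close> is used to identify the integral among the solutions of a functional
  equation.\<close>

lemma sine_log_integrable: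
  shows "set_integrable lborel {0<..} (\<lambda>y. (sin (\<beta> * ln y) / (1 - y))\<^sup>2)"
    and "\<bar>sine_log_integral \<beta>\<bar> \<le> \<beta>\<^sup>2 * (LBINT y:{0<..}. 4 / (sqrt y * (1 + sqrt y)\<^sup>2))"
proof -
  have b: "(sin (\<beta> * ln y) / (1 - y))\<^sup>2 \<le> \<beta>\<^sup>2 * (4 / (sqrt y * (1 + sqrt y)\<^sup>2))" if "y > 0" for y
  proof -
    have "\<bar>sin (\<beta> * ln y)\<bar> \<le> \<bar>\<beta> * ln y\<bar>" by (rule abs_sin_x_le_abs_x)
    then have "(sin (\<beta> * ln y))\<^sup>2 \<le> (\<beta> * ln y)\<^sup>2" by (simp add: abs_le_square_iff)
    then have "(sin (\<beta> * ln y))\<^sup>2 / (1 - y)\<^sup>2 \<le> (\<beta> * ln y)\<^sup>2 / (1 - y)\<^sup>2" by (intro divide_right_mono) auto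
    also have "\<dots> = \<beta>\<^sup>2 * (ln y / (1 - y))\<^sup>2" by (simp add: power_divide power_mult_distrib)
    also have "\<dots> \<le> \<beta>\<^sup>2 * (4 / (sqrt y * (1 + sqrt y)\<^sup>2))"
      by (intro mult_left_mono log_ratio_bound that) auto
    finally show ?thesis by (simp add: power_divide)
  qed
  have int: "set_integrable lborel {0<..} (\<lambda>y::real. \<beta>\<^sup>2 * (4 / (sqrt y * (1 + sqrt y)\<^sup>2)))"
    by (intro set_integrable_mult_right log_ratio_bound_integrable)
  show s: "set_integrable lborel {0<..} (\<lambda>y. (sin (\<beta> * ln y) / (1 - y))\<^sup>2)"
  proof (rule set_integrable_bound[OF int])
    show "set_borel_measurable lborel {0<..} (\<lambda>y. (sin (\<beta> * ln y) / (1 - y))\<^sup>2)"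
      unfolding set_borel_measurable_def by measurable
    show "AE y in lborel. y \<in> {0<..} \<longrightarrow> norm ((sin (\<beta> * ln y) / (1 - y))\<^sup>2)
        \<le> norm (\<beta>\<^sup>2 * (4 / (sqrt y * (1 + sqrt y)\<^sup>2)))"
      using b by (intro AE_I2) (force intro: order_trans)
  qed
  have "sine_log_integral \<beta> \<ge> 0"
    unfolding sine_log_integral_def set_lebesgue_integral_def by (rule integral_nonneg_AE) auto
  moreover have "sine_log_integral \<beta> \<le> (LBINT y:{0<..}. \<beta>\<^sup>2 * (4 / (sqrt y * (1 + sqrt y)\<^sup>2)))"
    unfolding sine_log_integral_def by (rule set_integral_mono[OF s int]) (use b in auto)
  then have "sine_log_integral \<beta> \<le> \<beta>\<^sup>2 * (LBINT y:{0<..}. 4 / (sqrt y * (1 + sqrt y)\<^sup>2))"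
    unfolding set_integral_mult_right .
  ultimately show "\<bar>sine_log_integral \<beta>\<bar> \<le> \<beta>\<^sup>2 * (LBINT y:{0<..}. 4 / (sqrt y * (1 + sqrt y)\<^sup>2))"
    by simp
qed

text \<open>The representation of \<open>1 / s\<^sup>2\<close> as a Laplace transform, for use with \<open>s = 1 + y\<close>.\<close>

lemma erlang_integral:
  fixes s :: real assumes "s > 0"
  shows "integrable lborel (\<lambda>w. indicator {0<..} w * (w * exp (- (w * s))))"
    and "(\<integral>w. indicator {0<..} w * (w * exp (- (w * s))) \<partial>lborel) = 1 / s\<^sup>2"
proof -
  have "(\<integral>\<^sup>+w. ennreal (w * exp (- (w * s))) * indicator {0..} w \<partial>lborel) = ennreal (0 - (- (0 / s + 1 / s\<^sup>2) * exp (- (0 * s))))"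
  proof (rule nn_integral_FTC_atLeast)
    show "((\<lambda>w. - (w / s + 1 / s\<^sup>2) * exp (- (w * s))) has_real_derivative w * exp (- (w * s))) (at w)" for w
      using assms by (auto intro!: derivative_eq_intros simp: field_simps power2_eq_square)
    show "((\<lambda>w. - (w / s + 1 / s\<^sup>2) * exp (- (w * s))) \<longlongrightarrow> 0) at_top"
      using assms by real_asymp
  qed auto
  moreover have "(\<integral>\<^sup>+w. ennreal (w * exp (- (w * s))) * indicator {0..} w \<partial>lborel)
     = (\<integral>\<^sup>+w. ennreal (indicator {0<..} w * (w * exp (- (w * s)))) \<partial>lborel)"
    by (intro nn_integral_cong) (auto simp: indicator_def)
  ultimately have e: "(\<integral>\<^sup>+w. ennreal (indicator {0<..} w * (w * exp (- (w * s)))) \<partial>lborel) = ennreal (1 / s\<^sup>2)"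
    by simp
  have nn: "AE w in lborel. 0 \<le> indicator {0<..} w * (w * exp (- (w * s)))"
    by (intro AE_I2) (auto simp: indicator_def)
  show "integrable lborel (\<lambda>w. indicator {0<..} w * (w * exp (- (w * s))))"
    by (rule integrableI_nn_integral_finite[OF _ nn e]) auto
  show "(\<integral>w. indicator {0<..} w * (w * exp (- (w * s))) \<partial>lborel) = 1 / s\<^sup>2"
    by (rule integral_eq_nn_integral[OF _ nn, THEN trans]) (use e in auto)
qed

lemma cis_measurable[measurable]: "cis \<in> borel_measurable borel"
  by (intro borel_measurable_continuous_onI continuous_intros)

lemma Gamma_lborel_integral:
  fixes c :: real
  shows "integrable lborel (\<lambda>t. indicator {0<..} t *\<^sub>R (cis (c * ln t) * exp (- t)))"
    and "(\<integral>t. indicator {0<..} t *\<^sub>R (cis (c * ln t) * exp (- t)) \<partial>lborel) = Gamma (1 + \<i> * c)"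
proof -
  have e: "complex_of_real t powr ((1 + \<i> * c) - 1) / of_real (exp t) = cis (c * ln t) * exp (- t)"
    if "t \<in> {0<..}" for t
    using that by (simp add: powr_def cis_conv_exp Ln_of_real exp_minus field_simps exp_of_real)
  have ai: "(\<lambda>t. cis (c * ln t) * exp (- t)) absolutely_integrable_on {0<..}"
    using absolutely_integrable_Gamma_integral'[of "1 + \<i> * c"]
    by (subst set_integrable_cong[OF refl refl e[symmetric]]) auto
  have hi: "((\<lambda>t. cis (c * ln t) * exp (- t)) has_integral Gamma (1 + \<i> * c)) {0<..}"
    using Gamma_integral_complex'[of "1 + \<i> * c"] by (subst has_integral_cong[OF e[symmetric]]) auto
  have m: "(\<lambda>t. cis (c * ln t) * complex_of_real (exp (- t))) \<in> borel_measurable borel"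
    by measurable
  have si: "set_integrable lborel {0<..} (\<lambda>t. cis (c * ln t) * exp (- t))"
    using set_integrable_lborel_iff[OF m] ai by simp
  then show "integrable lborel (\<lambda>t. indicator {0<..} t *\<^sub>R (cis (c * ln t) * exp (- t)))"
    by (simp add: set_integrable_def)
  show "(\<integral>t. indicator {0<..} t *\<^sub>R (cis (c * ln t) * exp (- t)) \<partial>lborel) = Gamma (1 + \<i> * c)"
    using set_borel_integral_eq_integral(2)[OF si] hi by (simp add: set_lebesgue_integral_def integral_unique)
qed

text \<open>The integral that comes from points on different half-lines. It is a Beta integral: writing
  \<open>1 / (1 + y)\<^sup>2\<close> as a Laplace transform and exchanging the integrals gives
  \<open>\<Gamma>(1 + i c) \<Gamma>(1 - i c)\<close>.\<close>

lemma cis_log_integral: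
  fixes c :: real
  assumes "c \<noteq> 0"
  shows "set_integrable lborel {0<..} (\<lambda>y. cis (c * ln y) / of_real ((1 + y)\<^sup>2))"
    and "(LBINT y:{0<..}. cis (c * ln y) / of_real ((1 + y)\<^sup>2)) = of_real (pi * c / sinh (pi * c))"
proof -
  define F where "F w y = indicator {0<..} w *\<^sub>R (indicator {0<..} y *\<^sub>R
    (cis (c * ln y) * of_real (w * exp (- (w * (1 + y))))))" for w y :: real
  have [measurable]: "(\<lambda>(w, y). F w y) \<in> borel_measurable (lborel \<Otimes>\<^sub>M lborel)"
    unfolding F_def by measurable
  have Fn: "norm (F w y) = indicator {0<..} y * (indicator {0<..} w * (w * exp (- (w * (1 + y)))))" for w y
    by (auto simp: F_def norm_mult indicator_def)
  have inner_int: "integrable lborel (\<lambda>w. F w y)" for y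
  proof (cases "y > 0")
    case True
    have "integrable lborel (\<lambda>w. norm (F w y))"
      unfolding Fn using erlang_integral(1)[of "1 + y"] True by simp
    moreover have "(\<lambda>w. F w y) \<in> borel_measurable lborel" unfolding F_def by measurable
    ultimately show ?thesis by (simp add: integrable_norm_iff)
  qed (simp add: F_def)
  have inner: "(\<integral>w. F w y \<partial>lborel) = indicator {0<..} y *\<^sub>R (cis (c * ln y) / of_real ((1 + y)\<^sup>2))" for y
  proof (cases "y > 0")
    case True
    have "(\<integral>w. F w y \<partial>lborel) = (\<integral>w. cis (c * ln y) * of_real (indicator {0<..} w * (w * exp (- (w * (1 + y))))) \<partial>lborel)"
      using True by (intro Bochner_Integration.integral_cong) (auto simp: F_def indicator_def)
    also have "\<dots> = cis (c * ln y) * of_real (1 / (1 + y)\<^sup>2)"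
      unfolding integral_mult_right_zero integral_complex_of_real using True by (subst erlang_integral(2)) auto
    finally show ?thesis using True by simp
  qed (simp add: F_def)
  have int: "integrable (lborel \<Otimes>\<^sub>M lborel) (\<lambda>(y, w). F w y)"
  proof (rule lborel_pair.Fubini_integrable)
    show "(\<lambda>(y, w). F w y) \<in> borel_measurable (lborel \<Otimes>\<^sub>M lborel)"
      unfolding F_def by measurable
    show "AE y in lborel. integrable lborel (\<lambda>w. case (y, w) of (y, w) \<Rightarrow> F w y)"
      using inner_int by simp
    have "(\<integral>w. norm (F w y) \<partial>lborel) = indicator {0<..} y *\<^sub>R (1 / (1 + \<bar>y\<bar>)\<^sup>2)" for y
      unfolding Fn using erlang_integral(2)[of "1 + y"] by (auto simp: indicator_def)
    then show "integrable lborel (\<lambda>y. \<integral>w. norm (case (y, w) of (y, w) \<Rightarrow> F w y) \<partial>lborel)"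
      using integrable_mult_indicator[OF _ integrable_inverse_square, of "{0<..}"] by simp
  qed
  have y_int: "integrable lborel (\<lambda>y. \<integral>w. F w y \<partial>lborel)"
    by (rule lborel_pair.integrable_fst[OF int])
  then show "set_integrable lborel {0<..} (\<lambda>y. cis (c * ln y) / of_real ((1 + y)\<^sup>2))"
    unfolding inner set_integrable_def .
  have outer: "(\<integral>y. F w y \<partial>lborel)
      = (indicator {0<..} w *\<^sub>R (cis ((- c) * ln w) * exp (- w))) * Gamma (1 + \<i> * c)" for w
  proof (cases "w > 0")
    case True
    define g where "g t = indicator {0<..} t *\<^sub>R (cis (c * ln t) * exp (- t))" for t
    have "Gamma (1 + \<i> * c) = (\<integral>t. g t \<partial>lborel)"
      using Gamma_lborel_integral(2)[of c] by (simp add: g_def)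
    also have "\<dots> = w *\<^sub>R (\<integral>y. g (w * y) \<partial>lborel)"
      using lborel_integral_real_affine[of w g 0] True by simp
    also have "\<dots> = (\<integral>y. w *\<^sub>R g (w * y) \<partial>lborel)" by simp
    finally have G: "Gamma (1 + \<i> * c) = (\<integral>y. w *\<^sub>R g (w * y) \<partial>lborel)" .
    have P: "(cis ((- c) * ln w) * exp (- w)) * (w *\<^sub>R g (w * y)) = F w y" for y
    proof (cases "y > 0")
      case y: True
      have "cis ((- c) * ln w) * cis (c * ln (w * y)) = cis (c * ln y)"
        using True y by (simp add: cis_mult ln_mult algebra_simps)
      then show ?thesis
        using True y by (simp add: F_def g_def scaleR_conv_of_real algebra_simps exp_add exp_diff exp_minus)
          (simp add: field_simps)
    qed (use True in \<open>simp add: F_def g_def zero_less_mult_iff\<close>)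
    have "(\<integral>y. F w y \<partial>lborel) = (cis ((- c) * ln w) * exp (- w)) * (\<integral>y. w *\<^sub>R g (w * y) \<partial>lborel)"
      by (subst integral_mult_right_zero[symmetric]) (simp only: P)
    then show ?thesis unfolding G using True by simp
  qed (simp add: F_def)
  have "(\<integral>y. (\<integral>w. F w y \<partial>lborel) \<partial>lborel) = (\<integral>w. (\<integral>y. F w y \<partial>lborel) \<partial>lborel)"
    by (rule lborel_pair.Fubini_integral[OF int, symmetric])
  also have "\<dots> = Gamma (1 + \<i> * of_real (- c)) * Gamma (1 + \<i> * c)"
    unfolding outer integral_mult_left_zero Gamma_lborel_integral(2) ..
  also have "\<dots> = of_real (pi * c / sinh (pi * c))"
  proof -
    have ic: "\<i> * complex_of_real c \<noteq> 0" using assms by simp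
    have "Gamma (1 + \<i> * c) = \<i> * c * Gamma (\<i> * c)"
      using Gamma_plus1[of "\<i> * complex_of_real c"] assms
      by (auto simp: add.commute nonpos_Ints_def complex_eq_iff)
    then have "Gamma (1 + \<i> * of_real (- c)) * Gamma (1 + \<i> * c)
        = \<i> * c * (Gamma (\<i> * c) * Gamma (1 - \<i> * c))" by simp
    also have "\<dots> = \<i> * c * (of_real pi / sin (of_real pi * (\<i> * c)))"
      by (subst Gamma_reflection_complex) simp
    also have "sin (of_real pi * (\<i> * c)) = \<i> * sinh (of_real (pi * c))"
      by (simp add: sinh_conv_sin mult_ac)
    also have "sinh (complex_of_real (pi * c)) = of_real (sinh (pi * c))"
      by (simp add: sinh_field_def exp_of_real del: of_real_mult flip: of_real_minus)
    finally show ?thesis by (simp add: field_simps)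
  qed
  finally show "(LBINT y:{0<..}. cis (c * ln y) / of_real ((1 + y)\<^sup>2)) = of_real (pi * c / sinh (pi * c))"
    unfolding inner set_lebesgue_integral_def .
qed

text \<open>For \<open>S = sin\<^sup>2 (\<beta> ln y)\<close> one has
  \<open>S / (1 - y)\<^sup>2 = 4 y S / (1 - y\<^sup>2)\<^sup>2 + S / (1 + y)\<^sup>2\<close>. The first term has the frequency
  halved after the substitution of \<open>y\<close> for \<open>y\<^sup>2\<close>, and the second one, where \<open>2 S = 1 - cos (2 \<beta> ln y)\<close>, is
  known.\<close>

lemma sine_log_integral_double:
  assumes "\<beta> \<noteq> 0"
  shows "sine_log_integral \<beta> = 2 * sine_log_integral (\<beta> / 2) + (1/2 - pi * \<beta> / sinh (2 * pi * \<beta>))"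
proof -
  have c1: "set_integrable lborel {0<..} (\<lambda>y. Re (cis (2 * \<beta> * ln y) / of_real ((1 + y)\<^sup>2)))"
    using cis_log_integral(1)[of "2 * \<beta>"] assms unfolding set_integrable_def
    by (auto dest: integrable_Re)
  have c2: "(LBINT y:{0<..}. Re (cis (2 * \<beta> * ln y) / of_real ((1 + y)\<^sup>2))) = 2 * pi * \<beta> / sinh (2 * pi * \<beta>)"
    using cis_log_integral[of "2 * \<beta>"] assms integral_Re[of lborel "\<lambda>y. indicator {0<..} y *\<^sub>R (cis (2 * \<beta> * ln y) / of_real ((1 + y)\<^sup>2))"]
    unfolding set_integrable_def set_lebesgue_integral_def by (simp add: mult_ac)
  define f where "f w = 2 * (sin (\<beta> / 2 * ln w) / (1 - w))\<^sup>2" for w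
  have f_int: "set_integrable lborel {0<..} f"
    unfolding f_def by (intro set_integrable_mult_right sine_log_integrable)
  have fm[measurable]: "f \<in> borel_measurable borel" unfolding f_def by measurable
  have sub: "(LBINT s:{0<..}. 2 * s * f (s\<^sup>2)) = 2 * sine_log_integral (\<beta> / 2)"
    by (subst square_substitution(2)[OF fm f_int])
      (simp only: f_def[abs_def] sine_log_integral_def set_integral_mult_right)
  have sub_int: "set_integrable lborel {0<..} (\<lambda>s. 2 * s * f (s\<^sup>2))"
    using square_substitution(1)[OF fm] f_int by simp
  have "sine_log_integral \<beta> = (LBINT y:{0<..}. 2 * y * f (y\<^sup>2)
      + (1/2 * (1 / (1 + \<bar>y\<bar>)\<^sup>2) - 1/2 * Re (cis (2 * \<beta> * ln y) / of_real ((1 + y)\<^sup>2))))"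
    unfolding sine_log_integral_def
  proof (rule set_lebesgue_integral_cong_AE)
    have "(sin (\<beta> * ln y) / (1 - y))\<^sup>2 = 2 * y * f (y\<^sup>2)
      + (1/2 * (1 / (1 + \<bar>y\<bar>)\<^sup>2) - 1/2 * Re (cis (2 * \<beta> * ln y) / of_real ((1 + y)\<^sup>2)))" if "y > 0" "y \<noteq> 1" for y
    proof -
      define S where "S = (sin (\<beta> * ln y))\<^sup>2"
      have cos2: "cos (2 * (\<beta> * ln y)) = 1 - 2 * S"
        unfolding S_def by (rule cos_double_sin)
      have nz: "1 - y \<noteq> 0" "1 + y \<noteq> 0" using that by auto
      have e: "1 - y\<^sup>2 = (1 - y) * (1 + y)" by (simp add: power2_eq_square algebra_simps)
      have "2 * y * f (y\<^sup>2) = 4 * y * S / ((1 - y)\<^sup>2 * (1 + y)\<^sup>2)"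
        using that by (simp add: f_def e ln_realpow power_divide power_mult_distrib S_def)
      moreover have "1/2 * (1 / (1 + \<bar>y\<bar>)\<^sup>2) - 1/2 * Re (cis (2 * \<beta> * ln y) / of_real ((1 + y)\<^sup>2))
          = S / (1 + y)\<^sup>2"
      proof -
        have r: "Re (cis (2 * \<beta> * ln y) / of_real ((1 + y)\<^sup>2)) = (1 - 2 * S) / (1 + y)\<^sup>2"
          unfolding Re_divide_of_real cis.sel mult.assoc cos2 ..
        show ?thesis unfolding r using that by (simp add: field_simps)
      qed
      moreover have "S / (1 - y)\<^sup>2 = 4 * y * S / ((1 - y)\<^sup>2 * (1 + y)\<^sup>2) + S / (1 + y)\<^sup>2"
      proof -
        have y2: "4 * y + (1 - y)\<^sup>2 = (1 + y)\<^sup>2" by (simp add: power2_eq_square algebra_simps)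
        have "S / (1 - y)\<^sup>2 = S * (4 * y + (1 - y)\<^sup>2) / ((1 - y)\<^sup>2 * (1 + y)\<^sup>2)"
          unfolding y2 using nz by simp
        also have "\<dots> = 4 * y * S / ((1 - y)\<^sup>2 * (1 + y)\<^sup>2) + S * (1 - y)\<^sup>2 / ((1 - y)\<^sup>2 * (1 + y)\<^sup>2)"
          by (simp add: distrib_left add_divide_distrib mult_ac)
        finally show ?thesis using nz by simp
      qed
      ultimately show ?thesis by (simp add: power_divide S_def)
    qed
    then show "AE y in lborel. y \<in> {0<..} \<longrightarrow> (sin (\<beta> * ln y) / (1 - y))\<^sup>2 = 2 * y * f (y\<^sup>2)
      + (1/2 * (1 / (1 + \<bar>y\<bar>)\<^sup>2) - 1/2 * Re (cis (2 * \<beta> * ln y) / of_real ((1 + y)\<^sup>2)))"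
      using AE_lborel_singleton[of 1] by (auto elim!: eventually_mono)
  qed (auto simp: f_def)
  also have "\<dots> = 2 * sine_log_integral (\<beta> / 2) + (1/2 * 1 - 1/2 * (2 * pi * \<beta> / sinh (2 * pi * \<beta>)))"
  proof -
    note m1 = set_integrable_mult_right[where a = "1/2", OF inverse_square_integral(1)]
      and m2 = set_integrable_mult_right[where a = "1/2", OF c1]
    show ?thesis
      by (subst set_integral_add(2)[OF sub_int set_integral_diff(1)[OF m1 m2]],
          subst set_integral_diff(2)[OF m1 m2])
        (simp only: set_integral_mult_right sub c2 inverse_square_integral(2))
  qed
  finally show ?thesis by simp
qed

text \<open>The right-hand side satisfies the same doubling equation, so the difference \<open>E\<close> of the two sides
  satisfies \<open>E(\<beta>) = 2\<^sup>n E(\<beta> / 2\<^sup>n)\<close>. Both sides are \<open>o(\<beta>)\<close> at 0, hence \<open>E = 0\<close>.\<close>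

lemma sine_log_integral_eq:
  assumes "\<beta> \<noteq> 0"
  shows "sine_log_integral \<beta> = pi * \<beta> * cosh (2 * pi * \<beta>) / sinh (2 * pi * \<beta>) - 1/2"
proof -
  define f where "f b = pi * b * cosh (2 * pi * b) / sinh (2 * pi * b) - 1/2" for b :: real
  define E where "E b = sine_log_integral b - f b" for b
  have f2: "f b = 2 * f (b / 2) + (1/2 - pi * b / sinh (2 * pi * b))" if "b \<noteq> 0" for b
  proof -
    define x where "x = pi * b"
    have x: "x \<noteq> 0" using that by (simp add: x_def)
    have "cosh (2 * x) / sinh (2 * x) = cosh x / sinh x - 1 / sinh (2 * x)"
      unfolding sinh_double cosh_double_cosh using x by (simp add: field_simps power2_eq_square)
    then have "x * cosh (2 * x) / sinh (2 * x) = x * cosh x / sinh x - x / sinh (2 * x)"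
      by (metis (no_types, opaque_lifting) right_diff_distrib times_divide_eq_right mult.right_neutral)
    then show ?thesis by (simp add: f_def x_def mult_ac)
  qed
  have E2: "E b = 2 * E (b / 2)" if "b \<noteq> 0" for b
    using sine_log_integral_double[OF that] f2[OF that] by (simp add: E_def)
  have En: "E \<beta> = 2 ^ n * E (\<beta> / 2 ^ n)" for n
  proof (induction n)
    case (Suc n)
    have "\<beta> / 2 ^ n \<noteq> 0" using assms by simp
    from E2[OF this] Suc show ?case by (simp add: mult_ac)
  qed simp
  have "((\<lambda>b. f b / b) \<longlongrightarrow> 0) (at 0)"
  proof -
    have "((\<lambda>x::real. (x * ((exp x + exp (- x)) / 2) / ((exp x - exp (- x)) / 2) - 1) / x) \<longlongrightarrow> 0) (at 0)"
      by real_asymp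
    moreover have "filterlim (\<lambda>b. 2 * pi * b) (at 0) (at 0)"
      by (auto simp: filterlim_at eventually_at_filter intro!: tendsto_eq_intros)
    ultimately have "((\<lambda>b. ((2 * pi * b) * cosh (2 * pi * b) / sinh (2 * pi * b) - 1) / (2 * pi * b)) \<longlongrightarrow> 0) (at 0)"
      unfolding sinh_field_def cosh_field_def by (rule filterlim_compose)
    then have "((\<lambda>b. pi * (((2 * pi * b) * cosh (2 * pi * b) / sinh (2 * pi * b) - 1) / (2 * pi * b))) \<longlongrightarrow> pi * 0) (at 0)"
      by (intro tendsto_mult tendsto_const)
    moreover have "pi * (((2 * pi * b) * c / s - 1) / (2 * pi * b)) = (pi * b * c / s - 1/2) / b" for b c s :: real
    proof (cases "b = 0")
      case False
      have "(2 * pi * b) * c / s - 1 = 2 * (pi * b * c / s - 1/2)" by (simp add: mult_ac)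
      then show ?thesis using False by (simp only: mult.assoc mult_divide_mult_cancel_left) simp
    qed simp
    ultimately show ?thesis by (simp only: f_def mult_zero_right)
  qed
  moreover have "((\<lambda>b. sine_log_integral b / b) \<longlongrightarrow> 0) (at 0)"
  proof (rule Lim_null_comparison)
    define K where "K = (LBINT y:{0<..}. 4 / (sqrt y * (1 + sqrt y :: real)\<^sup>2))"
    show "\<forall>\<^sub>F b in at 0. norm (sine_log_integral b / b) \<le> \<bar>b\<bar> * K"
      unfolding eventually_at_filter
    proof (intro always_eventually allI impI)
      fix b :: real assume "b \<noteq> 0"
      have "\<bar>sine_log_integral b\<bar> \<le> \<bar>b\<bar>\<^sup>2 * K"
        using sine_log_integrable(2)[of b] unfolding K_def by simp
      then show "norm (sine_log_integral b / b) \<le> \<bar>b\<bar> * K"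
        using \<open>b \<noteq> 0\<close> by (simp add: pos_divide_le_eq power2_eq_square mult_ac)
    qed
    show "((\<lambda>b. \<bar>b\<bar> * K) \<longlongrightarrow> 0) (at 0)" by (auto intro!: tendsto_eq_intros)
  qed
  ultimately have "((\<lambda>b. sine_log_integral b / b - f b / b) \<longlongrightarrow> 0 - 0) (at 0)"
    by (intro tendsto_diff)
  then have Eb: "((\<lambda>b. E b / b) \<longlongrightarrow> 0) (at 0)" by (simp add: E_def diff_divide_distrib)
  have "(\<lambda>n. \<beta> / 2 ^ n) \<longlonglongrightarrow> 0" by (rule LIMSEQ_divide_realpow_zero) simp
  then have "filterlim (\<lambda>n. \<beta> / 2 ^ n) (at 0) sequentially"
    using assms by (auto simp: filterlim_at)
  from filterlim_compose[OF Eb this]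
  have "(\<lambda>n. \<beta> * (E (\<beta> / 2 ^ n) / (\<beta> / 2 ^ n))) \<longlonglongrightarrow> \<beta> * 0"
    by (intro tendsto_mult tendsto_const)
  moreover have "\<beta> * (E (\<beta> / 2 ^ n) / (\<beta> / 2 ^ n)) = E \<beta>" for n
    using En[of n] assms by simp
  ultimately have "(\<lambda>n::nat. E \<beta>) \<longlonglongrightarrow> 0" by simp
  then have "E \<beta> = 0" by (simp add: LIMSEQ_const_iff)
  then show ?thesis by (simp add: E_def f_def)
qed


section \<open>The reproducing identity\<close>

lemma tendsto_zero_mult_bounded:
  fixes f g :: "'a \<Rightarrow> real"
  assumes "(f \<longlongrightarrow> 0) F" "\<And>x. \<bar>g x\<bar> \<le> C"
  shows "((\<lambda>x. f x * g x) \<longlongrightarrow> 0) F"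
proof (rule Lim_null_comparison)
  show "\<forall>\<^sub>F x in F. norm (f x * g x) \<le> \<bar>f x\<bar> * C"
    using assms(2) by (intro always_eventually) (auto simp: abs_mult intro: mult_left_mono)
  show "((\<lambda>x. \<bar>f x\<bar> * C) \<longlongrightarrow> 0) F"
    using tendsto_mult[OF tendsto_rabs[OF assms(1)] tendsto_const[of C]] by simp
qed

lemma tendsto_zero_mult_diff:
  fixes f g f0 g0 :: "'a \<Rightarrow> real"
  assumes "((\<lambda>x. f x - f0 x) \<longlongrightarrow> 0) F" "((\<lambda>x. g x - g0 x) \<longlongrightarrow> 0) F"
    and "\<And>x. \<bar>f0 x\<bar> \<le> C" "\<And>x. \<bar>g0 x\<bar> \<le> C"
  shows "((\<lambda>x. f x * g x - f0 x * g0 x) \<longlongrightarrow> 0) F"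
proof -
  have "((\<lambda>x. (f x - f0 x) * (g x - g0 x) + (f x - f0 x) * g0 x + (g x - g0 x) * f0 x) \<longlongrightarrow> 0 * 0 + 0 + 0) F"
    by (intro tendsto_add tendsto_mult tendsto_zero_mult_bounded[OF _ assms(3)]
        tendsto_zero_mult_bounded[OF _ assms(4)] assms(1,2))
  then show ?thesis by (simp add: algebra_simps)
qed

text \<open>The leading behaviour at 0 of a real solution of the system: \<open>x\<^sup>\<plusminus>\<^sup>i\<^sup>\<beta>\<close> with conjugate
  coefficients.\<close>

definition log_wave :: "real \<Rightarrow> complex \<Rightarrow> real \<Rightarrow> real" where
  "log_wave \<beta> A x = 2 * Re (A * cis (\<beta> * ln \<bar>x\<bar>))"

lemma log_wave_bound: "\<bar>log_wave \<beta> A x\<bar> \<le> 2 * norm A"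
  using abs_Re_le_cmod[of "A * cis (\<beta> * ln \<bar>x\<bar>)"] by (simp add: log_wave_def norm_mult)

text \<open>The condition on the amplitudes \<open>Ap\<close> and \<open>Am\<close> to the right and to the left of 0 is the one under
  which the constant in the reproducing identity is 1. The factor \<open>\<omega>\<close> is the ratio of the components of
  the eigenvector of the residue matrix at 0 for the eigenvalue \<open>i \<beta>\<close>.\<close>

locale whittaker_pair = decaying_pair +
  fixes \<beta> :: real and Ap Am \<omega> :: complex
  assumes \<rho>_pos: "\<rho> > 0" and \<beta>_nz: "\<beta> \<noteq> 0" and \<rho>_sq: "\<rho>\<^sup>2 = a\<^sup>2 + \<beta>\<^sup>2"
    and \<omega>_def: "\<omega> = Complex (- a / \<rho>) (\<beta> / \<rho>)"
    and p_right: "((\<lambda>x. p x - log_wave \<beta> Ap x) \<longlongrightarrow> 0) (at_right 0)"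
    and q_right: "((\<lambda>x. q x - log_wave \<beta> (\<omega> * Ap) x) \<longlongrightarrow> 0) (at_right 0)"
    and p_left: "((\<lambda>x. p x - log_wave \<beta> Am x) \<longlongrightarrow> 0) (at_left 0)"
    and q_left: "((\<lambda>x. q x - log_wave \<beta> (\<omega> * Am) x) \<longlongrightarrow> 0) (at_left 0)"
    and amplitude: "norm Am = norm Ap" "norm Ap \<noteq> 0"
    and connection: "4 * pi * \<beta> * (norm Ap ^ 4 * cosh (2 * pi * \<beta>) - Re ((cnj Ap * Am)\<^sup>2))
        = \<rho> * (norm Ap)\<^sup>2 * sinh (2 * pi * \<beta>)"
begin

lemma norm_\<omega>: "norm \<omega> = 1"
proof -
  have "(norm \<omega>)\<^sup>2 = (a\<^sup>2 + \<beta>\<^sup>2) / \<rho>\<^sup>2"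
    by (simp add: \<omega>_def cmod_power2 power_divide add_divide_distrib)
  also have "\<dots> = 1" unfolding \<rho>_sq[symmetric] using \<rho>_pos by simp
  finally show ?thesis by (simp add: power2_eq_1_iff) (smt (verit) norm_ge_zero)
qed

text \<open>The quadratic form is a first integral of the system with the terms \<open>\<plusminus> x/2\<close> removed, of which
  the waves are solutions; so its value on a wave does not depend on \<open>x\<close>.\<close>

lemma quadratic_log_wave:
  "\<rho> * (log_wave \<beta> A x * log_wave \<beta> A x) + 2 * a * (log_wave \<beta> A x * log_wave \<beta> (\<omega> * A) x)
    + \<rho> * (log_wave \<beta> (\<omega> * A) x * log_wave \<beta> (\<omega> * A) x) = 4 * \<beta>\<^sup>2 * (norm A)\<^sup>2 / \<rho>"
proof -
  define u v where "u = Re (A * cis (\<beta> * ln \<bar>x\<bar>))" and "v = Im (A * cis (\<beta> * ln \<bar>x\<bar>))"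
  have uv: "u\<^sup>2 + v\<^sup>2 = (norm A)\<^sup>2"
    by (simp only: u_def v_def cmod_power2[symmetric] norm_mult norm_cis mult_1_right)
  have p: "log_wave \<beta> A x = 2 * u" by (simp add: log_wave_def u_def)
  have q: "log_wave \<beta> (\<omega> * A) x = - 2 * (a * u + \<beta> * v) / \<rho>"
    unfolding log_wave_def mult.assoc u_def v_def using \<rho>_pos by (simp add: \<omega>_def field_simps)
  have "\<rho> * (\<rho> * (2 * u * (2 * u)) + 2 * a * (2 * u * (- 2 * (a * u + \<beta> * v) / \<rho>))
      + \<rho> * ((- 2 * (a * u + \<beta> * v) / \<rho>) * (- 2 * (a * u + \<beta> * v) / \<rho>)))
    = 4 * (\<rho>\<^sup>2 * u\<^sup>2 - 2 * a * u * (a * u + \<beta> * v) + (a * u + \<beta> * v)\<^sup>2)"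
    using \<rho>_pos by (simp add: field_simps power2_eq_square)
  also have "\<dots> = 4 * \<beta>\<^sup>2 * (u\<^sup>2 + v\<^sup>2)"
    unfolding \<rho>_sq by (simp add: algebra_simps power2_eq_square)
  finally show ?thesis unfolding p q uv using \<rho>_pos by (simp add: field_simps)
qed

lemma H_limit:
  assumes A: "((\<lambda>x. p x - log_wave \<beta> A x) \<longlongrightarrow> 0) F" "((\<lambda>x. q x - log_wave \<beta> (\<omega> * A) x) \<longlongrightarrow> 0) F"
    and F: "F \<le> at 0"
  shows "(H \<longlongrightarrow> 4 * \<beta>\<^sup>2 * (norm A)\<^sup>2 / \<rho>) F"
proof -
  define C where "C = 2 * norm A + 2 * norm (\<omega> * A)"
  have b: "\<bar>log_wave \<beta> A x\<bar> \<le> C" "\<bar>log_wave \<beta> (\<omega> * A) x\<bar> \<le> C" for x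
    using log_wave_bound[of \<beta> A x] log_wave_bound[of \<beta> "\<omega> * A" x] norm_ge_zero[of A] norm_ge_zero[of "\<omega> * A"]
    unfolding C_def by linarith+
  have x: "((\<lambda>x. x * (p x * q x)) \<longlongrightarrow> 0) F" by (rule tendsto_mono[OF F product_tendsto_zero])
  define P Q where "P = log_wave \<beta> A" and "Q = log_wave \<beta> (\<omega> * A)"
  have "((\<lambda>x. \<rho> * (p x * p x - P x * P x) + 2 * a * (p x * q x - P x * Q x)
      + \<rho> * (q x * q x - Q x * Q x) - x * (p x * q x) + 4 * \<beta>\<^sup>2 * (norm A)\<^sup>2 / \<rho>)
      \<longlongrightarrow> \<rho> * 0 + 2 * a * 0 + \<rho> * 0 - 0 + 4 * \<beta>\<^sup>2 * (norm A)\<^sup>2 / \<rho>) F"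
    unfolding P_def Q_def
    by (intro tendsto_add tendsto_diff tendsto_mult tendsto_const x tendsto_zero_mult_diff[OF A(1) A(1) b(1) b(1)]
        tendsto_zero_mult_diff[OF A b] tendsto_zero_mult_diff[OF A(2) A(2) b(2) b(2)])
  moreover have "\<rho> * (p x * p x - P x * P x) + 2 * a * (p x * q x - P x * Q x)
      + \<rho> * (q x * q x - Q x * Q x) - x * (p x * q x) + 4 * \<beta>\<^sup>2 * (norm A)\<^sup>2 / \<rho> = H x" for x
    unfolding quadratic_log_wave[of A x, folded P_def Q_def, symmetric]
    by (simp add: scaled_density_def algebra_simps power2_eq_square)
  ultimately show ?thesis by simp
qed

lemma H_right: "(H \<longlongrightarrow> 4 * \<beta>\<^sup>2 * (norm Ap)\<^sup>2 / \<rho>) (at_right 0)"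
  by (rule H_limit[OF p_right q_right]) (rule at_le, simp)

lemma H_left: "(H \<longlongrightarrow> 4 * \<beta>\<^sup>2 * (norm Ap)\<^sup>2 / \<rho>) (at_left 0)"
  using H_limit[OF p_left q_left] amplitude by (simp add: at_le)

text \<open>The numerator of the kernel in the limit at 0.\<close>

lemma log_wave_wronskian:
  "log_wave \<beta> A 1 * log_wave \<beta> (\<omega> * B) y - log_wave \<beta> (\<omega> * A) 1 * log_wave \<beta> B y
    = - 4 * \<beta> / \<rho> * Im (cnj A * B * cis (\<beta> * ln \<bar>y\<bar>))"
proof -
  define u v s t where "u = Re A" and "v = Im A" and
    "s = Re (B * cis (\<beta> * ln \<bar>y\<bar>))" and "t = Im (B * cis (\<beta> * ln \<bar>y\<bar>))"
  have 1: "log_wave \<beta> A 1 = 2 * u" "log_wave \<beta> (\<omega> * A) 1 = - 2 * (a * u + \<beta> * v) / \<rho>"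
    using \<rho>_pos by (auto simp: log_wave_def u_def v_def \<omega>_def field_simps)
  have 2: "log_wave \<beta> B y = 2 * s" by (simp add: log_wave_def s_def)
  have 3: "log_wave \<beta> (\<omega> * B) y = - 2 * (a * s + \<beta> * t) / \<rho>"
    unfolding log_wave_def mult.assoc s_def t_def using \<rho>_pos by (simp add: \<omega>_def field_simps)
  have 4: "Im (cnj A * B * cis (\<beta> * ln \<bar>y\<bar>)) = u * t - v * s"
    unfolding mult.assoc by (simp add: u_def v_def s_def t_def)
  show ?thesis unfolding 1 2 3 4 using \<rho>_pos by (simp add: field_simps)
qed

text \<open>The scales \<open>t\<close> with \<open>t\<^sup>i\<^sup>\<beta> = 1\<close>.\<close>

lemma dilation_sequence:
  defines "s \<equiv> \<lambda>n::nat. exp (- 2 * pi * real n / \<bar>\<beta>\<bar>)"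
  shows "s n > 0" and "s \<longlonglongrightarrow> 0" and "y \<noteq> 0 \<Longrightarrow> log_wave \<beta> A (s n * y) = log_wave \<beta> A y"
proof -
  show "s n > 0" by (simp add: s_def)
  have "s = (\<lambda>n. exp (- 2 * pi / \<bar>\<beta>\<bar>) ^ n)" by (simp add: fun_eq_iff s_def flip: exp_of_nat_mult)
  then show "s \<longlonglongrightarrow> 0" using \<beta>_nz by (simp add: LIMSEQ_realpow_zero)
  assume "y \<noteq> 0"
  then have "\<beta> * ln \<bar>s n * y\<bar> = \<beta> * ln \<bar>y\<bar> + 2 * pi * of_int (if \<beta> > 0 then - int n else int n)"
    using \<beta>_nz by (simp add: s_def abs_mult ln_mult algebra_simps)
  then have "cis (\<beta> * ln \<bar>s n * y\<bar>) = cis (\<beta> * ln \<bar>y\<bar>)"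
    by (simp only: cis_mult[symmetric] cis_multiple_2pi[OF Ints_of_int] mult_1_right)
  then show "log_wave \<beta> A (s n * y) = log_wave \<beta> A y" by (simp add: log_wave_def)
qed

lemma log_wave_measurable[measurable]: "log_wave b A \<in> borel_measurable borel"
  unfolding log_wave_def by measurable

text \<open>The two half-lines contribute the sine integral and the cosine integral; the connection condition
  between the amplitudes is exactly what makes the sum equal to the limit of the scaled density.\<close>

lemma limit_kernel_integral:
  assumes int: "integrable lborel (\<lambda>y. (g y)\<^sup>2)"
    and pos: "\<And>y. y > 0 \<Longrightarrow> g y = - 4 * \<beta> / \<rho> * Im (cnj Ap * Ap * cis (\<beta> * ln \<bar>y\<bar>)) / (1 - y)"
    and neg: "\<And>y. y < 0 \<Longrightarrow> g y = - 4 * \<beta> / \<rho> * Im (cnj Ap * Am * cis (\<beta> * ln \<bar>y\<bar>)) / (1 - y)"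
  shows "(\<integral>y. (g y)\<^sup>2 \<partial>lborel) = 4 * \<beta>\<^sup>2 * (norm Ap)\<^sup>2 / \<rho>"
proof -
  define N where "N = norm Ap"
  define w where "w = cnj Ap * Am"
  have int2: "integrable lborel (\<lambda>y. indicator {0<..} y *\<^sub>R (g y)\<^sup>2)" "integrable lborel (\<lambda>y. indicator {..<0} y *\<^sub>R (g y)\<^sup>2)"
    by (rule integrable_mult_indicator[OF _ int], simp)+
  have "(\<integral>y. (g y)\<^sup>2 \<partial>lborel) = (\<integral>y. indicator {0<..} y *\<^sub>R (g y)\<^sup>2 + indicator {..<0} y *\<^sub>R (g y)\<^sup>2 \<partial>lborel)"
    by (rule integral_cong_AE)
      (use int int2 AE_lborel_singleton[of 0] in \<open>auto elim!: eventually_mono simp: indicator_def\<close>)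
  also have "\<dots> = (\<integral>y. indicator {0<..} y *\<^sub>R (g y)\<^sup>2 \<partial>lborel) + (\<integral>y. indicator {..<0} y *\<^sub>R (g y)\<^sup>2 \<partial>lborel)"
    by (rule Bochner_Integration.integral_add[OF int2])
  also have "(\<integral>y. indicator {0<..} y *\<^sub>R (g y)\<^sup>2 \<partial>lborel) = 16 * \<beta>\<^sup>2 / \<rho>\<^sup>2 * N ^ 4 * sine_log_integral \<beta>"
  proof -
    have sq: "cnj Ap * Ap = of_real (N\<^sup>2)" by (simp add: N_def complex_norm_square mult.commute flip: of_real_power)
    have e: "indicator {0<..} y *\<^sub>R (g y)\<^sup>2
        = (16 * \<beta>\<^sup>2 / \<rho>\<^sup>2 * N ^ 4) * (indicator {0<..} y *\<^sub>R (sin (\<beta> * ln y) / (1 - y))\<^sup>2)" for y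
      using pos[of y] unfolding sq by (auto simp: indicator_def power_divide power_mult_distrib)
    show ?thesis unfolding sine_log_integral_def set_lebesgue_integral_def
      by (simp only: e integral_mult_right_zero)
  qed
  also have "(\<integral>y. indicator {..<0} y *\<^sub>R (g y)\<^sup>2 \<partial>lborel)
      = 16 * \<beta>\<^sup>2 / \<rho>\<^sup>2 * (N ^ 4 / 2 - Re (w\<^sup>2) * (pi * \<beta> / sinh (2 * pi * \<beta>)))"
  proof -
    let ?I = "\<lambda>y. cis (2 * \<beta> * ln y) / of_real ((1 + y)\<^sup>2)"
    have 0: "(\<integral>y. indicator {..<0} y *\<^sub>R (g y)\<^sup>2 \<partial>lborel) = (\<integral>y. indicator {..<0} (- y) *\<^sub>R (g (- y))\<^sup>2 \<partial>lborel)"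
      using lborel_integral_real_affine[of "-1" "\<lambda>y. indicator {..<0} y *\<^sub>R (g y)\<^sup>2" 0] by simp
    have e: "indicator {..<0} (- y) *\<^sub>R (g (- y))\<^sup>2 = 8 * \<beta>\<^sup>2 / \<rho>\<^sup>2 * N ^ 4 * (indicator {0<..} y *\<^sub>R (1 / (1 + \<bar>y\<bar>)\<^sup>2))
        - 8 * \<beta>\<^sup>2 / \<rho>\<^sup>2 * Re (w\<^sup>2 * (indicator {0<..} y *\<^sub>R ?I y))" for y
    proof (cases "y > 0")
      case True
      define \<zeta> where "\<zeta> = w * cis (\<beta> * ln y)"
      have "(g (- y))\<^sup>2 = 16 * \<beta>\<^sup>2 / \<rho>\<^sup>2 * (Im \<zeta>)\<^sup>2 / (1 + y)\<^sup>2"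
        using neg[of "- y"] True by (simp add: \<zeta>_def w_def power_divide power_mult_distrib)
      also have "(Im \<zeta>)\<^sup>2 = (N ^ 4 - Re (w\<^sup>2 * cis (2 * \<beta> * ln y))) / 2"
      proof -
        have "norm \<zeta> = N\<^sup>2" by (simp add: \<zeta>_def norm_mult w_def amplitude N_def power2_eq_square)
        then have "(Re \<zeta>)\<^sup>2 + (Im \<zeta>)\<^sup>2 = N ^ 4" by (simp flip: cmod_power2)
        moreover have "Re (\<zeta>\<^sup>2) = (Re \<zeta>)\<^sup>2 - (Im \<zeta>)\<^sup>2" by (simp add: power2_eq_square)
        moreover have "\<zeta>\<^sup>2 = w\<^sup>2 * cis (2 * \<beta> * ln y)"
          by (simp add: \<zeta>_def power_mult_distrib Complex.DeMoivre mult_ac)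
        ultimately show ?thesis by simp
      qed
      also have "16 * b / v * ((n - r) / 2) / d = 8 * b / v * n * (1 / d) - 8 * b / v * (r / d)"
        for b v n r d :: real
        by (cases "v = 0"; cases "d = 0") (simp_all add: field_simps)
      finally have "(g (- y))\<^sup>2 = 8 * \<beta>\<^sup>2 / \<rho>\<^sup>2 * N ^ 4 * (1 / (1 + y)\<^sup>2) - 8 * \<beta>\<^sup>2 / \<rho>\<^sup>2 * (Re (w\<^sup>2 * cis (2 * \<beta> * ln y)) / (1 + y)\<^sup>2)" .
      also have "Re (w\<^sup>2 * cis (2 * \<beta> * ln y)) / (1 + y)\<^sup>2 = Re (w\<^sup>2 * ?I y)"
        unfolding times_divide_eq_right Re_divide_of_real ..
      finally show ?thesis using True by simp
    qed simp
    have int3: "integrable lborel (\<lambda>y. indicator {0<..} y *\<^sub>R ?I y)"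
      using cis_log_integral(1)[of "2 * \<beta>"] \<beta>_nz by (simp add: set_integrable_def)
    have val: "(\<integral>y. indicator {0<..} y *\<^sub>R ?I y \<partial>lborel) = of_real (2 * pi * \<beta> / sinh (2 * pi * \<beta>))"
      using cis_log_integral(2)[of "2 * \<beta>"] \<beta>_nz by (simp add: set_lebesgue_integral_def mult_ac)
    have int4: "integrable lborel (\<lambda>y. w\<^sup>2 * (indicator {0<..} y *\<^sub>R ?I y))"
      by (intro integrable_mult_right int3)
    have "(\<integral>y. Re (w\<^sup>2 * (indicator {0<..} y *\<^sub>R ?I y)) \<partial>lborel) = Re (w\<^sup>2 * of_real (2 * pi * \<beta> / sinh (2 * pi * \<beta>)))"
      by (subst integral_Re[OF int4]) (simp only: integral_mult_right_zero val)
    also have "\<dots> = Re (w\<^sup>2) * (2 * pi * \<beta> / sinh (2 * pi * \<beta>))" by (simp only: times_complex.sel Re_complex_of_real Im_complex_of_real mult_zero_right diff_zero)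
    finally have re: "(\<integral>y. Re (w\<^sup>2 * (indicator {0<..} y *\<^sub>R ?I y)) \<partial>lborel) = Re (w\<^sup>2) * (2 * pi * \<beta> / sinh (2 * pi * \<beta>))" .
    note int5 = inverse_square_integral(1)[unfolded set_integrable_def]
    have val2: "(\<integral>y. indicator {..<0} (- y) *\<^sub>R (g (- y))\<^sup>2 \<partial>lborel)
        = 8 * \<beta>\<^sup>2 / \<rho>\<^sup>2 * N ^ 4 * 1 - 8 * \<beta>\<^sup>2 / \<rho>\<^sup>2 * (Re (w\<^sup>2) * (2 * pi * \<beta> / sinh (2 * pi * \<beta>)))"
    proof -
      have lin: "(\<integral>y. c * f y - d * h y \<partial>lborel) = c * (\<integral>y. f y \<partial>lborel) - d * (\<integral>y. h y \<partial>lborel)"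
        if "integrable lborel f" "integrable lborel h" for c d :: real and f h :: "real \<Rightarrow> real"
        using that by simp
      show ?thesis
        unfolding e lin[OF int5 integrable_Re[OF int4]] re
          inverse_square_integral(2)[unfolded set_lebesgue_integral_def] ..
    qed
    have "8 * b / v * n * 1 - 8 * b / v * (r * (2 * c / d)) = 16 * b / v * (n / 2 - r * (c / d))"
      for b v n r c d :: real
      by (cases "v = 0"; cases "d = 0") (simp_all add: field_simps)
    from this[of _ _ _ _ "pi * \<beta>"] show ?thesis unfolding 0 val2 by (simp only: mult.assoc)
  qed
  also have "16 * \<beta>\<^sup>2 / \<rho>\<^sup>2 * N ^ 4 * sine_log_integral \<beta>
      + 16 * \<beta>\<^sup>2 / \<rho>\<^sup>2 * (N ^ 4 / 2 - Re (w\<^sup>2) * (pi * \<beta> / sinh (2 * pi * \<beta>)))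
    = 4 * \<beta>\<^sup>2 / \<rho>\<^sup>2 * (4 * pi * \<beta> * (N ^ 4 * cosh (2 * pi * \<beta>) - Re (w\<^sup>2))) / sinh (2 * pi * \<beta>)"
  proof -
    have "16 * b / v * n * (x * co / d - 1/2) + 16 * b / v * (n / 2 - r * (x / d))
        = 4 * b / v * (4 * x * (n * co - r)) / d" for b v n x co d r :: real
      by (cases "v = 0"; cases "d = 0") (simp_all add: field_simps)
    from this[of _ _ _ "pi * \<beta>"] show ?thesis
      unfolding sine_log_integral_eq[OF \<beta>_nz] by (simp only: mult.assoc)
  qed
  also have "\<dots> = 4 * \<beta>\<^sup>2 / \<rho>\<^sup>2 * (\<rho> * N\<^sup>2 * sinh (2 * pi * \<beta>)) / sinh (2 * pi * \<beta>)"
    using connection by (simp only: N_def w_def)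
  also have "\<dots> = 4 * \<beta>\<^sup>2 * (norm Ap)\<^sup>2 / \<rho>"
    using \<rho>_pos \<beta>_nz by (simp add: N_def power2_eq_square)
  finally show ?thesis .
qed

text \<open>By proportionality only the constant is to be found, and it is found in the limit along the scales
  on which the waves repeat.\<close>

lemma reproducing_pos:
  assumes "x > 0"
  shows "x * kk x = H x"
proof -
  have "pp = qq" by (rule pp_eq_qq[OF \<rho>_pos H_right H_left])
  then obtain c where c: "\<And>t. t > 0 \<Longrightarrow> t * kk t = c * H t"
    using kk_proportional[OF \<rho>_pos] by blast
  define h where "h = 4 * \<beta>\<^sup>2 * (norm Ap)\<^sup>2 / \<rho>"
  have h: "h \<noteq> 0" using amplitude \<beta>_nz \<rho>_pos by (simp add: h_def)
  define s where "s n = exp (- 2 * pi * real n / \<bar>\<beta>\<bar>)" for n :: nat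
  note s = dilation_sequence[folded s_def]
  define p0 where "p0 y = log_wave \<beta> (if y > 0 then Ap else Am) y" for y
  define q0 where "q0 y = log_wave \<beta> (\<omega> * (if y > 0 then Ap else Am)) y" for y
  have [measurable]: "p0 \<in> borel_measurable borel" "q0 \<in> borel_measurable borel"
    unfolding p0_def q0_def if_distrib[of "\<lambda>A. log_wave \<beta> A _"] if_distrib[of "\<lambda>A. log_wave \<beta> (\<omega> * A) _"] by measurable
  have s_nz: "s n \<noteq> 0" for n using s(1)[of n] by simp
  have fr: "filterlim (\<lambda>n. s n * y) (at_right 0) sequentially" if "y > 0" for y
    using tendsto_mult_left_zero[OF s(2), of y] s(1) s_nz that by (auto simp: filterlim_at)
  have fl: "filterlim (\<lambda>n. s n * y) (at_left 0) sequentially" if "y < 0" for y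
    using tendsto_mult_left_zero[OF s(2), of y] s(1) s_nz that by (auto simp: filterlim_at mult_less_0_iff)
  have lims: "(\<lambda>n. p (s n * y)) \<longlonglongrightarrow> p0 y" "(\<lambda>n. q (s n * y)) \<longlonglongrightarrow> q0 y" if "y \<noteq> 0" for y
  proof -
    have *: "(\<lambda>n. f (s n * y)) \<longlonglongrightarrow> log_wave \<beta> A y"
      if "(\<lambda>n. f (s n * y) - log_wave \<beta> A (s n * y)) \<longlonglongrightarrow> 0" for f A
      using that unfolding s(3)[OF \<open>y \<noteq> 0\<close>] by (simp add: LIM_zero_iff)
    show "(\<lambda>n. p (s n * y)) \<longlonglongrightarrow> p0 y"
      using *[of p] filterlim_compose[OF p_right fr] filterlim_compose[OF p_left fl] that
      unfolding p0_def by (cases "y > 0") auto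
    show "(\<lambda>n. q (s n * y)) \<longlonglongrightarrow> q0 y"
      using *[of q] filterlim_compose[OF q_right fr] filterlim_compose[OF q_left fl] that
      unfolding q0_def by (cases "y > 0") auto
  qed
  define g where "g y = (p0 1 * q0 y - q0 1 * p0 y) / (1 - y)" for y
  note lim = kk_limit_at_zero[OF s(1) lims, simplified, folded g_def]
  have "(\<integral>y. (g y)\<^sup>2 \<partial>lborel) = h"
    unfolding h_def
  proof (rule limit_kernel_integral)
    show "integrable lborel (\<lambda>y. (g y)\<^sup>2)" by (rule lim(2))
    show "g y = - 4 * \<beta> / \<rho> * Im (cnj Ap * Ap * cis (\<beta> * ln \<bar>y\<bar>)) / (1 - y)" if "y > 0" for y
      using that log_wave_wronskian[of Ap Ap y] by (simp add: g_def p0_def q0_def)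
    show "g y = - 4 * \<beta> / \<rho> * Im (cnj Ap * Am * cis (\<beta> * ln \<bar>y\<bar>)) / (1 - y)" if "y < 0" for y
      using that log_wave_wronskian[of Ap Am y] by (simp add: g_def p0_def q0_def)
  qed
  then have "(\<lambda>n. c * H (s n)) \<longlonglongrightarrow> h" using lim(1) c[OF s(1)] by simp
  moreover have "(\<lambda>n. c * H (s n)) \<longlonglongrightarrow> c * h"
    using filterlim_compose[OF H_right fr[of 1]] by (intro tendsto_mult tendsto_const) (simp add: h_def)
  ultimately have "c * h = h" using LIMSEQ_unique by blast
  then have "c = 1" using h by simp
  then show ?thesis using c[OF assms] by simp
qed

end

lemma log_wave_minus: "log_wave \<beta> A (- x) = log_wave \<beta> A x"
  and log_wave_uminus: "log_wave \<beta> (- A) x = - log_wave \<beta> A x"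
  by (simp_all add: log_wave_def)

lemma scaled_density_mirror:
  "scaled_density (- a) \<rho> (\<lambda>x. q (- x)) (\<lambda>x. - p (- x)) x = scaled_density a \<rho> p q (- x)"
  by (simp add: scaled_density_def algebra_simps)

lemma whittaker_k_mirror:
  "whittaker_k (- a) \<rho> (\<lambda>x. q (- x)) (\<lambda>x. - p (- x)) x y = - whittaker_k a \<rho> p q (- x) (- y)"
proof (cases "x = y")
  case True
  then show ?thesis by (simp add: whittaker_k_def scaled_density_mirror)
next
  case False
  then have "x - y \<noteq> 0" "y - x \<noteq> 0" by auto
  with False show ?thesis by (simp add: whittaker_k_def field_simps)
qed

context whittaker_pair begin

text \<open>The reflected pair satisfies the same assumptions, with the amplitudes exchanged and multiplied
  by the phase \<open>\<omega>\<close>; so the reproducing identity extends to negative \<open>x\<close>.\<close>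

lemma mirror: "whittaker_pair (- a) \<rho> M (\<lambda>x. q (- x)) (\<lambda>x. - p (- x)) \<beta> (\<omega> * Am) (\<omega> * Ap) (Complex (a / \<rho>) (\<beta> / \<rho>))"
proof
  have img: "uminus ` (- {0}) = - {0 :: real}" by (auto intro: image_eqI[of _ _ "- x" for x])
  show "whittaker_system (- a) \<rho> (\<lambda>x. q (- x)) (\<lambda>x. - p (- x)) (- {0})"
    using whittaker_system_mirror[OF sys] unfolding img .
  show "M \<ge> 0" by (rule M_nonneg)
  show "\<bar>q (- x)\<bar> \<le> M * exp (- \<bar>x\<bar> / 4)" "\<bar>- p (- x)\<bar> \<le> M * exp (- \<bar>x\<bar> / 4)" if "x \<noteq> 0" for x
    using p_bound[of "- x"] q_bound[of "- x"] that by simp_all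
  show "\<rho> > 0" "\<beta> \<noteq> 0" "\<rho>\<^sup>2 = (- a)\<^sup>2 + \<beta>\<^sup>2" "Complex (a / \<rho>) (\<beta> / \<rho>) = Complex (- (- a) / \<rho>) (\<beta> / \<rho>)"
    using \<rho>_pos \<beta>_nz \<rho>_sq by simp_all
  have "a\<^sup>2 / \<rho>\<^sup>2 + \<beta>\<^sup>2 / \<rho>\<^sup>2 = \<rho>\<^sup>2 / \<rho>\<^sup>2" unfolding \<rho>_sq by (simp only: add_divide_distrib)
  also have "\<dots> = 1" using \<rho>_pos by simp
  finally have "a\<^sup>2 / \<rho>\<^sup>2 + \<beta>\<^sup>2 / \<rho>\<^sup>2 = 1" .
  then have m1: "Complex (a / \<rho>) (\<beta> / \<rho>) * \<omega> = - 1"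
    by (simp add: \<omega>_def complex_eq_iff power2_eq_square)
  have m: "Complex (a / \<rho>) (\<beta> / \<rho>) * (\<omega> * A) = - A" for A
    unfolding mult.assoc[symmetric] m1 by simp
  have r: "((\<lambda>x. f (- x) - log_wave \<beta> A x) \<longlongrightarrow> 0) (at_right 0)"
    if "((\<lambda>x. f x - log_wave \<beta> A x) \<longlongrightarrow> 0) (at_left 0)" for f A
    using that by (simp add: filterlim_at_left_to_right log_wave_minus)
  have l: "((\<lambda>x. f (- x) - log_wave \<beta> A x) \<longlongrightarrow> 0) (at_left 0)"
    if "((\<lambda>x. f x - log_wave \<beta> A x) \<longlongrightarrow> 0) (at_right 0)" for f A
    using that by (simp add: filterlim_at_left_to_right log_wave_minus)
  show "((\<lambda>x. q (- x) - log_wave \<beta> (\<omega> * Am) x) \<longlongrightarrow> 0) (at_right 0)" by (rule r[OF q_left])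
  show "((\<lambda>x. q (- x) - log_wave \<beta> (\<omega> * Ap) x) \<longlongrightarrow> 0) (at_left 0)" by (rule l[OF q_right])
  show "((\<lambda>x. - p (- x) - log_wave \<beta> (Complex (a / \<rho>) (\<beta> / \<rho>) * (\<omega> * Am)) x) \<longlongrightarrow> 0) (at_right 0)"
    unfolding m log_wave_uminus using tendsto_minus[OF r[OF p_left]] by simp
  show "((\<lambda>x. - p (- x) - log_wave \<beta> (Complex (a / \<rho>) (\<beta> / \<rho>) * (\<omega> * Ap)) x) \<longlongrightarrow> 0) (at_left 0)"
    unfolding m log_wave_uminus using tendsto_minus[OF l[OF p_right]] by simp
  show "norm (\<omega> * Ap) = norm (\<omega> * Am)" "norm (\<omega> * Am) \<noteq> 0"
    using amplitude norm_\<omega> by (simp_all add: norm_mult)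
  have "cnj (\<omega> * Am) * (\<omega> * Ap) = cnj (cnj Ap * Am) * (\<omega> * cnj \<omega>)" by (simp add: mult_ac)
  also have "\<omega> * cnj \<omega> = 1" using complex_norm_square[of \<omega>] norm_\<omega> by simp
  finally have "Re ((cnj (\<omega> * Am) * (\<omega> * Ap))\<^sup>2) = Re ((cnj Ap * Am)\<^sup>2)"
    by (metis complex_cnj_power complex_cnj(1) mult_1_right complex_cnj_cnj cnj.simps(1))
  then show "4 * pi * \<beta> * (norm (\<omega> * Am) ^ 4 * cosh (2 * pi * \<beta>) - Re ((cnj (\<omega> * Am) * (\<omega> * Ap))\<^sup>2))
      = \<rho> * (norm (\<omega> * Am))\<^sup>2 * sinh (2 * pi * \<beta>)"
    using connection by (simp only: norm_mult norm_\<omega> amplitude(1) mult_1_left)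
qed

lemma kernel_square_pos:
  assumes x: "x > 0"
  shows "integrable lborel (\<lambda>y. (k x y)\<^sup>2)" "(\<integral>y. (k x y)\<^sup>2 \<partial>lborel) = H x / \<bar>x\<bar>"
proof -
  have "integrable lborel (\<lambda>y. (1 / x\<^sup>2) * (x * k x (0 + x * y))\<^sup>2)"
    using dilated_kernel_square_integrable[OF x] by (intro integrable_mult_right) simp
  then have "integrable lborel (\<lambda>y. (k x (0 + x * y))\<^sup>2)"
    using x by (simp add: power_mult_distrib)
  then show "integrable lborel (\<lambda>y. (k x y)\<^sup>2)"
    using lborel_integrable_real_affine_iff[of x "\<lambda>y. (k x y)\<^sup>2" 0] x by simp
  show "(\<integral>y. (k x y)\<^sup>2 \<partial>lborel) = H x / \<bar>x\<bar>"
    using reproducing_pos[OF x] x by (simp add: kk_def field_simps)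
qed

lemma kernel_square:
  assumes x: "x \<noteq> 0"
  shows "integrable lborel (\<lambda>y. (k x y)\<^sup>2)" "(\<integral>y. (k x y)\<^sup>2 \<partial>lborel) = H x / \<bar>x\<bar>"
proof -
  have "integrable lborel (\<lambda>y. (k x y)\<^sup>2) \<and> (\<integral>y. (k x y)\<^sup>2 \<partial>lborel) = H x / \<bar>x\<bar>"
  proof (cases "x > 0")
    case False
    then have mx: "- x > 0" using x by simp
    note * = whittaker_pair.kernel_square_pos[OF mirror mx, unfolded whittaker_k_mirror scaled_density_mirror]
    then have "integrable lborel (\<lambda>y. (k x (0 + (- 1) * y))\<^sup>2)" "(\<integral>y. (k x (0 + (- 1) * y))\<^sup>2 \<partial>lborel) = H x / \<bar>x\<bar>"
      by simp_all
    then show ?thesis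
      using lborel_integrable_real_affine_iff[of "- 1" "\<lambda>y. (k x y)\<^sup>2" 0]
        lborel_integral_real_affine[of "- 1" "\<lambda>y. (k x y)\<^sup>2" 0] by simp
  qed (simp add: kernel_square_pos)
  then show "integrable lborel (\<lambda>y. (k x y)\<^sup>2)" "(\<integral>y. (k x y)\<^sup>2 \<partial>lborel) = H x / \<bar>x\<bar>" by auto
qed

lemma kernel_square_nn:
  assumes "x \<noteq> 0"
  shows "(\<integral>\<^sup>+y. ennreal ((k x y)\<^sup>2) \<partial>lborel) = ennreal (H x / \<bar>x\<bar>)"
  using nn_integral_eq_integral[OF kernel_square(1)[OF assms]] kernel_square(2)[OF assms] by simp

end


section \<open>Kummer functions\<close>

definition kummer_coeff :: "complex \<Rightarrow> complex \<Rightarrow> nat \<Rightarrow> complex" where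
  "kummer_coeff a b n = pochhammer a n / (pochhammer b n * fact n)"

text \<open>The condition on the real part is enough here, because the second Kummer parameter is
  \<open>1 \<plusminus> 2 i \<beta>\<close>.\<close>

lemma pochhammer_nonzero:
  fixes b :: complex
  assumes "Re b \<ge> 1"
  shows "pochhammer b n \<noteq> 0"
proof
  assume "pochhammer b n = 0"
  then obtain m where "b = - of_nat m" by (auto simp: pochhammer_eq_0_iff)
  then show False using assms by simp
qed

lemma kummer_coeff_Suc:
  assumes "Re b \<ge> 1"
  shows "kummer_coeff a b (Suc n) = (a + of_nat n) / ((b + of_nat n) * of_nat (Suc n)) * kummer_coeff a b n"
  by (simp add: kummer_coeff_def pochhammer_rec' del: of_nat_Suc)

lemma kummer_summable:
  fixes x :: complex
  assumes b: "Re b \<ge> 1"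
  shows "summable (\<lambda>n. kummer_coeff a b n * x ^ n)"
proof -
  define K where "K = (norm a + 1) * norm x"
  obtain N :: nat where N: "2 * K \<le> real N" using real_arch_simple by blast
  show ?thesis
  proof (rule summable_ratio_test[of "1/2" N])
    fix n assume "N \<le> n"
    then have n: "2 * K \<le> real (Suc n)" using N by simp
    have "real (Suc n) \<le> Re (b + of_nat n)" using b by simp
    also have "\<dots> \<le> norm (b + of_nat n)" by (rule complex_Re_le_cmod)
    finally have 1: "real (Suc n) \<le> norm (b + of_nat n)" .
    have "norm (a + of_nat n) \<le> norm a + real n" using norm_triangle_ineq[of a "of_nat n"] by simp
    also have "\<dots> \<le> (norm a + 1) * real (Suc n)" by (simp add: algebra_simps)
    finally have 2: "norm (a + of_nat n) \<le> (norm a + 1) * real (Suc n)" .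
    have "norm (a + of_nat n) / norm (b + of_nat n) \<le> (norm a + 1) * real (Suc n) / real (Suc n)"
      using 1 2 by (intro frac_le) auto
    then have 3: "norm (a + of_nat n) / norm (b + of_nat n) \<le> norm a + 1" by simp
    have "norm (kummer_coeff a b (Suc n) * x ^ Suc n)
        = (norm (a + of_nat n) / norm (b + of_nat n)) * norm x / real (Suc n) * norm (kummer_coeff a b n * x ^ n)"
      unfolding kummer_coeff_Suc[OF b] by (simp add: norm_mult norm_divide norm_power del: of_nat_Suc)
    also have "\<dots> \<le> (norm a + 1) * norm x / real (Suc n) * norm (kummer_coeff a b n * x ^ n)"
      by (intro mult_right_mono divide_right_mono 3) auto
    also have "(norm a + 1) * norm x / real (Suc n) \<le> 1 / 2"
      using n by (simp add: K_def field_simps del: of_nat_Suc)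
    then have "(norm a + 1) * norm x / real (Suc n) * norm (kummer_coeff a b n * x ^ n) \<le> 1/2 * norm (kummer_coeff a b n * x ^ n)"
      by (intro mult_right_mono) auto
    finally show "norm (kummer_coeff a b (Suc n) * x ^ Suc n) \<le> 1/2 * norm (kummer_coeff a b n * x ^ n)" .
  qed simp
qed

lemma kummer_M_altdef: "kummer_M a b x = (\<Sum>n. kummer_coeff a b n * x ^ n)"
  by (simp add: kummer_M_def kummer_coeff_def)

lemma kummer_M_0: "kummer_M a b 0 = 1"
  unfolding kummer_M_altdef powser_zero by (simp add: kummer_coeff_def)

text \<open>The derivative is recorded through \<open>x D\<close>, on which the coefficients act by multiplication with
  \<open>n\<close>; the contiguity relations are then identities between coefficients.\<close>

lemma kummer_M_deriv:
  assumes b: "Re b \<ge> 1"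
  obtains D where "(kummer_M a b has_field_derivative D) (at x)"
    and "(\<lambda>n. of_nat n * kummer_coeff a b n * x ^ n) sums (x * D)"
proof -
  let ?c = "kummer_coeff a b"
  have sm: "summable (\<lambda>n. ?c n * y ^ n)" for y by (rule kummer_summable[OF b])
  define D where "D = (\<Sum>n. diffs ?c n * x ^ n)"
  have d: "(kummer_M a b has_field_derivative D) (at x)"
    unfolding kummer_M_altdef[abs_def] D_def
    by (rule termdiffs_strong_converges_everywhere[OF sm])
  have "summable (\<lambda>n. diffs ?c n * x ^ n)"
    by (rule termdiff_converges_all[OF sm])
  then have "(\<lambda>n. x * (diffs ?c n * x ^ n)) sums (x * D)" unfolding D_def by (intro sums_mult summable_sums)
  moreover have "x * (diffs ?c n * x ^ n) = of_nat (Suc n) * ?c (Suc n) * x ^ Suc n" for n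
    by (simp only: diffs_def power_Suc mult_ac)
  ultimately have "(\<lambda>n. of_nat (Suc n) * ?c (Suc n) * x ^ Suc n) sums (x * D)" by (simp only:)
  then have "(\<lambda>n. of_nat n * ?c n * x ^ n) sums (x * D)"
    unfolding sums_Suc_iff[of "\<lambda>n. of_nat n * ?c n * x ^ n"] by simp
  with d show ?thesis by (rule that)
qed

text \<open>Contiguity, from \<open>a (a + 1)\<^sub>n = (a + n) (a)\<^sub>n\<close>.\<close>

lemma kummer_M_deriv_raise:
  assumes b: "Re b \<ge> 1"
  shows "\<exists>D. (kummer_M a b has_field_derivative D) (at x) \<and> x * D = a * (kummer_M (a + 1) b x - kummer_M a b x)"
proof -
  obtain D where D: "(kummer_M a b has_field_derivative D) (at x)"
    "(\<lambda>n. of_nat n * kummer_coeff a b n * x ^ n) sums (x * D)" using kummer_M_deriv[OF b] .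
  have c: "of_nat n * kummer_coeff a b n = a * (kummer_coeff (a + 1) b n - kummer_coeff a b n)" for n
  proof -
    have "a * pochhammer (a + 1) n = (a + of_nat n) * pochhammer a n"
      using pochhammer_rec[of a n] pochhammer_rec'[of a n] by simp
    then have "a * kummer_coeff (a + 1) b n = (a + of_nat n) * kummer_coeff a b n"
      by (simp add: kummer_coeff_def)
    then show ?thesis by (simp add: algebra_simps)
  qed
  have "(\<lambda>n. a * (kummer_coeff (a + 1) b n * x ^ n - kummer_coeff a b n * x ^ n))
      sums (a * (kummer_M (a + 1) b x - kummer_M a b x))"
    unfolding kummer_M_altdef by (intro sums_mult sums_diff summable_sums kummer_summable b)
  moreover have "a * (kummer_coeff (a + 1) b n * x ^ n - kummer_coeff a b n * x ^ n) = of_nat n * kummer_coeff a b n * x ^ n" for n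
    by (simp only: c right_diff_distrib left_diff_distrib mult.assoc)
  ultimately have "(\<lambda>n. of_nat n * kummer_coeff a b n * x ^ n) sums (a * (kummer_M (a + 1) b x - kummer_M a b x))"
    by (simp only:)
  with D show ?thesis using sums_unique2 by blast
qed

text \<open>The companion relation that leads back from \<open>a + 1\<close> to \<open>a\<close>. The two relations together are a
  first-order system for the functions with parameters \<open>a\<close> and \<open>a + 1\<close>.\<close>

lemma kummer_M_deriv_lower:
  assumes b: "Re b \<ge> 1"
  shows "\<exists>D. (kummer_M (a + 1) b has_field_derivative D) (at x) \<and>
    x * D = (x - (b - a - 1)) * kummer_M (a + 1) b x + (b - a - 1) * kummer_M a b x"
proof -
  let ?c = "kummer_coeff (a + 1) b" and ?d = "kummer_coeff a b"
  obtain D where D: "(kummer_M (a + 1) b has_field_derivative D) (at x)"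
    "(\<lambda>n. of_nat n * ?c n * x ^ n) sums (x * D)" using kummer_M_deriv[OF b] .
  have c: "of_nat (Suc n) * ?c (Suc n) = ?c n - (b - a - 1) * ?c (Suc n) + (b - a - 1) * ?d (Suc n)" for n
  proof -
    define u where "u = pochhammer (a + 1) n / (pochhammer b (Suc n) * fact (Suc n))"
    have nz: "b + of_nat n \<noteq> 0" using b by (auto simp: complex_eq_iff)
    have 1: "?c (Suc n) = u * (a + 1 + of_nat n)"
      by (simp only: kummer_coeff_def u_def pochhammer_rec'[of "a + 1"]) simp
    have 2: "?d (Suc n) = u * a"
      by (simp only: kummer_coeff_def u_def pochhammer_rec[of a]) simp
    have f: "fact (Suc n) = of_nat (Suc n) * (fact n :: complex)" by (rule fact_Suc)
    have 3: "?c n = u * ((b + of_nat n) * of_nat (Suc n))"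
      using nz pochhammer_nonzero[OF b, of n]
      by (simp only: kummer_coeff_def u_def pochhammer_rec'[of b] f) (simp del: of_nat_Suc)
    show ?thesis unfolding 1 2 3 of_nat_Suc by (simp add: algebra_simps)
  qed
  have sc: "(\<lambda>n. ?c n * x ^ n) sums kummer_M (a + 1) b x" and sd: "(\<lambda>n. ?d n * x ^ n) sums kummer_M a b x"
    unfolding kummer_M_altdef by (rule summable_sums[OF kummer_summable[OF b]])+
  have head: "?c 0 * x ^ 0 = 1" "?d 0 * x ^ 0 = 1" by (simp_all add: kummer_coeff_def)
  have sc': "(\<lambda>n. ?c (Suc n) * x ^ Suc n) sums (kummer_M (a + 1) b x - 1)"
    using sc unfolding sums_Suc_iff[of "\<lambda>n. ?c n * x ^ n"] head by simp
  have sd': "(\<lambda>n. ?d (Suc n) * x ^ Suc n) sums (kummer_M a b x - 1)"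
    using sd unfolding sums_Suc_iff[of "\<lambda>n. ?d n * x ^ n"] head by simp
  have "(\<lambda>n. x * (?c n * x ^ n) - (b - a - 1) * (?c (Suc n) * x ^ Suc n) + (b - a - 1) * (?d (Suc n) * x ^ Suc n))
     sums (x * kummer_M (a + 1) b x - (b - a - 1) * (kummer_M (a + 1) b x - 1) + (b - a - 1) * (kummer_M a b x - 1))"
    by (rule sums_add[OF sums_diff[OF sums_mult[OF sc] sums_mult[OF sc']] sums_mult[OF sd']])
  moreover have "x * (?c n * x ^ n) - (b - a - 1) * (?c (Suc n) * x ^ Suc n) + (b - a - 1) * (?d (Suc n) * x ^ Suc n)
      = of_nat (Suc n) * ?c (Suc n) * x ^ Suc n" for n
    by (simp only: c power_Suc) (simp only: algebra_simps)
  ultimately have "(\<lambda>n. of_nat (Suc n) * ?c (Suc n) * x ^ Suc n) sums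
     (x * kummer_M (a + 1) b x - (b - a - 1) * (kummer_M (a + 1) b x - 1) + (b - a - 1) * (kummer_M a b x - 1))"
    by (simp only:)
  then have "(\<lambda>n. of_nat n * ?c n * x ^ n) sums
     (x * kummer_M (a + 1) b x - (b - a - 1) * (kummer_M (a + 1) b x - 1) + (b - a - 1) * (kummer_M a b x - 1))"
    unfolding sums_Suc_iff[of "\<lambda>n. of_nat n * ?c n * x ^ n"] by simp
  with D(2) have "x * D = x * kummer_M (a + 1) b x - (b - a - 1) * (kummer_M (a + 1) b x - 1) + (b - a - 1) * (kummer_M a b x - 1)"
    by (rule sums_unique2)
  also have "\<dots> = (x - (b - a - 1)) * kummer_M (a + 1) b x + (b - a - 1) * kummer_M a b x"
    by (simp add: algebra_simps)
  finally have "x * D = (x - (b - a - 1)) * kummer_M (a + 1) b x + (b - a - 1) * kummer_M a b x" .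
  with D(1) show ?thesis by blast
qed

lemma kummer_coeff_cnj: "kummer_coeff (cnj a) (cnj b) n = cnj (kummer_coeff a b n)"
  by (simp add: kummer_coeff_def)

lemma kummer_M_cnj:
  assumes b: "Re b \<ge> 1"
  shows "kummer_M (cnj a) (cnj b) (cnj x) = cnj (kummer_M a b x)"
proof -
  have "(\<lambda>n. kummer_coeff a b n * x ^ n) sums kummer_M a b x"
    unfolding kummer_M_altdef by (rule summable_sums[OF kummer_summable[OF b]])
  then have "(\<lambda>n. cnj (kummer_coeff a b n * x ^ n)) sums cnj (kummer_M a b x)"
    by (rule sums_cnj[THEN iffD2])
  moreover have "cnj (kummer_coeff a b n * x ^ n) = kummer_coeff (cnj a) (cnj b) n * cnj x ^ n" for n
    by (simp only: complex_cnj_mult complex_cnj_power kummer_coeff_cnj)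
  ultimately have "(\<lambda>n. kummer_coeff (cnj a) (cnj b) n * cnj x ^ n) sums cnj (kummer_M a b x)"
    by (simp only:)
  then show ?thesis unfolding kummer_M_altdef[of "cnj a"] by (rule sums_unique[symmetric])
qed


section \<open>Whittaker functions as real solutions of the system\<close>

text \<open>The coefficient of \<open>x\<^sup>i\<^sup>\<beta>\<close> in the expansion of \<open>P\<^sub>+\<close> at 0, read off from the connection formula
  for the Whittaker function.\<close>

definition whittaker_amplitude :: "complex \<Rightarrow> complex" where
  "whittaker_amplitude z = of_real (sqrt (norm z) / norm (Gamma (1 + z)))
     * (Gamma (- (2 * \<i> * of_real (Im z))) / Gamma (- z))"

text \<open>The number \<open>- cnj z / |z|\<close>, in the form of the factor \<open>\<omega>\<close> above.\<close>

definition whittaker_phase :: "complex \<Rightarrow> complex" where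
  "whittaker_phase z = Complex (- Re z / norm z) (Im z / norm z)"

text \<open>One of the two complex conjugate terms whose sum is a Whittaker function. Its argument is complex so
  that the derivative is a complex one.\<close>

definition whittaker_wave :: "complex \<Rightarrow> complex \<Rightarrow> real \<Rightarrow> complex \<Rightarrow> complex" where
  "whittaker_wave A \<alpha> \<beta> x =
     A * (exp (- x / 2 + \<i> * of_real \<beta> * Ln x) * kummer_M \<alpha> (1 + 2 * \<i> * of_real \<beta>) x)"

definition wave_P :: "complex \<Rightarrow> real \<Rightarrow> real" where
  "wave_P z x = 2 * Re (whittaker_wave (whittaker_amplitude z) (- cnj z) (Im z) (of_real x))"

definition wave_Q :: "complex \<Rightarrow> real \<Rightarrow> real" where
  "wave_Q z x = 2 * Re (whittaker_wave (whittaker_phase z * whittaker_amplitude z) (1 - cnj z) (Im z) (of_real x))"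

lemma whittaker_phase_altdef: "whittaker_phase z = - cnj z / of_real (norm z)"
  by (simp add: whittaker_phase_def complex_eq_iff Re_divide_of_real Im_divide_of_real)

text \<open>The two contiguity relations are multiplied by \<open>exp (- x/2) x\<^sup>i\<^sup>\<beta>\<close>. The phase \<open>w\<close> is such that
  \<open>\<rho> w = - cnj z\<close> and \<open>z w = - \<rho>\<close>, and these are the two constants that the relations require.\<close>

lemma wave_system:
  assumes z: "z \<notin> \<real>"
  shows "whittaker_system (Re z) (norm z) (wave_P z) (wave_Q z) {0<..}"
  unfolding whittaker_system_def
proof (intro ballI)
  fix x :: real assume "x \<in> {0<..}"
  then have x: "x > 0" by simp
  define \<beta> a \<rho> A where "\<beta> = Im z" and "a = Re z" and "\<rho> = norm z" and "A = whittaker_amplitude z"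
  define w where "w = whittaker_phase z"
  define \<alpha> where "\<alpha> = - cnj z"
  define b where "b = 1 + 2 * \<i> * complex_of_real \<beta>"
  have b: "Re b \<ge> 1" by (simp add: b_def)
  have \<rho>: "\<rho> \<noteq> 0" using z by (auto simp: \<rho>_def)
  have \<rho>2: "complex_of_real \<rho> * \<rho> = z * cnj z"
    unfolding \<rho>_def using complex_norm_square[of z] by (simp only: power2_eq_square of_real_mult)
  define E where "E \<zeta> = exp (- \<zeta> / 2 + \<i> * of_real \<beta> * Ln \<zeta>)" for \<zeta> :: complex
  define c where "c = complex_of_real x"
  have c: "c \<notin> \<real>\<^sub>\<le>\<^sub>0" "c \<noteq> 0" using x by (auto simp: c_def)
  have "((\<lambda>\<zeta>. - \<zeta> / 2 + \<i> * of_real \<beta> * Ln \<zeta>) has_field_derivative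
      - 1 / 2 + \<i> * of_real \<beta> * inverse c) (at c)"
    by (rule DERIV_add[OF DERIV_cdivide[OF DERIV_minus[OF DERIV_ident]] DERIV_cmult[OF has_field_derivative_Ln[OF c(1)]]])
  then have "((\<lambda>\<zeta>. exp (- \<zeta> / 2 + \<i> * of_real \<beta> * Ln \<zeta>)) has_field_derivative
      exp (- c / 2 + \<i> * of_real \<beta> * Ln c) * (- 1 / 2 + \<i> * of_real \<beta> * inverse c)) (at c)"
    by (rule DERIV_fun_exp)
  then have dE: "(E has_field_derivative E c * (- 1 / 2 + \<i> * of_real \<beta> / c)) (at c)"
    by (simp only: E_def[abs_def] divide_inverse)
  obtain D1 where D1: "(kummer_M \<alpha> b has_field_derivative D1) (at c)"
    "c * D1 = \<alpha> * (kummer_M (\<alpha> + 1) b c - kummer_M \<alpha> b c)" using kummer_M_deriv_raise[OF b] by blast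
  obtain D0 where D0: "(kummer_M (\<alpha> + 1) b has_field_derivative D0) (at c)"
    "c * D0 = (c - (b - \<alpha> - 1)) * kummer_M (\<alpha> + 1) b c + (b - \<alpha> - 1) * kummer_M \<alpha> b c"
    using kummer_M_deriv_lower[OF b] by blast
  define F where "F \<zeta> = A * (E \<zeta> * kummer_M \<alpha> b \<zeta>)" for \<zeta>
  define G where "G \<zeta> = w * A * (E \<zeta> * kummer_M (\<alpha> + 1) b \<zeta>)" for \<zeta>
  have dF: "(F has_field_derivative A * (E c * (- 1/2 + \<i> * of_real \<beta> / c) * kummer_M \<alpha> b c + D1 * E c)) (at c)"
    unfolding F_def[abs_def] by (intro DERIV_cmult DERIV_mult dE D1)
  have dG: "(G has_field_derivative w * A * (E c * (- 1/2 + \<i> * of_real \<beta> / c) * kummer_M (\<alpha> + 1) b c + D0 * E c)) (at c)"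
    unfolding G_def[abs_def] by (intro DERIV_cmult DERIV_mult dE D0)
  have w: "of_real \<rho> * w = \<alpha>" using \<rho> by (simp add: w_def whittaker_phase_altdef \<alpha>_def \<rho>_def)
  have zw: "z * w = - of_real \<rho>"
    using \<rho> \<rho>2 by (simp add: w_def whittaker_phase_altdef \<rho>_def[symmetric] field_simps)
  have \<alpha>: "\<alpha> = \<i> * of_real \<beta> - of_real a" by (simp add: \<alpha>_def \<beta>_def a_def complex_eq_iff)
  have b\<alpha>: "b - \<alpha> - 1 = z" by (simp add: b_def \<alpha>_def \<beta>_def complex_eq_iff)
  have z': "z = of_real a + \<i> * of_real \<beta>" by (simp add: a_def \<beta>_def complex_eq_iff)
  have F': "A * (E c * (- 1/2 + \<i> * of_real \<beta> / c) * kummer_M \<alpha> b c + D1 * E c)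
      = of_real (a / x - 1/2) * F c + of_real (\<rho> / x) * G c" (is "?l = ?r")
  proof -
    have "c * ?l = A * E c * ((- c / 2 + \<i> * of_real \<beta>) * kummer_M \<alpha> b c + c * D1)"
      using c by (simp add: field_simps)
    also have "\<dots> = A * E c * ((a - c / 2) * kummer_M \<alpha> b c + of_real \<rho> * w * kummer_M (\<alpha> + 1) b c)"
      unfolding D1(2) w by (simp add: \<alpha> algebra_simps)
    also have "\<dots> = c * ?r"
      using c by (simp add: F_def G_def c_def[symmetric]) (simp add: field_simps)
    finally show ?thesis using c by simp
  qed
  have G': "w * A * (E c * (- 1/2 + \<i> * of_real \<beta> / c) * kummer_M (\<alpha> + 1) b c + D0 * E c)
      = of_real (- (a / x - 1/2)) * G c - of_real (\<rho> / x) * F c" (is "?l = ?r")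
  proof -
    have "c * ?l = w * A * E c * ((- c / 2 + \<i> * of_real \<beta>) * kummer_M (\<alpha> + 1) b c + c * D0)"
      using c by (simp add: field_simps)
    also have "\<dots> = w * A * E c * ((c / 2 - a) * kummer_M (\<alpha> + 1) b c) + (z * w) * A * E c * kummer_M \<alpha> b c"
      unfolding D0(2) b\<alpha> by (simp add: z' algebra_simps)
    also have "\<dots> = c * ?r"
      unfolding zw using c by (simp add: F_def G_def c_def[symmetric]) (simp add: field_simps)
    finally show ?thesis using c by simp
  qed
  have re: "((\<lambda>x. 2 * Re (f (of_real x))) has_real_derivative 2 * Re D) (at x)"
    if "(f has_field_derivative D) (at c)" for f D
  proof (rule DERIV_cmult)
    have "((\<lambda>x. f (of_real x)) has_vector_derivative D) (at x)"
      using that unfolding c_def by (rule has_vector_derivative_real_field)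
    then have "((\<lambda>x. Re (f (of_real x))) has_vector_derivative Re D) (at x)"
      by (rule bounded_linear.has_vector_derivative[OF bounded_linear_Re])
    then show "((\<lambda>x. Re (f (of_real x))) has_real_derivative Re D) (at x)"
      by (simp only: has_real_derivative_iff_has_vector_derivative)
  qed
  have P: "wave_P z = (\<lambda>x. 2 * Re (F (of_real x)))" and Q: "wave_Q z = (\<lambda>x. 2 * Re (G (of_real x)))"
    by (simp_all add: fun_eq_iff wave_P_def wave_Q_def whittaker_wave_def F_def G_def E_def A_def w_def \<alpha>_def b_def \<beta>_def)
  show "(wave_P z has_real_derivative (Re z / x - 1 / 2) * wave_P z x + norm z / x * wave_Q z x) (at x) \<and>
    (wave_Q z has_real_derivative - (Re z / x - 1 / 2) * wave_Q z x - norm z / x * wave_P z x) (at x)"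
  proof
    show "(wave_P z has_real_derivative (Re z / x - 1 / 2) * wave_P z x + norm z / x * wave_Q z x) (at x)"
      unfolding P Q a_def[symmetric] \<rho>_def[symmetric]
      by (rule DERIV_cong[OF re[OF dF]]) (simp only: F' plus_complex.sel Re_complex_of_real times_complex.sel Im_complex_of_real, simp add: c_def algebra_simps)
    show "(wave_Q z has_real_derivative - (Re z / x - 1 / 2) * wave_Q z x - norm z / x * wave_P z x) (at x)"
      unfolding P Q a_def[symmetric] \<rho>_def[symmetric]
      by (rule DERIV_cong[OF re[OF dG]]) (simp only: G' minus_complex.sel Re_complex_of_real times_complex.sel Im_complex_of_real, simp add: c_def algebra_simps)
  qed
qed

text \<open>The remaining factor \<open>exp (- x/2) M(x)\<close> tends to 1, and the wave is bounded.\<close>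

lemma wave_asymptotic:
  "((\<lambda>x. 2 * Re (whittaker_wave A \<alpha> \<beta> (of_real x)) - log_wave \<beta> A x) \<longlongrightarrow> 0) (at_right 0)"
proof (rule Lim_null_comparison)
  define b where "b = 1 + 2 * \<i> * complex_of_real \<beta>"
  define f where "f x = exp (- complex_of_real x / 2) * kummer_M \<alpha> b (of_real x) - 1" for x
  obtain D where "(kummer_M \<alpha> b has_field_derivative D) (at 0)"
    using kummer_M_deriv[of b \<alpha> 0] by (auto simp: b_def)
  then have "isCont (kummer_M \<alpha> b) (of_real 0)" by (auto intro: DERIV_isCont)
  then have "isCont (\<lambda>x. kummer_M \<alpha> b (complex_of_real x)) 0"
    by (rule isCont_o2[rotated]) (intro continuous_intros)
  then have "((\<lambda>x. kummer_M \<alpha> b (complex_of_real x)) \<longlongrightarrow> 1) (at 0)"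
    by (simp add: isCont_def kummer_M_0)
  then have "(f \<longlongrightarrow> exp (- complex_of_real 0 / 2) * 1 - 1) (at 0)"
    unfolding f_def[abs_def] by (intro tendsto_intros) auto
  then have f0: "(f \<longlongrightarrow> 0) (at_right 0)" by (simp add: filterlim_at_split)
  show "((\<lambda>x. 2 * norm A * norm (f x)) \<longlongrightarrow> 0) (at_right 0)"
    using tendsto_mult[OF tendsto_const tendsto_norm[OF f0], of "2 * norm A"] by simp
  show "\<forall>\<^sub>F x in at_right 0. norm (2 * Re (whittaker_wave A \<alpha> \<beta> (of_real x)) - log_wave \<beta> A x) \<le> 2 * norm A * norm (f x)"
    unfolding eventually_at_filter
  proof (intro always_eventually allI impI)
    fix x :: real assume "x \<in> {0<..}"
    then have x: "x > 0" by simp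
    have e: "exp (- complex_of_real x / 2 + \<i> * of_real \<beta> * Ln (of_real x)) = exp (- complex_of_real x / 2) * cis (\<beta> * ln x)"
      unfolding exp_add using x by (simp add: cis_conv_exp Ln_of_real mult_ac)
    define U where "U = A * cis (\<beta> * ln x)"
    have "whittaker_wave A \<alpha> \<beta> (of_real x) = U * (f x + 1)"
      unfolding whittaker_wave_def e f_def b_def U_def by (simp only: diff_add_cancel mult_ac)
    also have "\<dots> = U * f x + U" by (simp only: distrib_left mult_1_right)
    finally have "2 * Re (whittaker_wave A \<alpha> \<beta> (of_real x)) - log_wave \<beta> A x = 2 * Re (U * f x)"
      unfolding log_wave_def using x by (simp only: plus_complex.sel abs_of_pos U_def) (simp only: algebra_simps)
    then have "norm (2 * Re (whittaker_wave A \<alpha> \<beta> (of_real x)) - log_wave \<beta> A x) = 2 * \<bar>Re (U * f x)\<bar>"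
      by (simp only: real_norm_def abs_mult abs_numeral)
    also have "\<dots> \<le> 2 * norm (U * f x)" by (intro mult_left_mono abs_Re_le_cmod) simp
    also have "\<dots> = 2 * norm A * norm (f x)" by (simp only: U_def norm_mult norm_cis mult.assoc mult_1_right mult_1_left)
    finally show "norm (2 * Re (whittaker_wave A \<alpha> \<beta> (of_real x)) - log_wave \<beta> A x) \<le> 2 * norm A * norm (f x)" .
  qed
qed

text \<open>For real \<open>\<kappa>\<close> and purely imaginary second index the two terms of the connection formula are complex
  conjugates of each other.\<close>

lemma whittaker_W_real:
  fixes \<kappa> \<beta> x :: real
  assumes \<beta>: "\<beta> \<noteq> 0" and x: "x > 0"
  shows "whittaker_W (of_real \<kappa>) (\<i> * of_real \<beta>) x = of_real (sqrt x *
    (2 * Re (whittaker_wave (Gamma (- (2 * \<i> * of_real \<beta>)) / Gamma (1/2 - \<i> * of_real \<beta> - of_real \<kappa>))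
      (1/2 + \<i> * of_real \<beta> - of_real \<kappa>) \<beta> (of_real x))))"
proof -
  define b where "b = \<i> * complex_of_real \<beta>"
  have cb: "cnj b = - b" by (simp add: b_def)
  have b: "2 * b \<notin> \<int>"
  proof
    assume "2 * b \<in> \<int>"
    then have "Im (2 * b) = 0" by (metis Ints_cases complex_Im_of_int)
    then show False using \<beta> by (simp add: b_def)
  qed
  define g where "g = Gamma (- (2 * b)) / Gamma (1/2 - b - of_real \<kappa>)"
  define \<Phi> where "\<Phi> = kummer_M (1/2 + b - of_real \<kappa>) (1 + 2 * b) (of_real x)"
  define e where "e = exp (- complex_of_real x / 2) * exp (b * of_real (ln x))"
  have pw: "complex_of_real x powr (1/2 + c) = of_real (sqrt x) * exp (c * of_real (ln x))" for c
  proof -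
    have "complex_of_real x powr (1/2 + c) = exp ((1/2) * of_real (ln x)) * exp (c * of_real (ln x))"
      using x by (simp add: powr_def Ln_of_real distrib_right exp_add)
    also have "exp ((1/2) * complex_of_real (ln x)) = of_real (exp (ln x / 2))"
      by (simp flip: exp_of_real)
    also have "exp (ln x / 2) = sqrt x"
      using x by (simp add: powr_half_sqrt[symmetric] powr_def)
    finally show ?thesis .
  qed
  have M1: "whittaker_M (of_real \<kappa>) b x = of_real (sqrt x) * (e * \<Phi>)"
    unfolding whittaker_M_def pw e_def \<Phi>_def by (simp only: mult_ac)
  have reb: "Re (1 + 2 * b) \<ge> 1" by (simp add: b_def)
  have "cnj e = exp (- complex_of_real x / 2) * exp (- b * of_real (ln x))"
    unfolding e_def by (simp add: exp_cnj cb)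
  moreover have "cnj \<Phi> = kummer_M (1/2 + - b - of_real \<kappa>) (1 + 2 * - b) (of_real x)"
    unfolding \<Phi>_def kummer_M_cnj[OF reb, symmetric] by (simp add: cb)
  ultimately have M2: "whittaker_M (of_real \<kappa>) (- b) x = of_real (sqrt x) * cnj (e * \<Phi>)"
    unfolding whittaker_M_def pw by simp
  have g: "Gamma (2 * b) / Gamma (1/2 + b - of_real \<kappa>) = cnj g"
    unfolding g_def by (simp add: cnj_Gamma cb)
  have "whittaker_W (of_real \<kappa>) b x = g * (of_real (sqrt x) * (e * \<Phi>)) + cnj g * (of_real (sqrt x) * cnj (e * \<Phi>))"
    using b unfolding whittaker_W_def whittaker_W_generic_def M1 M2 g by (simp add: g_def)
  also have "\<dots> = of_real (sqrt x) * (g * (e * \<Phi>) + cnj (g * (e * \<Phi>)))" by (simp add: algebra_simps)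
  also have "\<dots> = of_real (sqrt x * (2 * Re (g * (e * \<Phi>))))"
    unfolding complex_add_cnj of_real_mult by simp
  also have "g * (e * \<Phi>) = whittaker_wave g (1/2 + b - of_real \<kappa>) \<beta> (of_real x)"
  proof -
    have "e = exp (- complex_of_real x / 2 + \<i> * of_real \<beta> * Ln (of_real x))"
      unfolding e_def exp_add using x by (simp add: b_def Ln_of_real)
    then show ?thesis by (simp add: whittaker_wave_def \<Phi>_def b_def mult_ac)
  qed
  finally show ?thesis by (simp add: g_def b_def mult.assoc)
qed

lemma whittaker_wave_scale: "whittaker_wave (of_real c * A) \<alpha> \<beta> x = of_real c * whittaker_wave A \<alpha> \<beta> x"
  by (simp add: whittaker_wave_def mult_ac)

lemma Gamma_norm_product:
  assumes "x > 0"
  shows "(Gamma (1 + z) * Gamma (1 + cnj z) * of_real x) powr (1/2)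
    = complex_of_real (norm (Gamma (1 + z)) * sqrt x)"
proof -
  have "Gamma (1 + z) * Gamma (1 + cnj z) = complex_of_real ((norm (Gamma (1 + z)))\<^sup>2)"
    using complex_norm_square[of "Gamma (1 + z)"] by (simp add: cnj_Gamma)
  then have "(Gamma (1 + z) * Gamma (1 + cnj z) * of_real x) powr (1/2)
      = complex_of_real ((norm (Gamma (1 + z)))\<^sup>2 * x) powr (of_real (1/2))" by simp
  also have "\<dots> = of_real (((norm (Gamma (1 + z)))\<^sup>2 * x) powr (1/2))"
    using assms by (intro powr_of_real) auto
  also have "((norm (Gamma (1 + z)))\<^sup>2 * x) powr (1/2) = norm (Gamma (1 + z)) * sqrt x"
    using assms by (simp add: powr_half_sqrt real_sqrt_mult)
  finally show ?thesis .
qed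

lemma norm_product_powr:
  "(z * cnj z) powr (1/4) = complex_of_real (sqrt (norm z))"
  "(z * cnj z) powr (3/4) = complex_of_real (norm z * sqrt (norm z))"
proof -
  have *: "(z * cnj z) powr (of_real t) = complex_of_real (norm z powr (2 * t))" for t
  proof -
    have "(z * cnj z) powr (of_real t) = complex_of_real ((norm z)\<^sup>2) powr (of_real t)"
      by (metis complex_norm_square of_real_power)
    also have "\<dots> = of_real (((norm z)\<^sup>2) powr t)" by (intro powr_of_real) auto
    also have "((norm z)\<^sup>2) powr t = norm z powr (2 * t)"
    proof (cases "norm z = 0")
      case False
      then have "(norm z)\<^sup>2 = norm z powr 2" by (simp add: powr_numeral)
      then show ?thesis by (simp only: powr_powr)
    qed simp
    finally show ?thesis .
  qed
  show "(z * cnj z) powr (1/4) = complex_of_real (sqrt (norm z))"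
    using *[of "1/4"] by (simp add: powr_half_sqrt)
  have "norm z powr (3/2) = norm z * sqrt (norm z)"
    using powr_add[of "norm z" 1 "1/2"] by (simp add: powr_half_sqrt)
  then show "(z * cnj z) powr (3/4) = complex_of_real (norm z * sqrt (norm z))"
    using *[of "3/4"] by simp
qed

lemma whittaker_P_wave:
  assumes z: "z \<notin> \<real>" and x: "x > 0"
  shows "whittaker_P 1 z (cnj z) x = of_real (wave_P z x)"
proof -
  have \<beta>: "Im z \<noteq> 0" using z by (auto simp: complex_is_Real_iff)
  have k: "(z + cnj z + 1) / 2 = complex_of_real (Re z + 1/2)" by (simp add: complex_eq_iff)
  have b: "(z - cnj z) / 2 = \<i> * complex_of_real (Im z)" by (simp add: complex_eq_iff)
  have e1: "1/2 - \<i> * complex_of_real (Im z) - of_real (Re z + 1/2) = - z" by (simp add: complex_eq_iff)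
  have e2: "1/2 + \<i> * complex_of_real (Im z) - of_real (Re z + 1/2) = - cnj z" by (simp add: complex_eq_iff)
  have "whittaker_P 1 z (cnj z) x = of_real (sqrt (norm z)) / of_real (norm (Gamma (1 + z)) * sqrt x)
     * of_real (sqrt x * (2 * Re (whittaker_wave (Gamma (- (2 * \<i> * of_real (Im z))) / Gamma (- z)) (- cnj z) (Im z) (of_real x))))"
    unfolding whittaker_P_def mult_1_left k b whittaker_W_real[OF \<beta> x] e1 e2 norm_product_powr Gamma_norm_product[OF x] ..
  also have "\<dots> = of_real (2 * Re (of_real (sqrt (norm z) / norm (Gamma (1 + z))) * whittaker_wave (Gamma (- (2 * \<i> * of_real (Im z))) / Gamma (- z)) (- cnj z) (Im z) (of_real x)))"
    using x by simp
  finally show ?thesis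
    unfolding whittaker_wave_scale[symmetric] wave_P_def whittaker_amplitude_def .
qed

text \<open>The lower first index changes \<open>\<Gamma>(- z)\<close> into \<open>\<Gamma>(1 - z) = - z \<Gamma>(- z)\<close>; together with the additional
  factor \<open>|z|\<close>, the square root of \<open>z z'\<close>, this produces the phase.\<close>

lemma whittaker_Q_wave:
  assumes z: "z \<notin> \<real>" and x: "x > 0"
  shows "whittaker_Q 1 z (cnj z) x = of_real (wave_Q z x)"
proof -
  have \<beta>: "Im z \<noteq> 0" using z by (auto simp: complex_is_Real_iff)
  have z0: "z \<noteq> 0" using z by auto
  have k: "(z + cnj z - 1) / 2 = complex_of_real (Re z - 1/2)" by (simp add: complex_eq_iff)
  have b: "(z - cnj z) / 2 = \<i> * complex_of_real (Im z)" by (simp add: complex_eq_iff)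
  have e1: "1/2 - \<i> * complex_of_real (Im z) - of_real (Re z - 1/2) = - z + 1" by (simp add: complex_eq_iff)
  have e2: "1/2 + \<i> * complex_of_real (Im z) - of_real (Re z - 1/2) = 1 - cnj z" by (simp add: complex_eq_iff)
  have "- z \<notin> \<int>\<^sub>\<le>\<^sub>0"
  proof
    assume "- z \<in> \<int>\<^sub>\<le>\<^sub>0"
    then obtain n where "- z = of_int n" by (auto simp: nonpos_Ints_def)
    then have "Im (- z) = 0" by simp
    then show False using \<beta> by simp
  qed
  then have G: "Gamma (- z + 1) = - z * Gamma (- z)" by (rule Gamma_plus1)
  have "whittaker_Q 1 z (cnj z) x = of_real (norm z * sqrt (norm z)) / of_real (norm (Gamma (1 + z)) * sqrt x)
     * of_real (sqrt x * (2 * Re (whittaker_wave (Gamma (- (2 * \<i> * of_real (Im z))) / Gamma (- z + 1)) (1 - cnj z) (Im z) (of_real x))))"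
    unfolding whittaker_Q_def mult_1_left k b whittaker_W_real[OF \<beta> x] e1 e2 norm_product_powr Gamma_norm_product[OF x] ..
  also have "\<dots> = of_real (2 * Re (of_real (norm z * sqrt (norm z) / norm (Gamma (1 + z))) * whittaker_wave (Gamma (- (2 * \<i> * of_real (Im z))) / Gamma (- z + 1)) (1 - cnj z) (Im z) (of_real x)))"
    using x by simp
  also have "of_real (norm z * sqrt (norm z) / norm (Gamma (1 + z))) * whittaker_wave (Gamma (- (2 * \<i> * of_real (Im z))) / Gamma (- z + 1)) (1 - cnj z) (Im z) (of_real x)
     = whittaker_wave (whittaker_phase z * whittaker_amplitude z) (1 - cnj z) (Im z) (of_real x)"
  proof -
    have ph: "whittaker_phase z = complex_of_real (norm z) / - z"
    proof -
      have "complex_of_real (norm z) * of_real (norm z) = z * cnj z"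
        using complex_norm_square[of z] by (simp only: power2_eq_square of_real_mult)
      then show ?thesis using z0 by (simp add: whittaker_phase_altdef field_simps)
    qed
    have "whittaker_phase z * whittaker_amplitude z =
      of_real (norm z * sqrt (norm z) / norm (Gamma (1 + z))) * (Gamma (- (2 * \<i> * of_real (Im z))) / Gamma (- z + 1))"
      unfolding G whittaker_amplitude_def ph by (simp add: mult_ac)
    then show ?thesis by (simp only: whittaker_wave_scale)
  qed
  finally show ?thesis unfolding wave_Q_def .
qed

text \<open>For \<open>z' = cnj z\<close> the functions with the sign \<open>-\<close> are thus those with the sign \<open>+\<close> for the
  parameter \<open>- cnj z\<close>.\<close>

lemma whittaker_P_flip: "whittaker_P (-1) z z' x = whittaker_P 1 (- z') (- z) x"
  and whittaker_Q_flip: "whittaker_Q (-1) z z' x = whittaker_Q 1 (- z') (- z) x"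
  by (simp_all add: whittaker_P_def whittaker_Q_def mult_ac algebra_simps)


section \<open>The amplitudes on the two half-lines\<close>

text \<open>The last equation is the reflection formula in the symmetric form for the pair \<open>u\<close>, \<open>- u\<close>.\<close>

lemma Gamma_facts_nonreal:
  fixes u :: complex
  assumes u: "u \<notin> \<real>"
  shows "u \<noteq> 0" "Gamma u \<noteq> 0" "Gamma (1 + u) = u * Gamma u" "sin (of_real pi * u) \<noteq> 0"
    "Gamma u * Gamma (- u) * (u * sin (of_real pi * u)) = - of_real pi"
proof -
  have int: "v \<notin> \<int>" if "v \<notin> \<real>" for v :: complex
    using that by (auto elim!: Ints_cases)
  have np: "v \<notin> \<int>\<^sub>\<le>\<^sub>0" if "v \<notin> \<real>" for v :: complex
    using int[OF that] by (auto simp: nonpos_Ints_def)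
  have mu: "- u \<notin> \<real>" using u Reals_minus[of "- u"] by auto
  show u0: "u \<noteq> 0" using u by auto
  show "Gamma u \<noteq> 0" using np[OF u] by (simp add: Gamma_eq_zero_iff)
  show "Gamma (1 + u) = u * Gamma u" using Gamma_plus1[OF np[OF u]] by (simp add: add.commute)
  show s: "sin (of_real pi * u) \<noteq> 0"
    using u by (auto simp: sin_eq_0 complex_is_Real_iff)
  have "Gamma u * Gamma (1 - u) = of_real pi / sin (of_real pi * u)"
    by (rule Gamma_reflection_complex)
  moreover have "Gamma (1 - u) = - u * Gamma (- u)"
    using Gamma_plus1[OF np[OF mu]] by (simp add: add.commute)
  ultimately have "- (Gamma u * Gamma (- u) * (u * sin (of_real pi * u))) = of_real pi"
    using s by (simp add: field_simps)
  then show "Gamma u * Gamma (- u) * (u * sin (of_real pi * u)) = - of_real pi"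
    by (simp only: neg_eq_iff_add_eq_0 eq_neg_iff_add_eq_0 add.commute)
qed

lemma norm_Gamma_imaginary:
  fixes \<beta> :: real
  assumes \<beta>: "\<beta> \<noteq> 0"
  shows "(norm (Gamma (- (2 * \<i> * complex_of_real \<beta>))))\<^sup>2 * (2 * \<beta> * sinh (2 * pi * \<beta>)) = pi"
proof -
  define u where "u = 2 * \<i> * complex_of_real \<beta>"
  have u: "u \<notin> \<real>" using \<beta> by (simp add: u_def complex_is_Real_iff)
  have c: "cnj u = - u" by (simp add: u_def)
  have "sin (of_real pi * u) = \<i> * of_real (sinh (2 * pi * \<beta>))"
    by (simp add: u_def complex_eq_iff Re_sin Im_sin sinh_field_def exp_minus field_simps)
  then have s: "u * sin (of_real pi * u) = - of_real (2 * \<beta> * sinh (2 * pi * \<beta>))"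
    by (simp add: u_def mult_ac)
  have "complex_of_real ((norm (Gamma (- u)))\<^sup>2) = Gamma (- u) * Gamma u"
    using complex_norm_square[of "Gamma (- u)"] by (simp add: cnj_Gamma c)
  then have "complex_of_real ((norm (Gamma (- u)))\<^sup>2 * (2 * \<beta> * sinh (2 * pi * \<beta>))) = of_real pi"
    using Gamma_facts_nonreal(5)[OF u] unfolding s by (simp add: mult_ac)
  then show ?thesis unfolding u_def of_real_eq_iff .
qed

text \<open>With \<open>h = sinh (\<pi> Im z)\<close> and \<open>s = sin (\<pi> Re z)\<close> both sides equal \<open>4 h\<^sup>2 (1 + h\<^sup>2)\<close>; the terms
  with \<open>s\<close> cancel.\<close>

lemma sin_connection:
  fixes z :: complex
  defines "S \<equiv> sin (of_real pi * z)"
  shows "2 * ((norm S)\<^sup>2 * cosh (2 * pi * Im z) - Re (S\<^sup>2)) = (sinh (2 * pi * Im z))\<^sup>2"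
proof -
  define s c h k where "s = sin (pi * Re z)" and "c = cos (pi * Re z)"
    and "h = sinh (pi * Im z)" and "k = cosh (pi * Im z)"
  have 1: "c\<^sup>2 = 1 - s\<^sup>2" and 2: "k\<^sup>2 = 1 + h\<^sup>2"
    by (simp_all add: c_def s_def k_def h_def cos_squared_eq cosh_square_eq)
  have S: "Re S = s * k" "Im S = c * h"
    by (simp_all add: S_def Re_sin Im_sin s_def c_def k_def h_def cosh_field_def sinh_field_def)
  have n: "(norm S)\<^sup>2 = s\<^sup>2 * k\<^sup>2 + c\<^sup>2 * h\<^sup>2" by (simp add: cmod_power2 S power_mult_distrib)
  have r: "Re (S\<^sup>2) = s\<^sup>2 * k\<^sup>2 - c\<^sup>2 * h\<^sup>2" by (simp add: power2_eq_square S)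
  have ch: "cosh (2 * pi * Im z) = k\<^sup>2 + h\<^sup>2"
    using cosh_double[of "pi * Im z"] by (simp add: k_def h_def mult_ac)
  have sh: "(sinh (2 * pi * Im z))\<^sup>2 = 4 * h\<^sup>2 * k\<^sup>2"
    using sinh_double[of "pi * Im z"] by (simp add: k_def h_def mult_ac power_mult_distrib)
  show ?thesis unfolding n r ch sh 1 2 by (simp add: algebra_simps)
qed

text \<open>The amplitude at the left of 0 of the function that equals \<open>Q\<^sub>-(- x)\<close> for \<open>x < 0\<close>.\<close>

definition left_amplitude :: "complex \<Rightarrow> complex" where
  "left_amplitude z = z / of_real (norm z) * whittaker_amplitude (- cnj z)"

lemma phase_left_amplitude:
  assumes "z \<notin> \<real>"
  shows "whittaker_phase z * left_amplitude z = - whittaker_amplitude (- cnj z)"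
    and "left_amplitude z = whittaker_phase (- cnj z) * whittaker_amplitude (- cnj z)"
proof -
  have "z \<noteq> 0" using assms by auto
  moreover have "z * cnj z = complex_of_real (norm z) * of_real (norm z)"
    using complex_norm_square[of z] by (simp only: power2_eq_square of_real_mult)
  ultimately have "whittaker_phase z * (z / of_real (norm z)) = - 1"
    by (simp add: whittaker_phase_altdef field_simps)
  then show "whittaker_phase z * left_amplitude z = - whittaker_amplitude (- cnj z)"
    unfolding left_amplitude_def mult.assoc[symmetric] by simp
  show "left_amplitude z = whittaker_phase (- cnj z) * whittaker_amplitude (- cnj z)"
    by (simp add: left_amplitude_def whittaker_phase_altdef)
qed

context
  fixes z :: complex
  assumes z: "z \<notin> \<real>"
begin

private definition "S = sin (of_real pi * z)"
private definition "G = norm (Gamma (- (2 * \<i> * complex_of_real (Im z))))"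
private definition "g1 = norm (Gamma z)"
private definition "g2 = norm (Gamma (- z))"

private lemma mz: "- z \<notin> \<real>" using z Reals_minus[of "- z"] by auto
private lemma cz: "cnj z \<notin> \<real>" using z by (simp add: complex_is_Real_iff)

private lemma pos: "norm z > 0" "g1 > 0" "g2 > 0" "norm S > 0"
  using Gamma_facts_nonreal[OF z] Gamma_facts_nonreal[OF mz] by (simp_all add: g1_def g2_def S_def)

private lemma gg: "g1 * g2 * norm z * norm S = pi"
  using arg_cong[OF Gamma_facts_nonreal(5)[OF z], of norm] by (simp add: norm_mult g1_def g2_def S_def)

private lemma norm_cnj_Gamma: "norm (Gamma (cnj u)) = norm (Gamma u)" for u :: complex
  by (metis cnj_Gamma complex_mod_cnj)

private lemma abs_Gamma_1: "norm (Gamma (1 + z)) = norm z * g1" "norm (Gamma (1 + - cnj z)) = norm z * g2"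
proof -
  show "norm (Gamma (1 + z)) = norm z * g1"
    unfolding Gamma_facts_nonreal(3)[OF z] by (simp add: norm_mult g1_def)
  have "norm (Gamma (1 + - cnj z)) = norm (Gamma (cnj (1 + - z)))" by simp
  also have "\<dots> = norm (Gamma (1 + - z))" by (rule norm_cnj_Gamma)
  finally show "norm (Gamma (1 + - cnj z)) = norm z * g2"
    unfolding Gamma_facts_nonreal(3)[OF mz] by (simp add: norm_mult g2_def)
qed

private lemma norm_amplitude: "norm (whittaker_amplitude z) = sqrt (norm z) / (norm z * g1) * (G / g2)"
  "norm (whittaker_amplitude (- cnj z)) = sqrt (norm z) / (norm z * g2) * (G / g1)"
proof -
  show "norm (whittaker_amplitude z) = sqrt (norm z) / (norm z * g1) * (G / g2)"
    unfolding whittaker_amplitude_def norm_mult norm_divide abs_Gamma_1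
    using pos by (simp add: G_def g2_def norm_divide norm_mult)
  have "norm (Gamma (- (- cnj z))) = g1" by (simp add: norm_cnj_Gamma g1_def)
  then show "norm (whittaker_amplitude (- cnj z)) = sqrt (norm z) / (norm z * g2) * (G / g1)"
    unfolding whittaker_amplitude_def norm_mult norm_divide abs_Gamma_1
    using pos by (simp add: G_def norm_divide norm_mult)
qed

lemma left_amplitude_norm: "norm (left_amplitude z) = norm (whittaker_amplitude z)"
  using pos unfolding left_amplitude_def norm_mult norm_amplitude by (simp add: norm_divide mult_ac)

private lemma norm_amplitude_sq: "(norm (whittaker_amplitude z))\<^sup>2 = norm z * G\<^sup>2 * (norm S)\<^sup>2 / pi\<^sup>2"
proof -
  have "(norm (whittaker_amplitude z))\<^sup>2 = norm z * G\<^sup>2 / (norm z * g1 * g2)\<^sup>2"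
    unfolding norm_amplitude using pos by (simp add: power_mult_distrib power_divide)
  also have "\<dots> = norm z * G\<^sup>2 * (norm S)\<^sup>2 / (g1 * g2 * norm z * norm S)\<^sup>2"
    using pos by (simp add: power_mult_distrib)
  finally show ?thesis unfolding gg .
qed

private lemma amplitude_product:
  "cnj (whittaker_amplitude z) * left_amplitude z = - of_real (norm z * G\<^sup>2 * norm S / pi\<^sup>2) * cnj S"
proof -
  define \<gamma> where "\<gamma> = Gamma (- (2 * \<i> * complex_of_real (Im z)))"
  define T where "T = sin (of_real pi * cnj z)"
  have T: "cnj S = T"
    unfolding S_def T_def by (simp add: complex_eq_iff Re_sin Im_sin field_simps)
  have r: "1 / (Gamma (- cnj z) * Gamma (cnj z)) = - (cnj z * T) / of_real pi"
    using Gamma_facts_nonreal(5)[OF cz] Gamma_facts_nonreal(2)[OF cz] Gamma_facts_nonreal(2)[of "- cnj z"] cz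
    by (auto simp: T_def field_simps)
  have \<gamma>: "cnj \<gamma> * \<gamma> = of_real (G\<^sup>2)"
    using complex_norm_square[of \<gamma>] by (simp add: G_def \<gamma>_def mult.commute)
  have zz: "z * cnj z = complex_of_real (norm z) * of_real (norm z)"
    using complex_norm_square[of z] by (simp only: power2_eq_square of_real_mult)
  have sq: "complex_of_real (sqrt (norm z)) * of_real (sqrt (norm z)) = of_real (norm z)"
    using pos by (simp flip: of_real_mult)
  have "cnj (whittaker_amplitude z) * left_amplitude z =
     of_real (sqrt (norm z)) / of_real (norm z * g1) * (cnj \<gamma> / Gamma (- cnj z)) *
     (z / of_real (norm z) * (of_real (sqrt (norm z)) / of_real (norm z * g2) * (\<gamma> / Gamma (cnj z))))"
    unfolding left_amplitude_def whittaker_amplitude_def abs_Gamma_1 \<gamma>_def by (simp add: cnj_Gamma)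
  also have "\<dots> = (of_real (sqrt (norm z)) * of_real (sqrt (norm z))) * (cnj \<gamma> * \<gamma>) * z
      * (1 / (Gamma (- cnj z) * Gamma (cnj z))) / of_real (norm z * g1 * norm z * norm z * g2)"
    by (simp add: field_simps)
  also have "\<dots> = - of_real (norm z) * of_real (G\<^sup>2) * (z * cnj z) * T / of_real (pi * (norm z * g1 * norm z * norm z * g2))"
    unfolding sq \<gamma> r by simp
  also have "\<dots> = - of_real (norm z * G\<^sup>2 * norm z * norm z / (pi * (norm z * g1 * norm z * norm z * g2))) * T"
    unfolding zz by simp
  also have "norm z * G\<^sup>2 * norm z * norm z / (pi * (norm z * g1 * norm z * norm z * g2)) = norm z * G\<^sup>2 * norm S / (pi * (g1 * g2 * norm z * norm S))"
    using pos by (simp add: field_simps)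
  finally show ?thesis unfolding gg T by (simp add: power2_eq_square)
qed

lemma amplitude_nonzero: "norm (whittaker_amplitude z) \<noteq> 0"
proof -
  have "Im z \<noteq> 0" using z by (simp add: complex_is_Real_iff)
  then have "G \<noteq> 0" using norm_Gamma_imaginary[of "Im z"] by (auto simp: G_def)
  then show ?thesis unfolding norm_amplitude using pos by simp
qed

text \<open>Both the moduli of the amplitudes and their product are given by the reflection formula in terms of
  \<open>S = sin (\<pi> z)\<close> and \<open>|\<Gamma>(2 i \<beta>)|\<^sup>2 = \<pi> / (2 \<beta> sinh (2 \<pi> \<beta>))\<close>. After this substitution the claim is
  the trigonometric identity above.\<close>

lemma amplitude_connection:
  "4 * pi * Im z * (norm (whittaker_amplitude z) ^ 4 * cosh (2 * pi * Im z)
      - Re ((cnj (whittaker_amplitude z) * left_amplitude z)\<^sup>2))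
    = norm z * (norm (whittaker_amplitude z))\<^sup>2 * sinh (2 * pi * Im z)"
proof -
  define N where "N = norm z * G\<^sup>2 / pi\<^sup>2"
  have "Im z \<noteq> 0" using z by (simp add: complex_is_Real_iff)
  then have G: "G\<^sup>2 * (2 * Im z * sinh (2 * pi * Im z)) = pi"
    using norm_Gamma_imaginary[of "Im z"] by (simp add: G_def)
  have A2: "(norm (whittaker_amplitude z))\<^sup>2 = N * (norm S)\<^sup>2"
    unfolding norm_amplitude_sq N_def by simp
  have A4: "norm (whittaker_amplitude z) ^ 4 = N\<^sup>2 * (norm S)\<^sup>2 * (norm S)\<^sup>2"
    using power_mult[of "norm (whittaker_amplitude z)" 2 2] unfolding A2
    by (simp add: power_mult_distrib power2_eq_square mult_ac)
  have "cnj (whittaker_amplitude z) * left_amplitude z = - (of_real (N * norm S) * cnj S)"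
    unfolding amplitude_product N_def by simp
  then have "(cnj (whittaker_amplitude z) * left_amplitude z)\<^sup>2 = of_real (N\<^sup>2 * (norm S)\<^sup>2) * cnj (S\<^sup>2)"
    by (simp only: power2_minus power_mult_distrib of_real_power of_real_mult complex_cnj_power)
  then have "Re ((cnj (whittaker_amplitude z) * left_amplitude z)\<^sup>2) = Re (of_real (N\<^sup>2 * (norm S)\<^sup>2) * cnj (S\<^sup>2))"
    by (rule arg_cong)
  also have "\<dots> = N\<^sup>2 * (norm S)\<^sup>2 * Re (S\<^sup>2)"
    unfolding times_complex.sel Re_complex_of_real Im_complex_of_real complex_cnj by (simp del: complex_cnj_power)
  finally have w: "Re ((cnj (whittaker_amplitude z) * left_amplitude z)\<^sup>2) = N\<^sup>2 * (norm S)\<^sup>2 * Re (S\<^sup>2)" .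
  have "4 * pi * Im z * (norm (whittaker_amplitude z) ^ 4 * cosh (2 * pi * Im z)
      - Re ((cnj (whittaker_amplitude z) * left_amplitude z)\<^sup>2))
    = 2 * pi * Im z * N\<^sup>2 * (norm S)\<^sup>2 * (2 * ((norm S)\<^sup>2 * cosh (2 * pi * Im z) - Re (S\<^sup>2)))"
    unfolding A4 w by (simp add: algebra_simps)
  also have "\<dots> = norm z * (N * (norm S)\<^sup>2) * sinh (2 * pi * Im z) * (G\<^sup>2 * (2 * Im z * sinh (2 * pi * Im z))) / pi"
    unfolding S_def sin_connection N_def by (simp add: power2_eq_square mult_ac)
  finally show ?thesis unfolding G A2 by simp
qed

end


section \<open>First and second moments of a determinantal process\<close>

lemma rc_borel_iff:
  "D \<in> rc_borel \<longleftrightarrow> D \<in> sets borel \<and> (\<exists>c>0. \<exists>b. \<forall>x\<in>D. c \<le> \<bar>x\<bar> \<and> \<bar>x\<bar> \<le> b)"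
proof
  assume "D \<in> rc_borel"
  then obtain C where C: "D \<in> sets borel" "compact C" "C \<subseteq> Rstar" "D \<subseteq> C"
    by (auto simp: rc_borel_def)
  have "closed C" "0 \<notin> C" using C by (auto intro: compact_imp_closed)
  then have "open (- C)" "0 \<in> - C" by auto
  then obtain c where c: "c > 0" "ball 0 c \<subseteq> - C" by (metis openE)
  obtain b where b: "\<forall>x\<in>C. norm x \<le> b" using compact_imp_bounded[OF C(2)] by (auto simp: bounded_iff)
  have "\<forall>x\<in>D. c \<le> \<bar>x\<bar> \<and> \<bar>x\<bar> \<le> b"
  proof
    fix x assume "x \<in> D"
    then have "x \<in> C" using C by auto
    then have "x \<notin> ball 0 c" using c by auto
    then show "c \<le> \<bar>x\<bar> \<and> \<bar>x\<bar> \<le> b" using b \<open>x \<in> C\<close> by auto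
  qed
  then show "D \<in> sets borel \<and> (\<exists>c>0. \<exists>b. \<forall>x\<in>D. c \<le> \<bar>x\<bar> \<and> \<bar>x\<bar> \<le> b)"
    by (intro conjI C(1) exI[of _ c] exI[of _ b] c(1))
next
  assume "D \<in> sets borel \<and> (\<exists>c>0. \<exists>b. \<forall>x\<in>D. c \<le> \<bar>x\<bar> \<and> \<bar>x\<bar> \<le> b)"
  then obtain c b where D: "D \<in> sets borel" "c > 0" "\<forall>x\<in>D. c \<le> \<bar>x\<bar> \<and> \<bar>x\<bar> \<le> b" by auto
  have "compact ({- b..- c} \<union> {c..b})" by (intro compact_Un compact_Icc)
  moreover have "D \<subseteq> {- b..- c} \<union> {c..b}"
  proof
    fix x assume "x \<in> D"
    then have "c \<le> \<bar>x\<bar>" "\<bar>x\<bar> \<le> b" using D(3) by blast+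
    then show "x \<in> {- b..- c} \<union> {c..b}" by (cases "x \<ge> 0") auto
  qed
  moreover have "{- b..- c} \<union> {c..b} \<subseteq> Rstar" using D(2) by auto
  ultimately show "D \<in> rc_borel" using D(1) by (auto simp: rc_borel_def)
qed

lemma rc_borel_Int: "D \<in> rc_borel \<Longrightarrow> A \<in> sets borel \<Longrightarrow> D \<inter> A \<in> rc_borel"
  unfolding rc_borel_def by (auto intro!: sets.Int)

lemma rc_borel_sets[measurable_dest]: "D \<in> rc_borel \<Longrightarrow> D \<in> sets borel"
  by (simp add: rc_borel_iff)

lemma space_conf_space: "space conf_space = Conf"
  unfolding conf_space_def by (rule space_measure_of) auto

lemma card_measurable_conf:
  assumes "D \<in> rc_borel"
  shows "(\<lambda>X. card (X \<inter> D)) \<in> conf_space \<rightarrow>\<^sub>M count_space UNIV"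
proof (rule measurableI)
  fix A :: "nat set"
  have "(\<lambda>X. card (X \<inter> D)) -` A \<inter> Conf \<in> sets conf_space"
    unfolding conf_space_def using assms by (subst sets_measure_of) auto
  then show "(\<lambda>X. card (X \<inter> D)) -` A \<inter> space conf_space \<in> sets conf_space"
    by (simp add: space_conf_space)
qed auto

lemma Conf_finite: "X \<in> Conf \<Longrightarrow> D \<in> rc_borel \<Longrightarrow> finite (X \<inter> D)"
proof -
  assume "X \<in> Conf" "D \<in> rc_borel"
  then obtain C where "finite (X \<inter> C)" "D \<subseteq> C" unfolding Conf_def rc_borel_def by blast
  then show ?thesis by (meson Int_mono finite_subset order_refl)
qed

lemma determinantal_intensity:
  assumes det_P: "determinantal P K" and D: "D \<in> rc_borel"
    and K_diag: "\<And>x. x \<noteq> 0 \<Longrightarrow> K x x = of_real (r x)"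
    and [measurable]: "r \<in> borel_measurable borel"
  shows "integrable P (\<lambda>X. real (card (X \<inter> D)))"
    and "(\<integral>X. real (card (X \<inter> D)) \<partial>P) = (\<integral>x. indicator D x * r x \<partial>lborel)"
proof -
  interpret ps: product_sigma_finite "\<lambda>_::nat. lborel :: real measure" by standard
  have [measurable]: "D \<in> sets borel" using D by (rule rc_borel_sets)
  have D0: "\<And>x. x \<in> D \<Longrightarrow> x \<noteq> 0" using D by (force simp: rc_borel_iff)
  have fam: "(\<forall>i<1::nat. (\<lambda>_. D) i \<in> rc_borel) \<and> disjoint_family_on (\<lambda>_. D) {..<1::nat}"
    using D by (auto simp: disjoint_family_on_def)
  have lt1: "{..<1::nat} = {0}" by auto
  note * = det_P[unfolded determinantal_def, THEN conjunct2, rule_format, OF le_refl fam, unfolded lt1]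
  show "integrable P (\<lambda>X. real (card (X \<inter> D)))" using *[THEN conjunct1] by simp
  have "complex_of_real (\<integral>X. real (card (X \<inter> D)) \<partial>P) =
    set_lebesgue_integral (\<Pi>\<^sub>M i\<in>{0::nat}. lborel) (\<Pi>\<^sub>E i\<in>{0}. D)
            (\<lambda>x. Determinant.det (mat 1 1 (\<lambda>(i, j). K (x i) (x j))))"
    using *[THEN conjunct2, THEN conjunct2] by simp
  also have "\<dots> = (\<integral>x. complex_of_real (indicator D (x 0) * r (x 0)) \<partial>(\<Pi>\<^sub>M i\<in>{0::nat}. lborel))"
    unfolding set_lebesgue_integral_def
  proof (rule Bochner_Integration.integral_cong[OF refl])
    fix x :: "nat \<Rightarrow> real" assume "x \<in> space (\<Pi>\<^sub>M i\<in>{0::nat}. lborel)"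
    then have "x \<in> (\<Pi>\<^sub>E i\<in>{0}. D) \<longleftrightarrow> x 0 \<in> D" by (auto simp: space_PiM PiE_iff)
    moreover have "Determinant.det (mat 1 1 (\<lambda>(i, j). K (x i) (x j))) = K (x 0) (x 0)"
      by (subst det_single) auto
    ultimately show "indicat_real (\<Pi>\<^sub>E i\<in>{0}. D) x *\<^sub>R Determinant.det (mat 1 1 (\<lambda>(i, j). K (x i) (x j)))
        = complex_of_real (indicator D (x 0) * r (x 0))"
      using K_diag D0 by (auto simp: indicator_def)
  qed
  also have "\<dots> = (\<integral>x. complex_of_real (indicator D x * r x) \<partial>lborel)"
    by (rule ps.product_integral_singleton[of "\<lambda>x. complex_of_real (indicator D x * r x)" 0]) measurable
  also have "\<dots> = complex_of_real (\<integral>x. indicator D x * r x \<partial>lborel)"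
    by (rule integral_complex_of_real)
  finally show "(\<integral>X. real (card (X \<inter> D)) \<partial>P) = (\<integral>x. indicator D x * r x \<partial>lborel)"
    by (simp only: of_real_eq_iff)
qed

text \<open>The expected number of points in a small interval around \<open>x\<close> is the integral of the diagonal of the
  kernel, so the diagonal cannot be negative there.\<close>

lemma determinantal_intensity_nonneg:
  assumes det_P: "determinantal P K" and K_diag: "\<And>x. x \<noteq> 0 \<Longrightarrow> K x x = of_real (r x)"
    and meas: "r \<in> borel_measurable borel" and cont: "continuous_on (- {0}) r" and x: "x \<noteq> 0"
  shows "r x \<ge> 0"
proof (rule ccontr)
  assume "\<not> r x \<ge> 0"
  then have neg: "r x < 0" by simp
  have "isCont r x" using cont x by (simp add: continuous_on_eq_continuous_at open_Compl)
  then have "\<forall>\<^sub>F y in nhds x. r y < r x / 2"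
    using neg by (intro order_tendstoD) (auto simp: continuous_within tendsto_at_iff_tendsto_nhds)
  then obtain d where d: "d > 0" "\<And>y. dist y x < d \<Longrightarrow> r y < r x / 2"
    unfolding eventually_nhds_metric by blast
  define e where "e = min (d / 2) (\<bar>x\<bar> / 2)"
  have e: "e > 0" "e < d" "e < \<bar>x\<bar>" using d(1) x by (auto simp: e_def)
  define D where "D = {x - e..x + e}"
  have bd: "\<bar>x\<bar> - e \<le> \<bar>y\<bar> \<and> \<bar>y\<bar> \<le> \<bar>x\<bar> + e" if "y \<in> D" for y
    using that by (auto simp: D_def)
  have "D \<in> sets borel" by (simp add: D_def)
  moreover have "\<bar>x\<bar> - e > 0" using e by simp
  ultimately have D: "D \<in> rc_borel" unfolding rc_borel_iff using bd by blast
  have "D \<subseteq> - {0}" using bd \<open>\<bar>x\<bar> - e > 0\<close> by force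
  then have "set_integrable lborel {x - e..x + e} r"
    using continuous_on_subset[OF cont] by (intro borel_integrable_atLeastAtMost') (simp add: D_def)
  then have i1: "integrable lborel (\<lambda>y. indicator D y * r y)" by (simp add: set_integrable_def D_def)
  have i2: "integrable lborel (\<lambda>y. indicator D y * (r x / 2))"
    by (intro integrable_mult_left integrable_real_indicator) (auto simp: D_def emeasure_lborel_Icc_eq)
  have "0 \<le> (\<integral>X. real (card (X \<inter> D)) \<partial>P)" by simp
  also have "\<dots> = (\<integral>y. indicator D y * r y \<partial>lborel)"
    by (rule determinantal_intensity(2)[OF det_P D K_diag meas])
  also have "\<dots> \<le> (\<integral>y. indicator D y * (r x / 2) \<partial>lborel)"
  proof (rule integral_mono[OF i1 i2])
    fix y show "indicator D y * r y \<le> indicator D y * (r x / 2)"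
    proof (cases "y \<in> D")
      case True
      then have "\<bar>y - x\<bar> < d" using e unfolding D_def atLeastAtMost_iff by linarith
      then show ?thesis using d(2)[of y] True by (simp add: dist_real_def)
    qed simp
  qed
  also have "\<dots> = measure lborel D * (r x / 2)" by simp
  also have "measure lborel D = 2 * e" using e by (simp add: D_def)
  finally show False using e neg by (simp add: zero_le_mult_iff)
qed

text \<open>What the rigidity argument needs of a determinantal process. The kernel itself is not symmetric: its
  two-point function contains \<open>- k\<^sup>2\<close> for points on the same half-line, which repel each other, and
  \<open>+ k\<^sup>2\<close> for points on opposite half-lines, which attract each other.\<close>

locale signed_kernel_process =
  fixes P :: "real set measure" and K :: "real \<Rightarrow> real \<Rightarrow> complex"
    and k :: "real \<Rightarrow> real \<Rightarrow> real" and r :: "real \<Rightarrow> real" and C :: real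
  assumes det_P: "determinantal P K"
    and K_diag: "\<And>x. x \<noteq> 0 \<Longrightarrow> K x x = of_real (r x)"
    and K_off: "\<And>x y. x \<noteq> 0 \<Longrightarrow> y \<noteq> 0 \<Longrightarrow> x \<noteq> y \<Longrightarrow> K x y * K y x = of_real (sgn x * sgn y * (k x y)\<^sup>2)"
    and k_meas[measurable]: "case_prod k \<in> borel_measurable (borel \<Otimes>\<^sub>M borel)"
    and r_meas[measurable]: "r \<in> borel_measurable borel"
    and r_nonneg: "\<And>x. x \<noteq> 0 \<Longrightarrow> r x \<ge> 0"
    and reproducing: "\<And>x. x \<noteq> 0 \<Longrightarrow> (\<integral>\<^sup>+y. ennreal ((k x y)\<^sup>2) \<partial>lborel) = ennreal (r x)"
    and C_nonneg: "C \<ge> 0"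
    and r_bound: "\<And>x. x \<noteq> 0 \<Longrightarrow> r x \<le> C / x\<^sup>2"
    and k_bound: "\<And>x y. x \<noteq> 0 \<Longrightarrow> y \<noteq> 0 \<Longrightarrow> (k x y)\<^sup>2 \<le> C / x\<^sup>2"
    and k_bound': "\<And>x y. x \<noteq> 0 \<Longrightarrow> y \<noteq> 0 \<Longrightarrow> (k x y)\<^sup>2 \<le> C / (x\<^sup>2 * y\<^sup>2)"
begin

sublocale prob_space P
  using det_P by (simp add: determinantal_def point_process_def)

lemma sets_P: "sets P = sets conf_space"
  using det_P by (simp add: determinantal_def point_process_def)

lemma space_P: "space P = Conf"
  using sets_eq_imp_space_eq[OF sets_P] by (simp add: space_conf_space)

lemma k_measurable'[measurable]:
  "f \<in> borel_measurable N \<Longrightarrow> g \<in> borel_measurable N \<Longrightarrow> (\<lambda>w. k (f w) (g w)) \<in> borel_measurable N"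
  using measurable_compose[OF measurable_Pair k_meas] by simp

definition num :: "real set \<Rightarrow> real set \<Rightarrow> real" where "num D X = real (card (X \<inter> D))"

lemma num_measurable[measurable]: "D \<in> rc_borel \<Longrightarrow> num D \<in> borel_measurable P"
  unfolding num_def
  using measurable_compose[OF card_measurable_conf, of D real borel] measurable_cong_sets[OF sets_P refl]
  by auto

text \<open>The two-point correlation function.\<close>

definition r2 :: "real \<times> real \<Rightarrow> real" where
  "r2 w = r (fst w) * r (snd w) - sgn (fst w) * sgn (snd w) * (k (fst w) (snd w))\<^sup>2"

lemma r2_measurable[measurable]: "r2 \<in> borel_measurable (lborel \<Otimes>\<^sub>M lborel)"
  unfolding r2_def by measurable

lemma r_integrable:
  assumes D: "D \<in> rc_borel"
  shows "integrable lborel (\<lambda>x. indicator D x * r x)"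
proof -
  have [measurable]: "D \<in> sets borel" using D by (rule rc_borel_sets)
  obtain c b where c: "c > 0" and b: "\<forall>x\<in>D. c \<le> \<bar>x\<bar> \<and> \<bar>x\<bar> \<le> b" using D by (auto simp: rc_borel_iff)
  show ?thesis
  proof (rule Bochner_Integration.integrable_bound)
    have "emeasure lborel {- b..b} < \<infinity>" by (simp add: emeasure_lborel_Icc_eq)
    then show "integrable lborel (\<lambda>x. (C / c\<^sup>2) * indicator {- b..b} x)"
      by (intro integrable_mult_right integrable_real_indicator) auto
    show "AE x in lborel. norm (indicator D x * r x) \<le> norm (C / c\<^sup>2 * indicator {- b..b} x)"
    proof (intro AE_I2)
      fix x show "norm (indicator D x * r x) \<le> norm (C / c\<^sup>2 * indicator {- b..b} x)"
      proof (cases "x \<in> D")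
        case True
        then have x: "c \<le> \<bar>x\<bar>" "\<bar>x\<bar> \<le> b" "x \<noteq> 0" using b c by auto
        have "c\<^sup>2 \<le> x\<^sup>2" using x c by (simp add: abs_le_square_iff[symmetric])
        then have "C / x\<^sup>2 \<le> C / c\<^sup>2"
          using C_nonneg c x(3) by (intro divide_left_mono) auto
        then have "r x \<le> C / c\<^sup>2" using r_bound[OF x(3)] by linarith
        moreover have "x \<in> {- b..b}" using x by (simp add: abs_le_iff)
        ultimately show ?thesis using True r_nonneg[OF x(3)] C_nonneg by simp
      qed simp
    qed
  qed measurable
qed

lemma integrable_rc_times:
  fixes f :: "real \<times> real \<Rightarrow> real"
  assumes D: "D \<in> rc_borel" "D' \<in> rc_borel"
    and [measurable]: "f \<in> borel_measurable (lborel \<Otimes>\<^sub>M lborel)"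
    and L: "\<And>x y. x \<in> D \<Longrightarrow> y \<in> D' \<Longrightarrow> \<bar>f (x, y)\<bar> \<le> L"
  shows "integrable (lborel \<Otimes>\<^sub>M lborel) (\<lambda>w. indicator (D \<times> D') w * f w)"
proof -
  have [measurable]: "D \<in> sets borel" "D' \<in> sets borel" using D by (auto intro: rc_borel_sets)
  obtain b where b: "\<forall>x\<in>D. \<bar>x\<bar> \<le> b" using D by (auto simp: rc_borel_iff)
  obtain b' where b': "\<forall>x\<in>D'. \<bar>x\<bar> \<le> b'" using D by (auto simp: rc_borel_iff)
  show ?thesis
  proof (rule Bochner_Integration.integrable_bound)
    have "emeasure (lborel \<Otimes>\<^sub>M lborel) ({- b..b} \<times> {- b'..b'}) < \<infinity>"
      by (subst lborel.emeasure_pair_measure_Times) (auto simp: emeasure_lborel_Icc_eq ennreal_mult_less_top)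
    then show "integrable (lborel \<Otimes>\<^sub>M lborel) (\<lambda>w. L * indicator ({- b..b} \<times> {- b'..b'}) w)"
      by (intro integrable_mult_right integrable_real_indicator) auto
    show "AE w in lborel \<Otimes>\<^sub>M lborel. norm (indicator (D \<times> D') w * f w) \<le> norm (L * indicator ({- b..b} \<times> {- b'..b'}) w)"
    proof (intro AE_I2)
      fix w :: "real \<times> real"
      obtain x y where w: "w = (x, y)" by (cases w)
      show "norm (indicator (D \<times> D') w * f w) \<le> norm (L * indicator ({- b..b} \<times> {- b'..b'}) w)"
      proof (cases "x \<in> D \<and> y \<in> D'")
        case True
        then have "\<bar>x\<bar> \<le> b" "\<bar>y\<bar> \<le> b'" using b b' by blast+
        then have "x \<in> {- b..b}" "y \<in> {- b'..b'}" by (simp_all add: abs_le_iff)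
        moreover have "\<bar>f w\<bar> \<le> \<bar>L\<bar>" using L[of x y] True by (simp add: w)
        ultimately show ?thesis using True by (simp add: w)
      qed (simp add: w)
    qed
  qed measurable
qed

lemma inverse_square_bound:
  assumes "0 < e" "e \<le> \<bar>x\<bar>"
  shows "x \<noteq> 0" "C / x\<^sup>2 \<le> C / e\<^sup>2" "\<bar>r x\<bar> \<le> C / e\<^sup>2"
proof -
  show x: "x \<noteq> 0" using assms by auto
  have "e\<^sup>2 \<le> x\<^sup>2" using assms by (simp add: abs_le_square_iff[symmetric])
  then show "C / x\<^sup>2 \<le> C / e\<^sup>2"
    using C_nonneg assms x by (intro divide_left_mono) auto
  then show "\<bar>r x\<bar> \<le> C / e\<^sup>2" using r_bound[OF x] r_nonneg[OF x] by simp
qed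

lemma k_square_integrable:
  assumes D: "D \<in> rc_borel" "D' \<in> rc_borel"
  shows "integrable (lborel \<Otimes>\<^sub>M lborel) (\<lambda>w. indicator (D \<times> D') w * (k (fst w) (snd w))\<^sup>2)"
proof -
  obtain c where c: "c > 0" "\<forall>x\<in>D. c \<le> \<bar>x\<bar>" using D by (auto simp: rc_borel_iff)
  have nz: "\<forall>y\<in>D'. y \<noteq> 0" using D by (force simp: rc_borel_iff)
  show ?thesis
  proof (rule integrable_rc_times[OF D, of _ "C / c\<^sup>2"])
    show "\<bar>(k (fst (x, y)) (snd (x, y)))\<^sup>2\<bar> \<le> C / c\<^sup>2" if "x \<in> D" "y \<in> D'" for x y
      using k_bound[of x y] inverse_square_bound(1,2)[OF c(1), of x] c(2) nz that by fastforce
  qed measurable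
qed

lemma r_mult_integrable:
  assumes D: "D \<in> rc_borel" "D' \<in> rc_borel"
  shows "integrable (lborel \<Otimes>\<^sub>M lborel) (\<lambda>w. indicator (D \<times> D') w * (r (fst w) * r (snd w)))"
proof -
  obtain c where c: "c > 0" "\<forall>x\<in>D. c \<le> \<bar>x\<bar>" using D by (auto simp: rc_borel_iff)
  obtain c' where c': "c' > 0" "\<forall>x\<in>D'. c' \<le> \<bar>x\<bar>" using D by (auto simp: rc_borel_iff)
  show ?thesis
  proof (rule integrable_rc_times[OF D, of _ "C / c\<^sup>2 * (C / c'\<^sup>2)"])
    show "\<bar>r (fst (x, y)) * r (snd (x, y))\<bar> \<le> C / c\<^sup>2 * (C / c'\<^sup>2)" if "x \<in> D" "y \<in> D'" for x y
      using inverse_square_bound(3)[OF c(1), of x] inverse_square_bound(3)[OF c'(1), of y] c(2) c'(2) that C_nonneg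
      unfolding abs_mult fst_conv snd_conv by (intro mult_mono) auto
  qed measurable
qed

lemma r2_integrable:
  assumes D: "D \<in> rc_borel" "D' \<in> rc_borel"
  shows "integrable (lborel \<Otimes>\<^sub>M lborel) (\<lambda>w. indicator (D \<times> D') w * r2 w)"
proof -
  have [measurable]: "D \<in> sets borel" "D' \<in> sets borel" using D by (auto intro: rc_borel_sets)
  show ?thesis
  proof (rule Bochner_Integration.integrable_bound)
  show "integrable (lborel \<Otimes>\<^sub>M lborel) (\<lambda>w. norm (indicator (D \<times> D') w * (r (fst w) * r (snd w)))
      + norm (indicator (D \<times> D') w * (k (fst w) (snd w))\<^sup>2))"
    by (intro Bochner_Integration.integrable_add integrable_norm r_mult_integrable k_square_integrable D)
  have "\<bar>u - sgn x * sgn y * t\<^sup>2\<bar> \<le> \<bar>u\<bar> + t\<^sup>2" for u x y t :: real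
    by (rule order_trans[OF abs_triangle_ineq4]) (auto simp: abs_mult sgn_if)
  then show "AE w in lborel \<Otimes>\<^sub>M lborel. norm (indicator (D \<times> D') w * r2 w)
      \<le> norm (norm (indicator (D \<times> D') w * (r (fst w) * r (snd w)))
      + norm (indicator (D \<times> D') w * (k (fst w) (snd w))\<^sup>2))"
    unfolding r2_def
    by (intro AE_I2) (auto simp: indicator_def)
  qed measurable
qed

lemma expectation_num:
  assumes D: "D \<in> rc_borel"
  shows "integrable P (num D)" and "expectation (num D) = (\<integral>x. indicator D x * r x \<partial>lborel)"
  using determinantal_intensity[OF det_P D K_diag r_meas] by (simp_all add: num_def[abs_def])

lemma expectation_num_disjoint:
  assumes D: "D \<in> rc_borel" "D' \<in> rc_borel" "D \<inter> D' = {}"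
  shows "integrable P (\<lambda>X. num D X * num D' X)"
    and "expectation (\<lambda>X. num D X * num D' X) = (\<integral>w. indicator (D \<times> D') w * r2 w \<partial>(lborel \<Otimes>\<^sub>M lborel))"
proof -
  interpret ps: product_sigma_finite "\<lambda>_::nat. lborel :: real measure" by standard
  have [measurable]: "D \<in> sets borel" "D' \<in> sets borel" using D by (auto intro: rc_borel_sets)
  have D0: "\<And>x. x \<in> D \<Longrightarrow> x \<noteq> 0" "\<And>x. x \<in> D' \<Longrightarrow> x \<noteq> 0" using D by (force simp: rc_borel_iff)+
  define F where "F i = (if i = (0::nat) then D else D')" for i
  have fam: "(\<forall>i<2::nat. F i \<in> rc_borel) \<and> disjoint_family_on F {..<2}"
    using D by (auto simp: F_def disjoint_family_on_def)
  have lt2: "{..<2::nat} = insert 1 {0}" by auto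
  have le: "(2::nat) \<ge> 1" by simp
  note * = det_P[unfolded determinantal_def, THEN conjunct2, rule_format, OF le fam, unfolded lt2]
  show "integrable P (\<lambda>X. num D X * num D' X)"
    using *[THEN conjunct1] by (simp add: num_def F_def mult.commute)
  define G where "G x = indicat_real (\<Pi>\<^sub>E i\<in>insert 1 {0}. F i) x *\<^sub>R
      Determinant.det (mat 2 2 (\<lambda>(i, j). K (x i) (x j)))" for x
  have G_int: "integrable (\<Pi>\<^sub>M i\<in>insert (1::nat) {0}. lborel) G"
    using *[THEN conjunct2, THEN conjunct1] unfolding set_integrable_def G_def .
  have det2: "Determinant.det (mat 2 2 f) = f (0,0) * f (1,1) - f (0,1) * f (1,0)" for f :: "nat \<times> nat \<Rightarrow> complex"
  proof -
    define A where "A = mat 2 2 f"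
    have A: "A \<in> carrier_mat 2 2" by (simp add: A_def)
    have "Determinant.det (mat_delete A 0 0) = f (1, 1)" "Determinant.det (mat_delete A 0 1) = f (1, 0)"
      using A by (subst det_single; simp add: mat_delete_def A_def)+
    moreover have "{..<2::nat} = {0, 1}" by auto
    ultimately show ?thesis
      using laplace_expansion_row[OF A, of 0] by (simp add: A_def[symmetric] cofactor_def) (simp add: A_def)
  qed
  have G_eq: "G (x(1 := y)) = complex_of_real (indicator (D \<times> D') (x 0, y) * r2 (x 0, y))"
    if "x \<in> space (\<Pi>\<^sub>M i\<in>{0::nat}. lborel)" for x y
  proof -
    have "x(1 := y) \<in> (\<Pi>\<^sub>E i\<in>insert 1 {0}. F i) \<longleftrightarrow> x 0 \<in> D \<and> y \<in> D'"
      using that by (auto simp: space_PiM PiE_iff F_def extensional_def)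
    moreover have "K (x 0) (x 0) * K y y - K (x 0) y * K y (x 0) = complex_of_real (r2 (x 0, y))"
      if "x 0 \<in> D" "y \<in> D'"
    proof -
      have "x 0 \<noteq> 0" "y \<noteq> 0" "x 0 \<noteq> y" using that D D0 by auto
      then show ?thesis by (simp add: K_diag K_off r2_def)
    qed
    ultimately show ?thesis unfolding G_def det2 by (auto simp: indicator_def)
  qed
  have "complex_of_real (expectation (\<lambda>X. num D X * num D' X)) = integral\<^sup>L (\<Pi>\<^sub>M i\<in>insert (1::nat) {0}. lborel) G"
    using *[THEN conjunct2, THEN conjunct2] unfolding set_lebesgue_integral_def G_def
    by (simp add: num_def F_def mult.commute)
  also have "\<dots> = (\<integral>x. (\<integral>y. G (x(1 := y)) \<partial>lborel) \<partial>(\<Pi>\<^sub>M i\<in>{0::nat}. lborel))"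
    by (rule ps.product_integral_insert[OF _ _ G_int]) auto
  also have "\<dots> = (\<integral>x. (\<integral>y. complex_of_real (indicator (D \<times> D') (x 0, y) * r2 (x 0, y)) \<partial>lborel) \<partial>(\<Pi>\<^sub>M i\<in>{0::nat}. lborel))"
    by (intro Bochner_Integration.integral_cong refl G_eq)
  also have "\<dots> = (\<integral>x. (\<integral>y. complex_of_real (indicator (D \<times> D') (x, y) * r2 (x, y)) \<partial>lborel) \<partial>lborel)"
    by (rule ps.product_integral_singleton[of "\<lambda>x. \<integral>y. complex_of_real (indicator (D \<times> D') (x, y) * r2 (x, y)) \<partial>lborel" 0]) measurable
  also have "\<dots> = complex_of_real (\<integral>x. (\<integral>y. indicator (D \<times> D') (x, y) * r2 (x, y) \<partial>lborel) \<partial>lborel)"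
    by (simp only: integral_complex_of_real)
  also have "(\<integral>x. (\<integral>y. indicator (D \<times> D') (x, y) * r2 (x, y) \<partial>lborel) \<partial>lborel)
      = (\<integral>w. indicator (D \<times> D') w * r2 w \<partial>(lborel \<Otimes>\<^sub>M lborel))"
    by (rule lborel_pair.integral_fst'[OF r2_integrable[OF D(1,2)]])
  finally show "expectation (\<lambda>X. num D X * num D' X) = (\<integral>w. indicator (D \<times> D') w * r2 w \<partial>(lborel \<Otimes>\<^sub>M lborel))"
    by (simp only: of_real_eq_iff)
qed

end

definition dyadic_index :: "nat \<Rightarrow> real \<Rightarrow> int" where
  "dyadic_index n x = \<lfloor>2 ^ n * x\<rfloor>"

lemma dyadic_index_measurable[measurable]: "dyadic_index n \<in> borel \<rightarrow>\<^sub>M count_space UNIV"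
  unfolding dyadic_index_def by measurable

lemma dyadic_index_Suc: "dyadic_index n x = dyadic_index (Suc n) x div 2"
proof -
  have "2 ^ n * x = (2 ^ Suc n * x) / real_of_int 2" by simp
  then show ?thesis unfolding dyadic_index_def
    using floor_divide_real_eq_div[of 2 "2 ^ Suc n * x"] by (simp only:)
qed

lemma dyadic_index_mono:
  assumes "dyadic_index m x \<noteq> dyadic_index m y" "m \<le> n"
  shows "dyadic_index n x \<noteq> dyadic_index n y"
  using assms(2,1)
proof (induction n rule: dec_induct)
  case (step n)
  then show ?case using dyadic_index_Suc[of n x] dyadic_index_Suc[of n y] by auto
qed

lemma dyadic_index_separates:
  assumes "x \<noteq> y"
  shows "\<forall>\<^sub>F n in sequentially. dyadic_index n x \<noteq> dyadic_index n y"
proof -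
  obtain m :: nat where m: "1 / \<bar>x - y\<bar> < 2 ^ m"
    using real_arch_pow[of 2 "1 / \<bar>x - y\<bar>"] by auto
  have "dyadic_index m x \<noteq> dyadic_index m y"
  proof
    assume "dyadic_index m x = dyadic_index m y"
    then have "\<bar>2 ^ m * x - 2 ^ m * y\<bar> < 1" unfolding dyadic_index_def by linarith
    then have "2 ^ m * \<bar>x - y\<bar> < 1" by (simp add: abs_mult flip: right_diff_distrib)
    then show False using m assms by (simp add: field_simps)
  qed
  then show ?thesis
    by (intro eventually_mono[OF eventually_ge_at_top[of m]]) (rule dyadic_index_mono)
qed

lemma dyadic_index_bounded:
  assumes "\<bar>x\<bar> \<le> b"
  shows "dyadic_index n x \<in> {- (\<lceil>2 ^ n * b\<rceil> + 1)..\<lceil>2 ^ n * b\<rceil> + 1}"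
proof -
  have "\<bar>2 ^ n * x\<bar> \<le> 2 ^ n * b" using assms by (simp add: abs_mult)
  then show ?thesis unfolding dyadic_index_def by (auto; linarith)
qed

context signed_kernel_process begin

text \<open>The definition of the process gives mixed moments only for disjoint sets. Pairs of points in different
  cells of a partition are counted by such moments.\<close>

lemma expectation_num_off_diagonal:
  fixes n :: nat
  assumes D: "D \<in> rc_borel" "D' \<in> rc_borel"
  defines "Q \<equiv> \<lambda>X. real (card {w \<in> (X \<inter> D) \<times> (X \<inter> D'). dyadic_index n (fst w) \<noteq> dyadic_index n (snd w)})"
  shows "integrable P Q" and "expectation Q =
    (\<integral>w. indicator {w \<in> D \<times> D'. dyadic_index n (fst w) \<noteq> dyadic_index n (snd w)} w * r2 w \<partial>(lborel \<Otimes>\<^sub>M lborel))"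
proof -
  have [measurable]: "D \<in> sets borel" "D' \<in> sets borel" using D by (auto intro: rc_borel_sets)
  obtain b1 b2 where "\<forall>x\<in>D. \<bar>x\<bar> \<le> b1" "\<forall>x\<in>D'. \<bar>x\<bar> \<le> b2" using D by (auto simp: rc_borel_iff)
  then have b: "\<bar>x\<bar> \<le> max b1 b2" if "x \<in> D \<union> D'" for x using that by force
  \<comment> \<open>Both sets are bounded, so finitely many cells cover them.\<close>
  define I where "I = {- (\<lceil>2 ^ n * max b1 b2\<rceil> + 1)..\<lceil>2 ^ n * max b1 b2\<rceil> + 1}"
  have I: "dyadic_index n x \<in> I" if "x \<in> D \<union> D'" for x
    unfolding I_def by (rule dyadic_index_bounded[OF b[OF that]])
  have [simp]: "finite I" by (simp add: I_def)
  define J where "J = {(i, j). i \<in> I \<and> j \<in> I \<and> i \<noteq> j}"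
  have J: "finite J" by (rule finite_subset[of _ "I \<times> I"]) (auto simp: J_def)
  define E F where "E i = D \<inter> dyadic_index n -` {i}" and "F j = D' \<inter> dyadic_index n -` {j}" for i j
  have vm: "dyadic_index n -` {i} \<in> sets borel" for i
    using measurable_sets[OF dyadic_index_measurable, of "{i}" n] by simp
  have EF: "E i \<in> rc_borel" "F i \<in> rc_borel" for i
    unfolding E_def F_def by (intro rc_borel_Int D vm)+
  have dis: "E i \<inter> F j = {}" if "(i, j) \<in> J" for i j using that by (auto simp: E_def F_def J_def)
  have Q_eq: "Q X = (\<Sum>(i, j)\<in>J. num (E i) X * num (F j) X)" if "X \<in> Conf" for X
  proof -
    have fin: "finite (X \<inter> E i)" "finite (X \<inter> F i)" for i using Conf_finite[OF that] EF by auto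
    have "{w \<in> (X \<inter> D) \<times> (X \<inter> D'). dyadic_index n (fst w) \<noteq> dyadic_index n (snd w)}
        = (\<Union>(i, j)\<in>J. (X \<inter> E i) \<times> (X \<inter> F j))"
      using I by (auto simp: J_def E_def F_def)
    also have "card \<dots> = (\<Sum>(i, j)\<in>J. card ((X \<inter> E i) \<times> (X \<inter> F j)))"
    proof (subst card_UN_disjoint[OF J])
      show "\<forall>p\<in>J. finite (case p of (i, j) \<Rightarrow> (X \<inter> E i) \<times> (X \<inter> F j))" using fin by auto
      show "\<forall>p\<in>J. \<forall>p'\<in>J. p \<noteq> p' \<longrightarrow> (case p of (i, j) \<Rightarrow> (X \<inter> E i) \<times> (X \<inter> F j)) \<inter>
          (case p' of (i, j) \<Rightarrow> (X \<inter> E i) \<times> (X \<inter> F j)) = {}"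
        by (auto simp: E_def F_def)
    qed (auto intro: sum.cong)
    finally show ?thesis
      by (simp add: Q_def num_def card_cartesian_product split_def)
  qed
  have int: "integrable P (\<lambda>X. num (E i) X * num (F j) X)" if "(i, j) \<in> J" for i j
    by (rule expectation_num_disjoint(1)[OF EF(1) EF(2) dis[OF that]])
  have int': "integrable P (\<lambda>X. \<Sum>(i, j)\<in>J. num (E i) X * num (F j) X)"
    using int by (intro Bochner_Integration.integrable_sum) auto
  show "integrable P Q"
    by (rule Bochner_Integration.integrable_cong[THEN iffD2, OF refl _ int']) (use Q_eq space_P in auto)
  have "expectation Q = expectation (\<lambda>X. \<Sum>(i, j)\<in>J. num (E i) X * num (F j) X)"
    by (rule Bochner_Integration.integral_cong) (use Q_eq space_P in auto)
  also have "\<dots> = (\<Sum>(i, j)\<in>J. expectation (\<lambda>X. num (E i) X * num (F j) X))"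
    unfolding split_def using int by (intro Bochner_Integration.integral_sum) (auto simp: split_def)
  also have "\<dots> = (\<Sum>(i, j)\<in>J. \<integral>w. indicator (E i \<times> F j) w * r2 w \<partial>(lborel \<Otimes>\<^sub>M lborel))"
    by (intro sum.cong refl) (auto simp: expectation_num_disjoint(2)[OF EF(1) EF(2) dis])
  also have "\<dots> = (\<integral>w. (\<Sum>(i, j)\<in>J. indicator (E i \<times> F j) w * r2 w) \<partial>(lborel \<Otimes>\<^sub>M lborel))"
    unfolding split_def by (intro Bochner_Integration.integral_sum[symmetric] r2_integrable EF)
  also have "\<dots> = (\<integral>w. indicator {w \<in> D \<times> D'. dyadic_index n (fst w) \<noteq> dyadic_index n (snd w)} w * r2 w \<partial>(lborel \<Otimes>\<^sub>M lborel))"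
  proof (intro Bochner_Integration.integral_cong refl)
    fix w :: "real \<times> real"
    have U: "{w \<in> D \<times> D'. dyadic_index n (fst w) \<noteq> dyadic_index n (snd w)} = (\<Union>p\<in>J. E (fst p) \<times> F (snd p))"
      using I by (auto simp: J_def E_def F_def)
    have "indicat_real (\<Union>p\<in>J. E (fst p) \<times> F (snd p)) w = (\<Sum>p\<in>J. indicator (E (fst p) \<times> F (snd p)) w)"
      by (rule indicator_UN_disjoint[OF J]) (auto simp: disjoint_family_on_def E_def F_def)
    then show "(\<Sum>(i, j)\<in>J. indicator (E i \<times> F j) w * r2 w)
        = indicator {w \<in> D \<times> D'. dyadic_index n (fst w) \<noteq> dyadic_index n (snd w)} w * r2 w"
      unfolding U by (simp add: split_def sum_distrib_right)
  qed
  finally show "expectation Q =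
    (\<integral>w. indicator {w \<in> D \<times> D'. dyadic_index n (fst w) \<noteq> dyadic_index n (snd w)} w * r2 w \<partial>(lborel \<Otimes>\<^sub>M lborel))" .
qed

text \<open>As the cells shrink, the pairs of points in different cells exhaust all pairs of distinct points of
  the configuration; the pairs of equal points give the first moment of the intersection.\<close>

lemma expectation_num_mult:
  assumes D: "D \<in> rc_borel" "D' \<in> rc_borel"
  shows "integrable P (\<lambda>X. num D X * num D' X)"
    and "expectation (\<lambda>X. num D X * num D' X) = (\<integral>x. indicator (D \<inter> D') x * r x \<partial>lborel)
      + (\<integral>w. indicator (D \<times> D') w * r2 w \<partial>(lborel \<Otimes>\<^sub>M lborel))"
proof -
  have [measurable]: "D \<in> sets borel" "D' \<in> sets borel" using D by (auto intro: rc_borel_sets)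
  have DD: "D \<inter> D' \<in> rc_borel" using D by (intro rc_borel_Int) auto
  define S where "S n = {w \<in> D \<times> D'. dyadic_index n (fst w) \<noteq> dyadic_index n (snd w)}" for n
  have [measurable]: "S n \<in> sets (lborel \<Otimes>\<^sub>M lborel)" for n
  proof -
    have "S n = (D \<times> D') \<inter> {w \<in> space (lborel \<Otimes>\<^sub>M lborel). dyadic_index n (fst w) \<noteq> dyadic_index n (snd w)}"
      by (auto simp: S_def space_pair_measure)
    also have "\<dots> \<in> sets (lborel \<Otimes>\<^sub>M lborel)" by measurable
    finally show ?thesis .
  qed
  define Q where "Q n X = real (card {w \<in> (X \<inter> D) \<times> (X \<inter> D'). dyadic_index n (fst w) \<noteq> dyadic_index n (snd w)})" for n X
  define u where "u X = num D X * num D' X - num (D \<inter> D') X" for X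
  note Q = expectation_num_off_diagonal[OF D, folded Q_def S_def]
  have fin: "finite (X \<inter> D)" "finite (X \<inter> D')" if "X \<in> Conf" for X
    using Conf_finite[OF that] D by auto
  have mono: "mono (\<lambda>n. Q n X)" if "X \<in> Conf" for X
    unfolding Q_def using fin[OF that]
    by (intro monoI of_nat_mono card_mono) (auto dest: dyadic_index_mono)
  have lim: "(\<lambda>n. Q n X) \<longlonglongrightarrow> u X" if X: "X \<in> Conf" for X
  proof (rule tendsto_eventually)
    have "\<forall>\<^sub>F n in sequentially. \<forall>w\<in>(X \<inter> D) \<times> (X \<inter> D'). fst w \<noteq> snd w \<longrightarrow> dyadic_index n (fst w) \<noteq> dyadic_index n (snd w)"
    proof (rule eventually_ball_finite)
      show "finite ((X \<inter> D) \<times> (X \<inter> D'))" using fin[OF X] by simp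
      show "\<forall>w\<in>(X \<inter> D) \<times> (X \<inter> D'). \<forall>\<^sub>F n in sequentially. fst w \<noteq> snd w \<longrightarrow> dyadic_index n (fst w) \<noteq> dyadic_index n (snd w)"
      proof
        fix w :: "real \<times> real"
        show "\<forall>\<^sub>F n in sequentially. fst w \<noteq> snd w \<longrightarrow> dyadic_index n (fst w) \<noteq> dyadic_index n (snd w)"
          using dyadic_index_separates[of "fst w" "snd w"] by (cases "fst w = snd w") auto
      qed
    qed
    then show "\<forall>\<^sub>F n in sequentially. Q n X = u X"
    proof eventually_elim
      case (elim n)
      have "{w \<in> (X \<inter> D) \<times> (X \<inter> D'). dyadic_index n (fst w) \<noteq> dyadic_index n (snd w)}
          = (X \<inter> D) \<times> (X \<inter> D') - (\<lambda>x. (x, x)) ` (X \<inter> (D \<inter> D'))"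
      proof -
        have "dyadic_index n a \<noteq> dyadic_index n b \<longleftrightarrow> a \<noteq> b" if "a \<in> X \<inter> D" "b \<in> X \<inter> D'" for a b
          using elim that by force
        then show ?thesis by (auto simp: image_iff)
      qed
      also have "card \<dots> = card ((X \<inter> D) \<times> (X \<inter> D')) - card ((\<lambda>x. (x, x)) ` (X \<inter> (D \<inter> D')))"
        by (intro card_Diff_subset finite_imageI finite_subset[OF _ fin(1)[OF X]]) auto
      finally have 1: "card {w \<in> (X \<inter> D) \<times> (X \<inter> D'). dyadic_index n (fst w) \<noteq> dyadic_index n (snd w)}
        = card ((X \<inter> D) \<times> (X \<inter> D')) - card ((\<lambda>x. (x, x)) ` (X \<inter> (D \<inter> D')))" .
      have "card ((\<lambda>x. (x, x)) ` (X \<inter> (D \<inter> D'))) \<le> card ((X \<inter> D) \<times> (X \<inter> D'))"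
        using fin[OF X] by (intro card_mono) auto
      moreover have "card ((\<lambda>x. (x, x)) ` (X \<inter> (D \<inter> D'))) = card (X \<inter> (D \<inter> D'))"
        by (rule card_image) (auto simp: inj_on_def)
      ultimately show ?case unfolding Q_def 1 u_def num_def
        by (simp add: of_nat_diff card_cartesian_product)
    qed
  qed
  have ilim: "(\<lambda>n. expectation (Q n)) \<longlonglongrightarrow> (\<integral>w. indicator (D \<times> D') w * r2 w \<partial>(lborel \<Otimes>\<^sub>M lborel))"
    unfolding Q(2)
  proof (rule integral_dominated_convergence[OF _ _ integrable_norm[OF r2_integrable[OF D]]])
    show "AE w in lborel \<Otimes>\<^sub>M lborel. (\<lambda>n. indicator (S n) w * r2 w) \<longlonglongrightarrow> indicator (D \<times> D') w * r2 w"
    proof -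
      have "AE w in lborel \<Otimes>\<^sub>M lborel. fst w \<noteq> (snd w :: real)"
      proof (rule lborel_pair.AE_pair_measure)
        show "{w \<in> space (lborel \<Otimes>\<^sub>M lborel). fst w \<noteq> (snd w :: real)} \<in> sets (lborel \<Otimes>\<^sub>M lborel)"
          by measurable
        have "AE y in lborel. x \<noteq> y" for x :: real
          using AE_lborel_singleton[of x] by eventually_elim auto
        then show "AE x in lborel. AE y in lborel. fst (x, y) \<noteq> (snd (x, y) :: real)" by simp
      qed
      then show ?thesis
      proof eventually_elim
        case (elim w)
        from dyadic_index_separates[OF this]
        have "\<forall>\<^sub>F n in sequentially. indicator (S n) w * r2 w = indicator (D \<times> D') w * r2 w"
          by eventually_elim (auto simp: S_def indicator_def)
        then show ?case by (rule tendsto_eventually)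
      qed
    qed
    show "AE w in lborel \<Otimes>\<^sub>M lborel. norm (indicator (S n) w * r2 w) \<le> norm (indicator (D \<times> D') w * r2 w)" for n
      by (intro AE_I2) (auto simp: S_def indicator_def)
  qed measurable
  have um: "u \<in> borel_measurable P" unfolding u_def using D DD by measurable
  have AEC: "AE X in P. X \<in> Conf" by (intro AE_I2) (simp add: space_P)
  have u: "integrable P u" "expectation u = (\<integral>w. indicator (D \<times> D') w * r2 w \<partial>(lborel \<Otimes>\<^sub>M lborel))"
    by (rule integral_monotone_convergence_nonneg[OF Q(1) _ _ _ ilim um];
        use AEC mono lim in \<open>auto elim!: eventually_mono simp: Q_def\<close>)+
  have e: "num D X * num D' X = num (D \<inter> D') X + u X" for X by (simp add: u_def)
  show "integrable P (\<lambda>X. num D X * num D' X)"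
    unfolding e by (intro Bochner_Integration.integrable_add expectation_num DD u)
  show "expectation (\<lambda>X. num D X * num D' X) = (\<integral>x. indicator (D \<inter> D') x * r x \<partial>lborel)
      + (\<integral>w. indicator (D \<times> D') w * r2 w \<partial>(lborel \<Otimes>\<^sub>M lborel))"
    unfolding e using expectation_num[OF DD] u by simp
qed

end


section \<open>Covariances of charges of annuli\<close>

lemma inverse_square_tail:
  fixes \<alpha> :: real
  assumes "\<alpha> > 0"
  shows "integrable lborel (\<lambda>x. indicator {x. \<alpha> \<le> \<bar>x\<bar>} x * (1 / x\<^sup>2))"
    and "(\<integral>x. indicator {x. \<alpha> \<le> \<bar>x\<bar>} x * (1 / x\<^sup>2) \<partial>lborel) = 2 / \<alpha>"
proof -
  define f where "f x = indicator {\<alpha>..} x * (1 / x\<^sup>2)" for x :: real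
  have fm[measurable]: "f \<in> borel_measurable borel" unfolding f_def by measurable
  have "(\<integral>\<^sup>+x. ennreal (1 / x\<^sup>2) * indicator {\<alpha>..} x \<partial>lborel) = ennreal (0 - (- 1 / \<alpha>))"
  proof (rule nn_integral_FTC_atLeast)
    show "((\<lambda>x. - 1 / x) has_real_derivative 1 / x\<^sup>2) (at x)" if "\<alpha> \<le> x" for x
      using that assms by (auto intro!: derivative_eq_intros simp: power2_eq_square)
    show "((\<lambda>x::real. - 1 / x) \<longlongrightarrow> 0) at_top"
      by (rule tendsto_divide_0[OF tendsto_const filterlim_at_top_imp_at_infinity[OF filterlim_ident]])
  qed auto
  then have e: "(\<integral>\<^sup>+x. ennreal (f x) \<partial>lborel) = ennreal (1 / \<alpha>)"
    by (simp add: f_def indicator_def if_distrib cong: if_cong)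
       (subst nn_integral_cong; auto simp: indicator_def)
  have nn: "AE x in lborel. 0 \<le> f x" by (auto simp: f_def)
  have f: "integrable lborel f" "integral\<^sup>L lborel f = 1 / \<alpha>"
    by (rule integrableI_nn_integral_finite[OF _ nn e], simp)
      (rule integral_eq_nn_integral[OF _ nn, THEN trans], use e assms in auto)
  have g: "integrable lborel (\<lambda>x. f (- x))" "(\<integral>x. f (- x) \<partial>lborel) = 1 / \<alpha>"
    using lborel_integrable_real_affine[OF f(1), of "-1" 0] lborel_integral_real_affine[of "-1" f 0] f(2) by auto
  have s: "indicator {x. \<alpha> \<le> \<bar>x\<bar>} x * (1 / x\<^sup>2) = f x + f (- x)" for x
    using assms by (auto simp: f_def indicator_def)
  show "integrable lborel (\<lambda>x. indicator {x. \<alpha> \<le> \<bar>x\<bar>} x * (1 / x\<^sup>2))"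
    unfolding s using f(1) g(1) by simp
  show "(\<integral>x. indicator {x. \<alpha> \<le> \<bar>x\<bar>} x * (1 / x\<^sup>2) \<partial>lborel) = 2 / \<alpha>"
    unfolding s using f g by simp
qed

context signed_kernel_process begin

lemma covariance_num:
  assumes D: "D \<in> rc_borel" "D' \<in> rc_borel"
    and s: "\<And>x. x \<in> D \<Longrightarrow> sgn x = s" "\<And>x. x \<in> D' \<Longrightarrow> sgn x = s'"
  shows "expectation (\<lambda>X. num D X * num D' X) - expectation (num D) * expectation (num D')
    = (\<integral>x. indicator (D \<inter> D') x * r x \<partial>lborel)
      - s * s' * (\<integral>w. indicator (D \<times> D') w * (k (fst w) (snd w))\<^sup>2 \<partial>(lborel \<Otimes>\<^sub>M lborel))"
proof -
  have "expectation (num D) * expectation (num D')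
      = (\<integral>x. (\<integral>y. indicator (D \<times> D') (x, y) * (r (fst (x, y)) * r (snd (x, y))) \<partial>lborel) \<partial>lborel)"
  proof -
    have "indicator (D \<times> D') (x, y) * (r (fst (x, y)) * r (snd (x, y)))
        = (indicator D x * r x) * (indicator D' y * r y)" for x y
      by (auto simp: indicator_def)
    then show ?thesis by (simp only: integral_mult_right_zero integral_mult_left_zero expectation_num(2) D)
  qed
  also have "\<dots> = (\<integral>w. indicator (D \<times> D') w * (r (fst w) * r (snd w)) \<partial>(lborel \<Otimes>\<^sub>M lborel))"
    by (rule lborel_pair.integral_fst'[OF r_mult_integrable[OF D]])
  finally have EE: "expectation (num D) * expectation (num D')
    = (\<integral>w. indicator (D \<times> D') w * (r (fst w) * r (snd w)) \<partial>(lborel \<Otimes>\<^sub>M lborel))" .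
  have "(\<integral>w. indicator (D \<times> D') w * r2 w \<partial>(lborel \<Otimes>\<^sub>M lborel))
    = (\<integral>w. indicator (D \<times> D') w * (r (fst w) * r (snd w))
        - s * s' * (indicator (D \<times> D') w * (k (fst w) (snd w))\<^sup>2) \<partial>(lborel \<Otimes>\<^sub>M lborel))"
    by (rule Bochner_Integration.integral_cong) (auto simp: indicator_def r2_def s)
  also have "\<dots> = (\<integral>w. indicator (D \<times> D') w * (r (fst w) * r (snd w)) \<partial>(lborel \<Otimes>\<^sub>M lborel))
      - s * s' * (\<integral>w. indicator (D \<times> D') w * (k (fst w) (snd w))\<^sup>2 \<partial>(lborel \<Otimes>\<^sub>M lborel))"
    using r_mult_integrable[OF D] k_square_integrable[OF D] by simp
  finally show ?thesis unfolding expectation_num_mult(2)[OF D] EE by simp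
qed

definition charge :: "real set \<Rightarrow> real set \<Rightarrow> real" where
  "charge A X = num (A \<inter> {0<..}) X - num (A \<inter> {..<0}) X"

lemma charge_measurable[measurable]:
  assumes "A \<in> rc_borel" shows "charge A \<in> borel_measurable P"
proof -
  have [measurable]: "A \<inter> {0<..} \<in> rc_borel" "A \<inter> {..<0} \<in> rc_borel"
    using assms by (auto intro: rc_borel_Int)
  show ?thesis unfolding charge_def by measurable
qed

lemma charge_integrable:
  assumes "A \<in> rc_borel" "A' \<in> rc_borel"
  shows "integrable P (charge A)" "integrable P (\<lambda>X. charge A X * charge A' X)"
proof -
  have rc: "A \<inter> {0<..} \<in> rc_borel" "A \<inter> {..<0} \<in> rc_borel" "A' \<inter> {0<..} \<in> rc_borel" "A' \<inter> {..<0} \<in> rc_borel"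
    using assms by (auto intro: rc_borel_Int)
  show "integrable P (charge A)" unfolding charge_def[abs_def]
    by (intro Bochner_Integration.integrable_diff expectation_num rc)
  have e: "charge A X * charge A' X = num (A \<inter> {0<..}) X * num (A' \<inter> {0<..}) X
      - num (A \<inter> {0<..}) X * num (A' \<inter> {..<0}) X - num (A \<inter> {..<0}) X * num (A' \<inter> {0<..}) X
      + num (A \<inter> {..<0}) X * num (A' \<inter> {..<0}) X" for X
    by (simp add: charge_def algebra_simps)
  show "integrable P (\<lambda>X. charge A X * charge A' X)" unfolding e
    by (intro Bochner_Integration.integrable_diff Bochner_Integration.integrable_add expectation_num_mult rc)
qed

text \<open>The signs in the charge cancel the signs in the two-point function, so that the covariance is
  that of a process with the symmetric kernel \<open>k\<close>. By the reproducing identity it is the integral of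
  \<open>k\<^sup>2\<close> over \<open>A\<close> times the complement of \<open>A'\<close>.\<close>

lemma covariance_charge:
  assumes A: "A \<in> rc_borel" "A' \<in> rc_borel" "A \<subseteq> A'"
  shows "expectation (\<lambda>X. charge A X * charge A' X) - expectation (charge A) * expectation (charge A')
    = (\<integral>x. indicator A x * r x \<partial>lborel)
      - (\<integral>w. indicator (A \<times> A') w * (k (fst w) (snd w))\<^sup>2 \<partial>(lborel \<Otimes>\<^sub>M lborel))"
proof -
  define p n p' n' where "p = A \<inter> {0<..}" and "n = A \<inter> {..<0}" and "p' = A' \<inter> {0<..}" and "n' = A' \<inter> {..<0}"
  have rc: "p \<in> rc_borel" "n \<in> rc_borel" "p' \<in> rc_borel" "n' \<in> rc_borel"
    using A unfolding p_def n_def p'_def n'_def by (auto intro: rc_borel_Int)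
  have nz: "0 \<notin> A" "0 \<notin> A'" using A by (force simp: rc_borel_iff)+
  have sg: "\<And>x. x \<in> p \<Longrightarrow> sgn x = 1" "\<And>x. x \<in> n \<Longrightarrow> sgn x = -1"
    "\<And>x. x \<in> p' \<Longrightarrow> sgn x = 1" "\<And>x. x \<in> n' \<Longrightarrow> sgn x = -1"
    by (auto simp: p_def n_def p'_def n'_def)
  let ?K = "\<lambda>D D'. \<integral>w. indicator (D \<times> D') w * (k (fst w) (snd w))\<^sup>2 \<partial>(lborel \<Otimes>\<^sub>M lborel)"
  let ?R = "\<lambda>D. \<integral>x. indicator D x * r x \<partial>lborel"
  let ?E = "\<lambda>D D'. expectation (\<lambda>X. num D X * num D' X)"
  have pp': "p \<inter> p' = p" "n \<inter> n' = n" "p \<inter> n' = {}" "n \<inter> p' = {}"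
    using A by (auto simp: p_def n_def p'_def n'_def)
  have cov: "?E p p' - expectation (num p) * expectation (num p') = ?R p - ?K p p'"
    "?E n n' - expectation (num n) * expectation (num n') = ?R n - ?K n n'"
    "?E p n' - expectation (num p) * expectation (num n') = ?K p n'"
    "?E n p' - expectation (num n) * expectation (num p') = ?K n p'"
    using covariance_num[OF rc(1) rc(3) sg(1,3)] covariance_num[OF rc(2) rc(4) sg(2,4)]
      covariance_num[OF rc(1) rc(4) sg(1,4)] covariance_num[OF rc(2) rc(3) sg(2,3)]
    by (simp_all add: pp')
  have int: "integrable P (\<lambda>X. num p X * num p' X)" "integrable P (\<lambda>X. num p X * num n' X)"
    "integrable P (\<lambda>X. num n X * num p' X)" "integrable P (\<lambda>X. num n X * num n' X)"
    by (intro expectation_num_mult rc)+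
  have int1: "integrable P (num p)" "integrable P (num n)" "integrable P (num p')" "integrable P (num n')"
    by (intro expectation_num rc)+
  have e: "charge A X * charge A' X = num p X * num p' X - num p X * num n' X - num n X * num p' X + num n X * num n' X" for X
    by (simp add: charge_def p_def n_def p'_def n'_def algebra_simps)
  have E2: "expectation (\<lambda>X. charge A X * charge A' X) = ?E p p' - ?E p n' - ?E n p' + ?E n n'"
    unfolding e using int by simp
  have E1: "expectation (charge A) = expectation (num p) - expectation (num n)"
    "expectation (charge A') = expectation (num p') - expectation (num n')"
    unfolding charge_def[abs_def] p_def[symmetric] n_def[symmetric] p'_def[symmetric] n'_def[symmetric]
    using int1 by simp_all
  have "expectation (\<lambda>X. charge A X * charge A' X) - expectation (charge A) * expectation (charge A')
    = (?E p p' - expectation (num p) * expectation (num p')) + (?E n n' - expectation (num n) * expectation (num n'))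
      - (?E p n' - expectation (num p) * expectation (num n')) - (?E n p' - expectation (num n) * expectation (num p'))"
    unfolding E1 E2 by (simp add: algebra_simps)
  also have "\<dots> = (?R p + ?R n) - (?K p p' + ?K n n' + ?K p n' + ?K n p')"
    unfolding cov by simp
  also have "?R p + ?R n = (\<integral>x. indicator p x * r x + indicator n x * r x \<partial>lborel)"
    using r_integrable rc by simp
  also have "\<dots> = ?R A"
    by (rule Bochner_Integration.integral_cong) (use nz in \<open>auto simp: p_def n_def indicator_def\<close>)
  also have "?K p p' + ?K n n' + ?K p n' + ?K n p' = (\<integral>w. indicator (p \<times> p') w * (k (fst w) (snd w))\<^sup>2
      + indicator (n \<times> n') w * (k (fst w) (snd w))\<^sup>2 + indicator (p \<times> n') w * (k (fst w) (snd w))\<^sup>2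
      + indicator (n \<times> p') w * (k (fst w) (snd w))\<^sup>2 \<partial>(lborel \<Otimes>\<^sub>M lborel))"
    using k_square_integrable rc by simp
  also have "\<dots> = ?K A A'"
  proof (rule Bochner_Integration.integral_cong[OF refl])
    fix w :: "real \<times> real"
    obtain x y where w: "w = (x, y)" by (cases w)
    show "indicator (p \<times> p') w * (k (fst w) (snd w))\<^sup>2
      + indicator (n \<times> n') w * (k (fst w) (snd w))\<^sup>2 + indicator (p \<times> n') w * (k (fst w) (snd w))\<^sup>2
      + indicator (n \<times> p') w * (k (fst w) (snd w))\<^sup>2 = indicator (A \<times> A') w * (k (fst w) (snd w))\<^sup>2"
      unfolding w using nz
      by (cases x "0::real" rule: linorder_cases; cases y "0::real" rule: linorder_cases)
        (auto simp: p_def n_def p'_def n'_def indicator_def)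
  qed
  finally show ?thesis .
qed

definition annulus :: "real \<Rightarrow> real \<Rightarrow> real set" where
  "annulus \<alpha> R = {x. \<alpha> \<le> \<bar>x\<bar> \<and> \<bar>x\<bar> \<le> R}"

lemma annulus_rc: "\<alpha> > 0 \<Longrightarrow> annulus \<alpha> R \<in> rc_borel"
  unfolding rc_borel_iff annulus_def by auto

lemma k_square_lborel_integrable:
  assumes "x \<noteq> 0"
  shows "integrable lborel (\<lambda>y. (k x y)\<^sup>2)" and "(\<integral>y. (k x y)\<^sup>2 \<partial>lborel) = r x"
proof -
  have m: "(\<lambda>y. (k x y)\<^sup>2) \<in> borel_measurable lborel" by measurable
  show "integrable lborel (\<lambda>y. (k x y)\<^sup>2)"
    by (rule integrableI_nn_integral_finite[OF m _ reproducing[OF assms]]) auto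
  show "(\<integral>y. (k x y)\<^sup>2 \<partial>lborel) = r x"
    by (rule integral_eq_nn_integral[OF m, THEN trans]) (use reproducing[OF assms] r_nonneg[OF assms] in auto)
qed

text \<open>The complement of the larger annulus consists of a neighbourhood of 0 of length \<open>2 \<gamma>\<close>, where
  \<open>k\<^sup>2 \<le> C / x\<^sup>2\<close> is used, and of a neighbourhood of infinity, where \<open>k\<^sup>2 \<le> C / (x\<^sup>2 y\<^sup>2)\<close> is
  used.\<close>

lemma covariance_charge_annulus:
  assumes \<gamma>: "0 < \<gamma>" "\<gamma> \<le> \<alpha>" and R: "R > 0"
  shows "expectation (\<lambda>X. charge (annulus \<alpha> R) X * charge (annulus \<gamma> R) X)
      - expectation (charge (annulus \<alpha> R)) * expectation (charge (annulus \<gamma> R))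
    \<le> 4 * C * \<gamma> / \<alpha> + 4 * C / (\<alpha> * R)"
proof -
  define A B where "A = annulus \<alpha> R" and "B = annulus \<gamma> R"
  have rc: "A \<in> rc_borel" "B \<in> rc_borel" using \<gamma> by (auto simp: A_def B_def intro!: annulus_rc)
  have [measurable]: "A \<in> sets borel" "B \<in> sets borel" using rc by (auto intro: rc_borel_sets)
  have AB: "A \<subseteq> B" using \<gamma> by (auto simp: A_def B_def annulus_def)
  have Anz: "x \<noteq> 0" if "x \<in> A" for x using that \<gamma> by (auto simp: A_def annulus_def)
  \<comment> \<open>For x in A the integral of \<open>k\<^sup>2\<close> over the complement of B is at most \<open>c / x\<^sup>2\<close>.\<close>
  define c where "c = C * (2 * \<gamma>) + C * (2 / R)"
  have c: "c \<ge> 0" using C_nonneg \<gamma> R by (simp add: c_def)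
  have inner: "(\<integral>y. indicator B y * (k x y)\<^sup>2 \<partial>lborel) \<ge> r x - c * (1 / x\<^sup>2)" if "x \<in> A" for x
  proof -
    note x = Anz[OF that]
    have int: "integrable lborel (\<lambda>y. (k x y)\<^sup>2)" "integrable lborel (\<lambda>y. indicator B y * (k x y)\<^sup>2)"
      using k_square_lborel_integrable(1)[OF x] integrable_mult_indicator[of B lborel "\<lambda>y. (k x y)\<^sup>2"] by auto
    have tail: "integrable lborel (\<lambda>y. indicator {y. R \<le> \<bar>y\<bar>} y * (1 / y\<^sup>2))" "(\<integral>y. indicator {y. R \<le> \<bar>y\<bar>} y * (1 / y\<^sup>2) \<partial>lborel) = 2 / R"
      by (rule inverse_square_tail[OF R])+
    have head: "integrable lborel (indicator {- \<gamma>..\<gamma>} :: real \<Rightarrow> real)" "(\<integral>y. indicator {- \<gamma>..\<gamma>} y \<partial>lborel) = 2 * \<gamma>"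
      using \<gamma> by (auto simp: measure_lborel_Icc)
    have "r x - (\<integral>y. indicator B y * (k x y)\<^sup>2 \<partial>lborel) = (\<integral>y. (k x y)\<^sup>2 - indicator B y * (k x y)\<^sup>2 \<partial>lborel)"
      using int k_square_lborel_integrable(2)[OF x] by simp
    also have "\<dots> \<le> (\<integral>y. C / x\<^sup>2 * indicator {- \<gamma>..\<gamma>} y + C / x\<^sup>2 * (indicator {y. R \<le> \<bar>y\<bar>} y * (1 / y\<^sup>2)) \<partial>lborel)"
    proof (rule integral_mono_AE)
      show "AE y in lborel. (k x y)\<^sup>2 - indicator B y * (k x y)\<^sup>2
          \<le> C / x\<^sup>2 * indicator {- \<gamma>..\<gamma>} y + C / x\<^sup>2 * (indicator {y. R \<le> \<bar>y\<bar>} y * (1 / y\<^sup>2))"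
        using AE_lborel_singleton[of 0]
      proof eventually_elim
        case (elim y)
        have nn: "C / x\<^sup>2 * indicator {- \<gamma>..\<gamma>} y \<ge> 0" "C / x\<^sup>2 * (indicator {y. R \<le> \<bar>y\<bar>} y * (1 / y\<^sup>2)) \<ge> 0"
          using C_nonneg by auto
        consider "y \<in> B" | "y \<notin> B" "\<bar>y\<bar> \<le> \<gamma>" | "y \<notin> B" "R \<le> \<bar>y\<bar>"
          unfolding B_def annulus_def mem_Collect_eq by linarith
        then show ?case
        proof cases
          case 2
          then have "y \<in> {- \<gamma>..\<gamma>}" by (simp add: abs_le_iff)
          then show ?thesis using 2 k_bound[OF x elim] nn(2) by simp
        next
          case 3
          then show ?thesis using k_bound'[OF x elim] nn(1) by simp
        qed (use nn in simp)
      qed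
    qed (intro Bochner_Integration.integrable_add Bochner_Integration.integrable_diff
        integrable_mult_right int tail(1) head(1))+
    also have "\<dots> = C / x\<^sup>2 * (2 * \<gamma>) + C / x\<^sup>2 * (2 / R)"
      by (subst Bochner_Integration.integral_add)
        (simp_all only: integral_mult_right_zero integrable_mult_right tail head)
    also have "\<dots> = c * (1 / x\<^sup>2)" by (simp add: c_def add_divide_distrib)
    finally show ?thesis by linarith
  qed
  have intk: "integrable lborel (\<lambda>x. \<integral>y. indicator (A \<times> B) (x, y) * (k (fst (x, y)) (snd (x, y)))\<^sup>2 \<partial>lborel)"
    by (rule lborel_pair.integrable_fst'[OF k_square_integrable[OF rc]])
  have tailA: "integrable lborel (\<lambda>x. indicator {x. \<alpha> \<le> \<bar>x\<bar>} x * (1 / x\<^sup>2))" "(\<integral>x. indicator {x. \<alpha> \<le> \<bar>x\<bar>} x * (1 / x\<^sup>2) \<partial>lborel) = 2 / \<alpha>"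
    using \<gamma> by (intro inverse_square_tail; simp)+
  have "(\<integral>x. indicator A x * r x \<partial>lborel) - (\<integral>w. indicator (A \<times> B) w * (k (fst w) (snd w))\<^sup>2 \<partial>(lborel \<Otimes>\<^sub>M lborel))
      = (\<integral>x. indicator A x * r x - (\<integral>y. indicator (A \<times> B) (x, y) * (k (fst (x, y)) (snd (x, y)))\<^sup>2 \<partial>lborel) \<partial>lborel)"
    using intk r_integrable[OF rc(1)] lborel_pair.integral_fst'[OF k_square_integrable[OF rc]] by simp
  also have "\<dots> \<le> (\<integral>x. c * (indicator {x. \<alpha> \<le> \<bar>x\<bar>} x * (1 / x\<^sup>2)) \<partial>lborel)"
  proof (rule integral_mono)
    fix x
    have "(\<integral>y. indicator (A \<times> B) (x, y) * (k (fst (x, y)) (snd (x, y)))\<^sup>2 \<partial>lborel) = indicator A x * (\<integral>y. indicator B y * (k x y)\<^sup>2 \<partial>lborel)"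
      by (cases "x \<in> A") (auto simp: indicator_def)
    then show "indicator A x * r x - (\<integral>y. indicator (A \<times> B) (x, y) * (k (fst (x, y)) (snd (x, y)))\<^sup>2 \<partial>lborel)
        \<le> c * (indicator {x. \<alpha> \<le> \<bar>x\<bar>} x * (1 / x\<^sup>2))"
      using inner[of x] c by (cases "x \<in> A") (auto simp: A_def annulus_def)
  qed (intro Bochner_Integration.integrable_diff integrable_mult_right intk r_integrable[OF rc(1)] tailA(1))+
  also have "\<dots> = c * (2 / \<alpha>)" by (simp only: integral_mult_right_zero tailA(2))
  also have "\<dots> = 4 * C * \<gamma> / \<alpha> + 4 * C / (\<alpha> * R)"
    using \<gamma> R by (simp add: c_def field_simps)
  finally show ?thesis
    using covariance_charge[OF rc AB] by (simp add: A_def B_def)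
qed

end


section \<open>Rigidity of the charge\<close>

context signed_kernel_process begin

text \<open>A discrete form of a cut-off that is linear in \<open>ln |x|\<close>. The inner radii have ratio \<open>n\<close>, so that the
  covariances of distinct terms are of order \<open>1/n\<close>; the outer radius is the inverse of a still smaller
  radius, so that the error at infinity is of the same order for every \<open>j \<le> n\<close>.\<close>

definition charge_average :: "real \<Rightarrow> nat \<Rightarrow> real set \<Rightarrow> real" where
  "charge_average \<delta> n X =
     (\<Sum>j\<in>{1..n}. charge (annulus (\<delta> / real n ^ j) (real n ^ (n + 1) / \<delta>)) X) / real n"

lemma charge_average_variance:
  assumes \<delta>: "\<delta> > 0" and n: "n \<ge> 1"
  defines "m \<equiv> expectation (charge_average \<delta> n)"
  shows "integrable P (\<lambda>X. (charge_average \<delta> n X - m)\<^sup>2)"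
    and "expectation (\<lambda>X. (charge_average \<delta> n X - m)\<^sup>2) \<le> 12 * C / real n"
proof -
  define N where "N = real n"
  have N: "N \<ge> 1" using n by (simp add: N_def)
  define T where "T j = charge (annulus (\<delta> / N ^ j) (N ^ (n + 1) / \<delta>))" for j
  have rc: "annulus (\<delta> / N ^ j) (N ^ (n + 1) / \<delta>) \<in> rc_borel" for j
    using \<delta> N by (intro annulus_rc) simp
  have int: "integrable P (T i)" "integrable P (\<lambda>X. T i X * T j X)" for i j
    unfolding T_def by (rule charge_integrable(1)[OF rc rc], rule charge_integrable(2)[OF rc rc])
  define c where "c i j = expectation (\<lambda>X. T i X * T j X) - expectation (T i) * expectation (T j)" for i j
  have c_sym: "c i j = c j i" for i j by (simp add: c_def mult.commute)
  have c_le: "c i j \<le> 4 * C * (if i = j then 1 else 1 / N) + 4 * C * (1 / N)"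
    if "i \<le> j" "j \<le> n" for i j
  proof -
    have "c i j \<le> 4 * C * (\<delta> / N ^ j) / (\<delta> / N ^ i) + 4 * C / ((\<delta> / N ^ i) * (N ^ (n + 1) / \<delta>))"
      unfolding c_def T_def using \<delta> N that
      by (intro covariance_charge_annulus) (auto intro!: divide_left_mono power_increasing mult_pos_pos)
    also have "4 * C * (\<delta> / N ^ j) / (\<delta> / N ^ i) = 4 * C * (N ^ i / N ^ j)" using \<delta> N by (simp add: field_simps)
    also have "4 * C / ((\<delta> / N ^ i) * (N ^ (n + 1) / \<delta>)) = 4 * C * (N ^ i / N ^ (n + 1))"
      using \<delta> N by (simp add: field_simps)
    also have "4 * C * (N ^ i / N ^ j) + 4 * C * (N ^ i / N ^ (n + 1))
        \<le> 4 * C * (if i = j then 1 else 1 / N) + 4 * C * (1 / N)"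
    proof -
      have *: "N ^ i / N ^ j \<le> 1 / N" if "i < j" for i j
      proof -
        have "N ^ i * N \<le> N ^ j" using power_increasing[of "Suc i" j N] that N by (simp add: mult.commute)
        then show ?thesis using N by (simp add: field_simps)
      qed
      have "N ^ i / N ^ j \<le> (if i = j then 1 else 1 / N)" using *[of i j] that N by auto
      moreover have "N ^ i / N ^ (n + 1) \<le> 1 / N" using *[of i "n + 1"] that by auto
      ultimately show ?thesis using C_nonneg by (intro add_mono mult_left_mono) auto
    qed
    finally show ?thesis .
  qed
  have c_le': "c i j \<le> 4 * C * (if i = j then 1 else 1 / N) + 4 * C * (1 / N)" if "i \<in> {1..n}" "j \<in> {1..n}" for i j
    using c_le[of i j] c_le[of j i] c_sym[of i j] that by (cases "i \<le> j") (auto split: if_splits)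
  have m: "m = (\<Sum>j\<in>{1..n}. expectation (T j)) / N"
    unfolding m_def charge_average_def[abs_def] T_def[symmetric] N_def[symmetric] using int by simp
  have sq: "(charge_average \<delta> n X - m)\<^sup>2
      = (\<Sum>i\<in>{1..n}. \<Sum>j\<in>{1..n}. (T i X - expectation (T i)) * (T j X - expectation (T j))) / N\<^sup>2" for X
  proof -
    have "charge_average \<delta> n X - m = (\<Sum>j\<in>{1..n}. T j X - expectation (T j)) / N"
      unfolding m charge_average_def T_def[symmetric] N_def[symmetric] by (simp add: sum_subtractf diff_divide_distrib)
    then show ?thesis by (simp add: power_divide power2_eq_square[of "sum _ _"] sum_product)
  qed
  have prod: "(T i X - expectation (T i)) * (T j X - expectation (T j))
      = T i X * T j X - expectation (T j) * T i X - expectation (T i) * T j X + expectation (T i) * expectation (T j)" for i j X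
    by (simp add: algebra_simps)
  have pint: "integrable P (\<lambda>X. (T i X - expectation (T i)) * (T j X - expectation (T j)))" for i j
    unfolding prod using int by (intro Bochner_Integration.integrable_add Bochner_Integration.integrable_diff integrable_mult_right) auto
  have pE: "expectation (\<lambda>X. (T i X - expectation (T i)) * (T j X - expectation (T j))) = c i j" for i j
    unfolding prod using int by (simp add: c_def prob_space)
  show "integrable P (\<lambda>X. (charge_average \<delta> n X - m)\<^sup>2)"
    unfolding sq by (intro integrable_divide Bochner_Integration.integrable_sum pint)
  have "expectation (\<lambda>X. (charge_average \<delta> n X - m)\<^sup>2) = (\<Sum>i\<in>{1..n}. \<Sum>j\<in>{1..n}. c i j) / N\<^sup>2"
    unfolding sq using pint pE by simp
  also have "(\<Sum>i\<in>{1..n}. \<Sum>j\<in>{1..n}. c i j)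
      \<le> (\<Sum>i\<in>{1..n}. \<Sum>j\<in>{1..n}. 4 * C * (if i = j then 1 else 0) + 8 * C * (1 / N))"
  proof (intro sum_mono order_trans[OF c_le'])
    fix i j
    show "4 * C * (if i = j then 1 else 1 / N) + 4 * C * (1 / N) \<le> 4 * C * (if i = j then 1 else 0) + 8 * C * (1 / N)"
      using C_nonneg N by (cases "i = j") (simp_all add: divide_right_mono)
  qed auto
  also have "\<dots> = 12 * C * N"
  proof -
    have "(\<Sum>j\<in>{1..n}. 4 * C * (if i = j then 1 else 0)) = 4 * C" if "i \<in> {1..n}" for i
      using that by (simp flip: sum_distrib_left)
    then have "(\<Sum>i\<in>{1..n}. \<Sum>j\<in>{1..n}. 4 * C * (if i = j then 1 else 0) + 8 * C * (1 / N))
        = (\<Sum>i\<in>{1..n}. 4 * C + N * (8 * C * (1 / N)))"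
      by (intro sum.cong refl) (simp add: sum.distrib N_def)
    also have "\<dots> = N * (12 * C)" using N by (simp add: N_def)
    finally show ?thesis by simp
  qed
  finally show "expectation (\<lambda>X. (charge_average \<delta> n X - m)\<^sup>2) \<le> 12 * C / real n"
    using N by (simp add: divide_right_mono power2_eq_square N_def)
qed

text \<open>Configurations may accumulate at infinity as well as at 0, but the expected number of points outside
  a neighbourhood of 0 is finite, because the intensity is at most \<open>C / x\<^sup>2\<close>.\<close>

lemma AE_finite_away_from_zero:
  assumes \<delta>: "\<delta> > 0"
  shows "AE X in P. finite (X \<inter> {x. \<delta> \<le> \<bar>x\<bar>})"
proof -
  let ?D = "\<lambda>n::nat. annulus \<delta> (real n)"
  have rc: "?D n \<in> rc_borel" for n using \<delta> by (rule annulus_rc)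
  have mono: "?D m \<subseteq> ?D n" if "m \<le> n" for m n using that by (auto simp: annulus_def)
  have fin: "finite (X \<inter> ?D n)" if "X \<in> Conf" for X n by (rule Conf_finite[OF that rc])
  have "(\<integral>\<^sup>+X. (SUP n. ennreal (num (?D n) X)) \<partial>P) = (SUP n. \<integral>\<^sup>+X. ennreal (num (?D n) X) \<partial>P)"
  proof (rule nn_integral_monotone_convergence_SUP_AE)
    show "AE X in P. ennreal (num (?D i) X) \<le> ennreal (num (?D (Suc i)) X)" for i
    proof (rule AE_I2)
      fix X assume "X \<in> space P"
      then have X: "X \<in> Conf" by (simp add: space_P)
      have "card (X \<inter> ?D i) \<le> card (X \<inter> ?D (Suc i))"
        using mono[of i "Suc i"] by (intro card_mono fin[OF X]) auto
      then show "ennreal (num (?D i) X) \<le> ennreal (num (?D (Suc i)) X)" by (simp add: num_def)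
    qed
    show "(\<lambda>X. ennreal (num (?D i) X)) \<in> borel_measurable P" for i using rc[of i] by measurable
  qed
  also have "\<dots> \<le> ennreal (C * (2 / \<delta>))"
  proof (rule SUP_least)
    fix n
    have "(\<integral>\<^sup>+X. ennreal (num (?D n) X) \<partial>P) = ennreal (expectation (num (?D n)))"
      by (rule nn_integral_eq_integral[OF expectation_num(1)[OF rc]]) (simp add: num_def)
    also have "expectation (num (?D n)) = (\<integral>x. indicator (?D n) x * r x \<partial>lborel)" by (rule expectation_num(2)[OF rc])
    also have "\<dots> \<le> (\<integral>x. C * (indicator {x. \<delta> \<le> \<bar>x\<bar>} x * (1 / x\<^sup>2)) \<partial>lborel)"
    proof (rule integral_mono[OF r_integrable[OF rc] integrable_mult_right[OF inverse_square_tail(1)[OF \<delta>]]])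
      show "indicator (?D n) x * r x \<le> C * (indicator {x. \<delta> \<le> \<bar>x\<bar>} x * (1 / x\<^sup>2))" for x
        using r_bound[of x] \<delta> C_nonneg by (cases "x \<in> ?D n"; cases "x = 0") (auto simp: annulus_def)
    qed
    also have "\<dots> = C * (2 / \<delta>)" by (simp only: integral_mult_right_zero inverse_square_tail(2)[OF \<delta>])
    finally show "(\<integral>\<^sup>+X. ennreal (num (?D n) X) \<partial>P) \<le> ennreal (C * (2 / \<delta>))" by (simp add: ennreal_leI)
  qed
  finally have "(\<integral>\<^sup>+X. (SUP n. ennreal (num (?D n) X)) \<partial>P) \<noteq> \<infinity>"
    by (auto simp: top_unique)
  then have "AE X in P. (SUP n. ennreal (num (?D n) X)) \<noteq> \<infinity>"
    by (intro nn_integral_PInf_AE) (use rc in measurable)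
  then show ?thesis
    using AE_space
  proof eventually_elim
    case (elim X)
    then have X: "X \<in> Conf" by (simp add: space_P)
    obtain b where b: "(SUP n. ennreal (num (?D n) X)) = ennreal b" "b \<ge> 0"
      using elim(1) by (cases "SUP n. ennreal (num (?D n) X)") auto
    have card_le: "real (card (X \<inter> ?D n)) \<le> b" for n
    proof -
      have "ennreal (num (?D n) X) \<le> ennreal b" unfolding b(1)[symmetric] by (rule SUP_upper) simp
      then show ?thesis using b(2) by (simp add: num_def)
    qed
    show ?case
    proof (rule ccontr)
      assume "infinite (X \<inter> {x. \<delta> \<le> \<bar>x\<bar>})"
      then obtain F where F: "F \<subseteq> X \<inter> {x. \<delta> \<le> \<bar>x\<bar>}" "finite F" "card F = Suc (nat \<lceil>b\<rceil>)"
        by (rule infinite_arbitrarily_large[THEN exE]) blast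
      obtain M where M: "\<forall>x\<in>F. \<bar>x\<bar> \<le> M" using finite_imp_bounded[OF F(2)] by (auto simp: bounded_iff)
      obtain n where n: "M \<le> real n" using real_arch_simple by blast
      have "F \<subseteq> X \<inter> ?D n" using F(1) M n by (force simp: annulus_def)
      then have "card F \<le> card (X \<inter> ?D n)" by (rule card_mono[OF fin[OF X]])
      then show False using card_le[of n] F(3) by linarith
    qed
  qed
qed

lemma charge_average_measurable_conf:
  assumes "\<delta> > 0" "n \<ge> 1"
  shows "charge_average \<delta> n \<in> borel_measurable conf_space"
proof -
  have "annulus (\<delta> / real n ^ j) (real n ^ (n + 1) / \<delta>) \<in> rc_borel" for j
    using assms by (intro annulus_rc) simp
  then have "charge_average \<delta> n \<in> borel_measurable P" unfolding charge_average_def by measurable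
  then show ?thesis using measurable_cong_sets[OF sets_P refl] by auto
qed

lemma num_split: "X \<in> Conf \<Longrightarrow> D \<in> rc_borel \<Longrightarrow> num D X = num D (X \<inter> B) + num D (X - B)"
proof -
  assume "X \<in> Conf" "D \<in> rc_borel"
  then have "finite (X \<inter> D)" by (rule Conf_finite)
  moreover have "X \<inter> D = (X \<inter> B \<inter> D) \<union> ((X - B) \<inter> D)" by auto
  ultimately show ?thesis unfolding num_def
    by (subst \<open>X \<inter> D = _\<close>, subst card_Un_disjoint) (auto intro: finite_subset)
qed

lemma charge_average_split:
  assumes "X \<in> Conf" "\<delta> > 0" "n \<ge> 1"
  shows "charge_average \<delta> n X = charge_average \<delta> n (X \<inter> B) + charge_average \<delta> n (X - B)"
proof -
  have rc: "annulus (\<delta> / real n ^ j) (real n ^ (n + 1) / \<delta>) \<in> rc_borel" for j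
    using assms by (intro annulus_rc) simp
  have "charge A X = charge A (X \<inter> B) + charge A (X - B)" if "A \<in> rc_borel" for A
    using num_split[OF assms(1), of "A \<inter> {0<..}" B] num_split[OF assms(1), of "A \<inter> {..<0}" B] that
    by (simp add: charge_def rc_borel_Int)
  then show ?thesis using rc by (simp add: charge_average_def sum.distrib add_divide_distrib)
qed

lemma charge_average_eventually:
  assumes F: "finite F" "\<And>x. x \<in> F \<Longrightarrow> \<delta> \<le> \<bar>x\<bar>" and \<delta>: "\<delta> > 0"
  shows "\<forall>\<^sub>F n in sequentially. charge_average \<delta> n F
    = real (card (F \<inter> {0<..})) - real (card (F \<inter> {..<0}))"
proof -
  obtain M where M: "\<forall>x\<in>F. \<bar>x\<bar> \<le> M" using finite_imp_bounded[OF F(1)] by (auto simp: bounded_iff)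
  show ?thesis
  proof (rule eventually_mono[OF eventually_ge_at_top[of "max 1 (nat \<lceil>\<delta> * M\<rceil>)"]])
    fix n assume n: "max 1 (nat \<lceil>\<delta> * M\<rceil>) \<le> n"
    then have n1: "real n \<ge> 1" "\<delta> * M \<le> real n" by (auto; linarith)+
    have "real n * 1 \<le> real n * real n ^ n" using n1 by (intro mult_left_mono one_le_power) auto
    moreover have "real n ^ (n + 1) = real n * real n ^ n" by simp
    ultimately have "\<delta> * M \<le> real n ^ (n + 1)" using n1 by linarith
    then have R: "M \<le> real n ^ (n + 1) / \<delta>" using \<delta> by (simp add: field_simps)
    have "charge (annulus (\<delta> / real n ^ j) (real n ^ (n + 1) / \<delta>)) F
        = real (card (F \<inter> {0<..})) - real (card (F \<inter> {..<0}))" for j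
    proof -
      have "\<delta> / real n ^ j \<le> \<delta>" using n1 \<delta> by (simp add: divide_le_eq mult_ge1_I one_le_power)
      then have "F \<subseteq> annulus (\<delta> / real n ^ j) (real n ^ (n + 1) / \<delta>)"
        using F(2) M R by (force simp: annulus_def)
      then have "F \<inter> (annulus (\<delta> / real n ^ j) (real n ^ (n + 1) / \<delta>) \<inter> {0<..}) = F \<inter> {0<..}"
        "F \<inter> (annulus (\<delta> / real n ^ j) (real n ^ (n + 1) / \<delta>) \<inter> {..<0}) = F \<inter> {..<0}" by auto
      then show ?thesis by (simp add: charge_def num_def)
    qed
    then show "charge_average \<delta> n F = real (card (F \<inter> {0<..})) - real (card (F \<inter> {..<0}))"
      using n1 by (simp add: charge_average_def)
  qed
qed

text \<open>Every annulus in the average eventually contains a given finite set of points with \<open>\<delta> \<le> |x|\<close>, so the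
  average assigns to \<open>B \<inter> X\<close> its charge. Hence the charge is the limit of the mean minus the average over
  \<open>X - B\<close>, along a subsequence on which the averages converge almost surely.\<close>

theorem charge_rigidity:
  assumes \<delta>: "\<delta> > 0" and B: "\<And>x. x \<in> B \<Longrightarrow> \<delta> \<le> \<bar>x\<bar>"
  shows "\<exists>N :: real set \<Rightarrow> int. N \<in> conf_space \<rightarrow>\<^sub>M count_space UNIV \<and>
    (AE X in P. finite (B \<inter> X) \<and>
       int (card (B \<inter> X \<inter> {0<..})) - int (card (B \<inter> X \<inter> {..<0})) = N (X - B))"
proof -
  define S where "S n = charge_average \<delta> (Suc n)" for n
  define m where "m n = expectation (S n)" for n
  have var: "integrable P (\<lambda>X. (S n X - m n)\<^sup>2)" "expectation (\<lambda>X. (S n X - m n)\<^sup>2) \<le> 12 * C / real (Suc n)" for n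
    unfolding S_def m_def by (rule charge_average_variance[OF \<delta>], simp)+
  have "(\<lambda>n. expectation (\<lambda>X. norm ((S n X - m n)\<^sup>2))) \<longlonglongrightarrow> 0"
  proof (rule tendsto_sandwich)
    show "\<forall>\<^sub>F n in sequentially. 0 \<le> expectation (\<lambda>X. norm ((S n X - m n)\<^sup>2))" by simp
    show "\<forall>\<^sub>F n in sequentially. expectation (\<lambda>X. norm ((S n X - m n)\<^sup>2)) \<le> 12 * C / real (Suc n)"
      using var(2) by simp
    show "(\<lambda>n. 12 * C / real (Suc n)) \<longlonglongrightarrow> 0"
      using tendsto_mult[OF tendsto_const[of "12 * C"] LIMSEQ_Suc[OF lim_1_over_n]] by simp
  qed simp
  from tendsto_L1_AE_subseq[OF var(1) this] obtain s where s: "strict_mono s"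
    "AE X in P. (\<lambda>n. (S (s n) X - m (s n))\<^sup>2) \<longlonglongrightarrow> 0" by blast
  \<comment> \<open>The floor makes N integer-valued everywhere; at X - B the limit is almost surely an integer.\<close>
  define N :: "real set \<Rightarrow> int" where "N Y = \<lfloor>lim (\<lambda>n. m (s n) - S (s n) Y)\<rfloor>" for Y
  have "S n \<in> borel_measurable conf_space" for n
    unfolding S_def by (rule charge_average_measurable_conf[OF \<delta>]) simp
  then have "N \<in> conf_space \<rightarrow>\<^sub>M count_space UNIV" unfolding N_def by measurable
  moreover have "AE X in P. finite (B \<inter> X) \<and>
       int (card (B \<inter> X \<inter> {0<..})) - int (card (B \<inter> X \<inter> {..<0})) = N (X - B)"
    using s(2) AE_finite_away_from_zero[OF \<delta>] AE_space
  proof eventually_elim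
    case (elim X)
    have X: "X \<in> Conf" using elim(3) by (simp add: space_P)
    have fin: "finite (X \<inter> B)" using elim(2) by (rule finite_subset[rotated]) (use B in auto)
    define t where "t = int (card (X \<inter> B \<inter> {0<..})) - int (card (X \<inter> B \<inter> {..<0}))"
    have "(\<lambda>n. S (s n) X - m (s n)) \<longlonglongrightarrow> 0"
      using tendsto_real_sqrt[OF elim(1)] by (simp add: tendsto_rabs_zero_iff)
    moreover have "(\<lambda>n. S (s n) (X \<inter> B)) \<longlonglongrightarrow> real_of_int t"
    proof (rule tendsto_eventually)
      have "\<forall>\<^sub>F n in sequentially. charge_average \<delta> n (X \<inter> B) = real_of_int t"
        using charge_average_eventually[OF fin _ \<delta>] B by (simp add: t_def)
      then have "\<forall>\<^sub>F n in sequentially. S n (X \<inter> B) = real_of_int t"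
        unfolding S_def by (rule eventually_compose_filterlim[OF _ filterlim_Suc])
      then show "\<forall>\<^sub>F n in sequentially. S (s n) (X \<inter> B) = real_of_int t"
        by (rule eventually_subseq[OF s(1)])
    qed
    ultimately have "(\<lambda>n. S (s n) (X \<inter> B) - (S (s n) X - m (s n))) \<longlonglongrightarrow> real_of_int t - 0"
      by (intro tendsto_diff)
    moreover have "S (s n) (X \<inter> B) - (S (s n) X - m (s n)) = m (s n) - S (s n) (X - B)" for n
      using charge_average_split[OF X \<delta>, of "Suc (s n)" B] by (simp add: S_def)
    ultimately have "(\<lambda>n. m (s n) - S (s n) (X - B)) \<longlonglongrightarrow> real_of_int t" by simp
    then have "N (X - B) = t" by (simp add: N_def limI)
    then show ?case using fin by (simp add: t_def Int_commute Int_left_commute)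
  qed
  ultimately show ?thesis by blast
qed

end


section \<open>The Whittaker kernel on the punctured line\<close>

text \<open>Both arguments of the quotient move, so differentiability at \<open>x\<close> alone is not enough; by the mean value
  theorem the quotient is a value of \<open>f'\<close> between the two arguments.\<close>

lemma difference_quotient_two_points:
  fixes f f' :: "real \<Rightarrow> real"
  assumes d: "d > 0" and der: "\<And>y. \<bar>y - x\<bar> < d \<Longrightarrow> (f has_real_derivative f' y) (at y)"
    and cont: "isCont f' x"
  shows "((\<lambda>w. (f (fst w) - f (snd w)) / (fst w - snd w)) \<longlongrightarrow> f' x) (at (x, x) within {(s, t). s \<noteq> t})"
proof (rule tendstoI)
  fix e :: real assume "e > 0"
  then obtain c where c: "c > 0" "\<And>y. dist y x < c \<Longrightarrow> dist (f' y) (f' x) < e"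
    using cont unfolding continuous_at_eps_delta by blast
  have main: "dist ((f s - f t) / (s - t)) (f' x) < e"
    if st: "s < t" "\<bar>s - x\<bar> < min c d" "\<bar>t - x\<bar> < min c d" for s t
  proof -
    have "\<bar>y - x\<bar> < min c d" if "s \<le> y" "y \<le> t" for y using st that by linarith
    note near = this
    obtain y where y: "s < y" "y < t" "f t - f s = (t - s) * f' y"
      using MVT2[OF st(1), of f f'] der near by (metis min_less_iff_conj)
    have "(f s - f t) / (s - t) = f' y" using y(3) st(1) by (simp add: field_simps)
    moreover have "dist y x < c" using near[of y] y by (simp add: dist_real_def)
    ultimately show ?thesis using c(2) by simp
  qed
  show "\<forall>\<^sub>F w in at (x, x) within {(s, t). s \<noteq> t}. dist ((f (fst w) - f (snd w)) / (fst w - snd w)) (f' x) < e"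
    unfolding eventually_at
  proof (intro exI[of _ "min c d"] conjI ballI impI)
    show "min c d > 0" using c(1) d by simp
    fix w :: "real \<times> real" assume w: "w \<in> {(s, t). s \<noteq> t}" "w \<noteq> (x, x) \<and> dist w (x, x) < min c d"
    obtain s t where st: "w = (s, t)" by (cases w)
    have "\<bar>s - x\<bar> < min c d" "\<bar>t - x\<bar> < min c d"
      using dist_fst_le[of w "(x, x)"] dist_snd_le[of w "(x, x)"] w(2) unfolding st dist_real_def by simp_all
    moreover have "(f s - f t) / (s - t) = (f t - f s) / (t - s)"
      by (metis minus_diff_eq minus_divide_divide)
    ultimately show "dist ((f (fst w) - f (snd w)) / (fst w - snd w)) (f' x) < e"
      using main[of s t] main[of t s] w(1) unfolding st by (cases "s < t") auto
  qed
qed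

lemma off_diagonal_limit_point: "at (x, x) within {(s :: real, t). s \<noteq> t} \<noteq> bot"
proof -
  have "(x, x) islimpt {(s :: real, t). s \<noteq> t}"
    unfolding islimpt_approachable
  proof (intro allI impI)
    fix e :: real assume "e > 0"
    then show "\<exists>w\<in>{(s, t). s \<noteq> t}. w \<noteq> (x, x) \<and> dist w (x, x) < e"
      by (intro bexI[of _ "(x + e / 2, x)"]) (auto simp: dist_Pair_Pair dist_real_def)
  qed
  then show ?thesis by (simp add: trivial_limit_within)
qed

lemma whittaker_k_diagonal:
  assumes sys: "whittaker_system a \<rho> p q (- {0})" and x: "x \<noteq> 0"
  shows "((\<lambda>w. whittaker_k a \<rho> p q (fst w) (snd w)) \<longlongrightarrow> scaled_density a \<rho> p q x / x)
    (at (x, x) within {(s, t). s \<noteq> t})"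
proof -
  have x': "\<And>y. y \<noteq> 0 \<Longrightarrow> y \<in> - {0 :: real}" by simp
  note d = whittaker_systemD[OF sys x']
  define p' q' where "p' y = (a / y - 1/2) * p y + \<rho> / y * q y"
    and "q' y = - (a / y - 1/2) * q y - \<rho> / y * p y" for y
  have cp: "isCont p x" "isCont q x" using d[OF x] by (auto intro: DERIV_isCont)
  then have cp': "isCont p' x" "isCont q' x"
    unfolding p'_def[abs_def] q'_def[abs_def] using x by (auto intro!: continuous_intros)
  have nz: "y \<noteq> 0" if "\<bar>y - x\<bar> < \<bar>x\<bar>" for y using that by auto
  let ?F = "at (x, x) within {(s :: real, t). s \<noteq> t}"
  have dp: "((\<lambda>w. (p (fst w) - p (snd w)) / (fst w - snd w)) \<longlongrightarrow> p' x) ?F"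
    using x d(1)[OF nz] by (intro difference_quotient_two_points[of "\<bar>x\<bar>"] cp') (auto simp: p'_def)
  have dq: "((\<lambda>w. (q (fst w) - q (snd w)) / (fst w - snd w)) \<longlongrightarrow> q' x) ?F"
    using x d(2)[OF nz] by (intro difference_quotient_two_points[of "\<bar>x\<bar>"] cp') (auto simp: q'_def)
  have "((\<lambda>w. snd w) \<longlongrightarrow> snd (x, x)) ?F" by (intro tendsto_snd tendsto_ident_at)
  then have "((\<lambda>w. p (snd w)) \<longlongrightarrow> p x) ?F" "((\<lambda>w. q (snd w)) \<longlongrightarrow> q x) ?F"
    using cp by (auto intro: isCont_tendsto_compose)
  note l = tendsto_diff[OF tendsto_mult[OF dp this(2)] tendsto_mult[OF dq this(1)]]
  have "p' x * q x - q' x * p x = scaled_density a \<rho> p q x / x"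
    using x by (simp add: p'_def q'_def scaled_density_def field_simps power2_eq_square)
  moreover have "\<forall>\<^sub>F w in ?F. (p (fst w) - p (snd w)) / (fst w - snd w) * q (snd w) - (q (fst w) - q (snd w)) / (fst w - snd w) * p (snd w)
     = whittaker_k a \<rho> p q (fst w) (snd w)"
    unfolding eventually_at_filter
  proof (intro always_eventually allI impI)
    fix w :: "real \<times> real" assume "w \<in> {(s, t). s \<noteq> t}"
    then have "fst w \<noteq> snd w" by auto
    moreover have "(p (fst w) - p (snd w)) * q (snd w) - (q (fst w) - q (snd w)) * p (snd w)
        = p (fst w) * q (snd w) - q (fst w) * p (snd w)"
      by (simp add: algebra_simps)
    ultimately show "(p (fst w) - p (snd w)) / (fst w - snd w) * q (snd w) - (q (fst w) - q (snd w)) / (fst w - snd w) * p (snd w)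
     = whittaker_k a \<rho> p q (fst w) (snd w)"
      by (simp only: whittaker_k_def if_False times_divide_eq_left diff_divide_distrib[symmetric])
  qed
  ultimately show ?thesis using Lim_transform_eventually[OF l] by simp
qed

text \<open>The components are exchanged on the negative half-line, and one of them changes its sign. Then all four
  cases in the definition of the kernel become one formula up to the sign of \<open>y\<close>, and one and the same
  system holds on both half-lines.\<close>

definition line_P :: "complex \<Rightarrow> real \<Rightarrow> real" where
  "line_P z x = (if x > 0 then wave_P z x else wave_Q (- cnj z) (- x))"

definition line_Q :: "complex \<Rightarrow> real \<Rightarrow> real" where
  "line_Q z x = (if x > 0 then wave_Q z x else - wave_P (- cnj z) (- x))"

lemma line_system:
  assumes z: "z \<notin> \<real>"
  shows "whittaker_system (Re z) (norm z) (line_P z) (line_Q z) (- {0})"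
  unfolding whittaker_system_def
proof (intro ballI)
  fix x :: real assume "x \<in> - {0}"
  then have "x \<noteq> 0" by simp
  then consider "x > 0" | "x < 0" unfolding neq_iff by blast
  then show "(line_P z has_real_derivative (Re z / x - 1 / 2) * line_P z x + norm z / x * line_Q z x) (at x) \<and>
      (line_Q z has_real_derivative - (Re z / x - 1 / 2) * line_Q z x - norm z / x * line_P z x) (at x)"
  proof cases
    case 1
    have tr: "(f has_real_derivative D) (at x)" if gD: "(g has_real_derivative D) (at x)" and gf: "\<And>y. y > 0 \<Longrightarrow> g y = f y" for f g D
    proof (rule has_field_derivative_transform_within_open[OF gD])
      show "open {0::real<..}" "x \<in> {0<..}" using 1 by simp_all
      show "g y = f y" if "y \<in> {0<..}" for y using gf[of y] that by simp
    qed
    have "x \<in> {0<..}" using 1 by simp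
    note d = whittaker_systemD[OF wave_system[OF z] this]
    have v: "line_P z x = wave_P z x" "line_Q z x = wave_Q z x" using 1 by (simp_all add: line_P_def line_Q_def)
    show ?thesis unfolding v
      by (intro conjI tr[OF d(1)] tr[OF d(2)]) (simp_all add: line_P_def line_Q_def)
  next
    case 2
    have tr: "(f has_real_derivative D) (at x)" if gD: "(g has_real_derivative D) (at x)" and gf: "\<And>y. y < 0 \<Longrightarrow> g y = f y" for f g D
    proof (rule has_field_derivative_transform_within_open[OF gD])
      show "open {..<0::real}" "x \<in> {..<0}" using 2 by simp_all
      show "g y = f y" if "y \<in> {..<0}" for y using gf[of y] that by simp
    qed
    have mz: "- cnj z \<notin> \<real>" using z by (simp add: complex_is_Real_iff)
    have "x \<in> uminus ` {0<..}" using 2 by (intro image_eqI[of _ _ "- x"]) auto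
    note d = whittaker_systemD[OF whittaker_system_mirror[OF wave_system[OF mz]] this]
    have v: "line_P z x = wave_Q (- cnj z) (- x)" "line_Q z x = - wave_P (- cnj z) (- x)"
      using 2 by (simp_all add: line_P_def line_Q_def)
    have r: "- Re (- cnj z) = Re z" "norm (- cnj z) = norm z" by simp_all
    show ?thesis unfolding v
      by (intro conjI tr[OF d(1)[unfolded r]] tr[OF d(2)[unfolded r]]) (simp_all add: line_P_def line_Q_def)
  qed
qed

lemma whittaker_kernel_off_line:
  assumes z: "z \<notin> \<real>" and xy: "x \<noteq> 0" "y \<noteq> 0" "x \<noteq> y"
  shows "whittaker_kernel_off z (cnj z) x y
    = of_real (sgn y * whittaker_k (Re z) (norm z) (line_P z) (line_Q z) x y)"
proof -
  have mz: "- cnj z \<notin> \<real>" using z by (simp add: complex_is_Real_iff)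
  have P1: "whittaker_P 1 z (cnj z) x = of_real (wave_P z x)" and Q1: "whittaker_Q 1 z (cnj z) x = of_real (wave_Q z x)"
    if "x > 0" for x using whittaker_P_wave[OF z that] whittaker_Q_wave[OF z that] .
  have P2: "whittaker_P (-1) z (cnj z) x = of_real (wave_P (- cnj z) x)"
    and Q2: "whittaker_Q (-1) z (cnj z) x = of_real (wave_Q (- cnj z) x)" if "x > 0" for x
    using whittaker_P_wave[OF mz that] whittaker_Q_wave[OF mz that]
    unfolding whittaker_P_flip[of z] whittaker_Q_flip[of z] by simp_all
  have nz: "complex_of_real x - of_real y \<noteq> 0" "complex_of_real y - of_real x \<noteq> 0" using xy(3) by simp_all
  consider "x > 0" "y > 0" | "x > 0" "y < 0" | "x < 0" "y > 0" | "x < 0" "y < 0" using xy by linarith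
  then show ?thesis
  proof cases
    case 1
    then show ?thesis using xy(3)
      by (simp add: whittaker_kernel_off_def P1 Q1 whittaker_k_def line_P_def line_Q_def)
  next
    case 2
    then show ?thesis using xy(3) nz
      by (simp add: whittaker_kernel_off_def P1 Q1 P2 Q2 whittaker_k_def line_P_def line_Q_def field_simps)
  next
    case 3
    then show ?thesis using xy(3) nz
      by (simp add: whittaker_kernel_off_def P1 Q1 P2 Q2 whittaker_k_def line_P_def line_Q_def field_simps)
  next
    case 4
    then show ?thesis using xy(3) nz
      by (simp add: whittaker_kernel_off_def P2 Q2 whittaker_k_def line_P_def line_Q_def field_simps)
  qed
qed

lemma whittaker_kernel_diagonal:
  assumes z: "z \<notin> \<real>" and x: "x \<noteq> 0"
  shows "whittaker_kernel z (cnj z) x x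
    = of_real (scaled_density (Re z) (norm z) (line_P z) (line_Q z) x / \<bar>x\<bar>)"
proof -
  let ?k = "whittaker_k (Re z) (norm z) (line_P z) (line_Q z)"
  let ?F = "at (x, x) within {(s :: real, t). s \<noteq> t}"
  have "((\<lambda>w. complex_of_real (sgn x * ?k (fst w) (snd w))) \<longlongrightarrow>
      of_real (sgn x * (scaled_density (Re z) (norm z) (line_P z) (line_Q z) x / x))) ?F"
    by (intro tendsto_of_real tendsto_mult tendsto_const whittaker_k_diagonal[OF line_system[OF z] x])
  moreover have "\<forall>\<^sub>F w in ?F. complex_of_real (sgn x * ?k (fst w) (snd w)) = (\<lambda>(s, t). whittaker_kernel_off z (cnj z) s t) w"
    unfolding eventually_at
  proof (intro exI[of _ "\<bar>x\<bar>"] conjI ballI impI)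
    show "\<bar>x\<bar> > 0" using x by simp
    fix w :: "real \<times> real" assume w: "w \<in> {(s, t). s \<noteq> t}" "w \<noteq> (x, x) \<and> dist w (x, x) < \<bar>x\<bar>"
    obtain s t where st: "w = (s, t)" by (cases w)
    have "\<bar>s - x\<bar> < \<bar>x\<bar>" "\<bar>t - x\<bar> < \<bar>x\<bar>"
      using dist_fst_le[of w "(x, x)"] dist_snd_le[of w "(x, x)"] w(2) unfolding st dist_real_def by simp_all
    then have "s \<noteq> 0" "t \<noteq> 0" "sgn t = sgn x" by (auto simp: sgn_if)
    then show "complex_of_real (sgn x * ?k (fst w) (snd w)) = (\<lambda>(s, t). whittaker_kernel_off z (cnj z) s t) w"
      using whittaker_kernel_off_line[OF z, of s t] w(1) by (simp add: st)
  qed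
  ultimately have "((\<lambda>(s, t). whittaker_kernel_off z (cnj z) s t) \<longlongrightarrow>
      of_real (sgn x * (scaled_density (Re z) (norm z) (line_P z) (line_Q z) x / x))) ?F"
    by (rule Lim_transform_eventually)
  then have "whittaker_kernel z (cnj z) x x = of_real (sgn x * (scaled_density (Re z) (norm z) (line_P z) (line_Q z) x / x))"
    unfolding whittaker_kernel_def using tendsto_Lim[OF off_diagonal_limit_point] by simp
  also have "sgn x * (scaled_density (Re z) (norm z) (line_P z) (line_Q z) x / x) = scaled_density (Re z) (norm z) (line_P z) (line_Q z) x / \<bar>x\<bar>"
    by (simp add: sgn_if)
  finally show ?thesis .
qed

text \<open>Near 0 the function is close to a bounded wave, on a compact interval it is bounded by continuity, and
  far out the bound is given.\<close>

lemma bounded_by_exponential: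
  fixes f :: "real \<Rightarrow> real"
  assumes cont: "continuous_on {0<..} f"
    and near: "((\<lambda>x. f x - log_wave \<beta> A x) \<longlongrightarrow> 0) (at_right 0)"
    and far: "X > 0" "\<And>x. x \<ge> X \<Longrightarrow> \<bar>f x\<bar> \<le> C * exp (- x / 4)" "C \<ge> 0"
  shows "\<exists>M\<ge>0. \<forall>x>0. \<bar>f x\<bar> \<le> M * exp (- x / 4)"
proof -
  have "\<forall>\<^sub>F x in at_right 0. \<bar>f x - log_wave \<beta> A x\<bar> < 1"
    using tendstoD[OF near, of 1] by (simp add: dist_real_def)
  then obtain e where e: "e > 0" "\<And>x. 0 < x \<Longrightarrow> x < e \<Longrightarrow> \<bar>f x - log_wave \<beta> A x\<bar> < 1"
    unfolding eventually_at_right_field by auto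
  have small: "\<bar>f x\<bar> \<le> 1 + 2 * norm A" if "0 < x" "x < e" for x
    using e(2)[OF that] log_wave_bound[of \<beta> A x] by linarith
  have "compact {e / 2..X}" "continuous_on {e / 2..X} f"
    using e(1) by (auto intro!: continuous_on_subset[OF cont])
  then have "bounded (f ` {e / 2..X})" by (intro compact_imp_bounded compact_continuous_image)
  then obtain B where "\<forall>x\<in>{e / 2..X}. \<bar>f x\<bar> \<le> B"
    unfolding bounded_iff by auto
  then have B: "\<bar>f x\<bar> \<le> B" if "e / 2 \<le> x" "x \<le> X" for x
    using that by simp
  define L where "L = max B (1 + 2 * norm A)"
  have L0: "L \<ge> 0" by (simp add: L_def le_max_iff_disj)
  have L: "\<bar>f x\<bar> \<le> L" if "0 < x" "x \<le> X" for x
    using small[of x] B[of x] that e(1) unfolding L_def by (cases "x < e") (auto simp: le_max_iff_disj)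
  define M where "M = L * exp (X / 4) + C"
  show ?thesis
  proof (intro exI[of _ M] conjI allI impI)
    show "M \<ge> 0" using L0 far by (simp add: M_def)
    fix x :: real assume x: "x > 0"
    show "\<bar>f x\<bar> \<le> M * exp (- x / 4)"
    proof (cases "x \<le> X")
      case True
      have "1 \<le> exp (X / 4) * exp (- x / 4)" unfolding exp_add[symmetric] one_le_exp_iff using True by linarith
      then have "L * 1 \<le> L * (exp (X / 4) * exp (- x / 4))" using L0 by (rule mult_left_mono)
      moreover have "L * (exp (X / 4) * exp (- x / 4)) \<le> M * exp (- x / 4)"
        unfolding M_def mult.assoc[symmetric] using far(3) by (intro mult_right_mono) auto
      ultimately show ?thesis using L[OF x True] by linarith
    next
      case False
      then have "\<bar>f x\<bar> \<le> C * exp (- x / 4)" using far by simp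
      also have "\<dots> \<le> M * exp (- x / 4)" using L0 by (intro mult_right_mono) (auto simp: M_def)
      finally show ?thesis .
    qed
  qed
qed


section \<open>Rigidity for the Whittaker kernel\<close>

lemma whittaker_system_subset: "whittaker_system a \<rho> p q S \<Longrightarrow> T \<subseteq> S \<Longrightarrow> whittaker_system a \<rho> p q T"
  by (auto simp: whittaker_system_def)

lemma whittaker_system_bounded:
  assumes sys: "whittaker_system a \<rho> p q {0<..}" and "\<rho> > 0"
    and nn: "\<And>x. x > 0 \<Longrightarrow> scaled_density a \<rho> p q x \<ge> 0"
    and p0: "((\<lambda>x. p x - log_wave \<beta> A x) \<longlongrightarrow> 0) (at_right 0)"
    and q0: "((\<lambda>x. q x - log_wave \<beta> B x) \<longlongrightarrow> 0) (at_right 0)"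
  shows "\<exists>M\<ge>0. \<forall>x>0. \<bar>p x\<bar> \<le> M * exp (- x / 4) \<and> \<bar>q x\<bar> \<le> M * exp (- x / 4)"
proof -
  obtain C X where X: "X > 0" "C \<ge> 0"
    "\<And>x. x \<ge> X \<Longrightarrow> \<bar>p x\<bar> \<le> C * exp (- x / 4)" "\<And>x. x \<ge> X \<Longrightarrow> \<bar>q x\<bar> \<le> C * exp (- x / 4)"
    using whittaker_system_decay[OF assms(1,2) nn] by blast
  have "continuous_on {0<..} p" "continuous_on {0<..} q"
    using whittaker_systemD[OF sys] by (auto intro!: continuous_at_imp_continuous_on DERIV_isCont)
  then obtain M1 M2 where M: "M1 \<ge> 0" "\<And>x. x > 0 \<Longrightarrow> \<bar>p x\<bar> \<le> M1 * exp (- x / 4)"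
      "\<And>x. x > 0 \<Longrightarrow> \<bar>q x\<bar> \<le> M2 * exp (- x / 4)"
    using bounded_by_exponential[OF _ p0 X(1,3,2)] bounded_by_exponential[OF _ q0 X(1,4,2)] by blast
  have "\<bar>p x\<bar> \<le> max M1 M2 * exp (- x / 4) \<and> \<bar>q x\<bar> \<le> max M1 M2 * exp (- x / 4)" if "x > 0" for x
  proof -
    have "M1 * exp (- x / 4) \<le> max M1 M2 * exp (- x / 4)" "M2 * exp (- x / 4) \<le> max M1 M2 * exp (- x / 4)"
      by (intro mult_right_mono; simp)+
    then show ?thesis using M(2,3)[OF that] by linarith
  qed
  moreover have "max M1 M2 \<ge> 0" using M(1) by simp
  ultimately show ?thesis by blast
qed

lemma line_asymptotics:
  assumes z: "z \<notin> \<real>"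
  shows "((\<lambda>x. line_P z x - log_wave (Im z) (whittaker_amplitude z) x) \<longlongrightarrow> 0) (at_right 0)"
    and "((\<lambda>x. line_Q z x - log_wave (Im z) (whittaker_phase z * whittaker_amplitude z) x) \<longlongrightarrow> 0) (at_right 0)"
    and "((\<lambda>x. line_P z x - log_wave (Im z) (left_amplitude z) x) \<longlongrightarrow> 0) (at_left 0)"
    and "((\<lambda>x. line_Q z x - log_wave (Im z) (whittaker_phase z * left_amplitude z) x) \<longlongrightarrow> 0) (at_left 0)"
proof -
  have P: "((\<lambda>x. wave_P z x - log_wave (Im z) (whittaker_amplitude z) x) \<longlongrightarrow> 0) (at_right 0)" for z
    unfolding wave_P_def by (rule wave_asymptotic)
  have Q: "((\<lambda>x. wave_Q z x - log_wave (Im z) (whittaker_phase z * whittaker_amplitude z) x) \<longlongrightarrow> 0) (at_right 0)" for z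
    unfolding wave_Q_def by (rule wave_asymptotic)
  have tr: "((\<lambda>x. f x) \<longlongrightarrow> 0) (at_right 0)" if "((\<lambda>x. g x) \<longlongrightarrow> 0) (at_right 0)" "\<And>x. x > 0 \<Longrightarrow> g x = f x" for f g :: "real \<Rightarrow> real"
    using that(1) by (rule Lim_transform_eventually) (simp add: eventually_at_filter that(2))
  show "((\<lambda>x. line_P z x - log_wave (Im z) (whittaker_amplitude z) x) \<longlongrightarrow> 0) (at_right 0)"
    by (rule tr[OF P[of z]]) (simp add: line_P_def)
  show "((\<lambda>x. line_Q z x - log_wave (Im z) (whittaker_phase z * whittaker_amplitude z) x) \<longlongrightarrow> 0) (at_right 0)"
    by (rule tr[OF Q[of z]]) (simp add: line_Q_def)
  show "((\<lambda>x. line_P z x - log_wave (Im z) (left_amplitude z) x) \<longlongrightarrow> 0) (at_left 0)"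
    unfolding filterlim_at_left_to_right minus_zero
    by (rule tr[OF Q[of "- cnj z"]]) (simp add: line_P_def log_wave_minus phase_left_amplitude(2)[OF z])
  show "((\<lambda>x. line_Q z x - log_wave (Im z) (whittaker_phase z * left_amplitude z) x) \<longlongrightarrow> 0) (at_left 0)"
    unfolding filterlim_at_left_to_right minus_zero
    by (rule tr[OF tendsto_minus[OF P[of "- cnj z"], unfolded minus_zero]])
      (simp add: line_Q_def log_wave_minus phase_left_amplitude(1)[OF z] log_wave_uminus)
qed

text \<open>This is where the existence of the process enters the analysis of the Whittaker functions.\<close>

lemma line_density_nonneg:
  assumes z: "z \<notin> \<real>" and det_P: "determinantal P (whittaker_kernel z (cnj z))" and x: "x \<noteq> 0"
  shows "scaled_density (Re z) (norm z) (line_P z) (line_Q z) x \<ge> 0"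
proof -
  let ?H = "scaled_density (Re z) (norm z) (line_P z) (line_Q z)"
  have "continuous_on (- {0}) ?H"
  proof (intro continuous_at_imp_continuous_on ballI)
    fix x :: real assume "x \<in> - {0}"
    then show "isCont ?H x" by (intro DERIV_isCont[OF scaled_density_deriv[OF line_system[OF z]]]) auto
  qed
  then have c: "continuous_on (- {0}) (\<lambda>x. ?H x / \<bar>x\<bar>)" by (intro continuous_intros) auto
  then have "(\<lambda>x. ?H x / \<bar>x\<bar>) \<in> borel_measurable borel"
    by (intro borel_measurable_continuous_countable_exceptions[of "{0}"]) auto
  from determinantal_intensity_nonneg[OF det_P whittaker_kernel_diagonal[OF z] this c x]
  show ?thesis using x by (simp add: zero_le_divide_iff)
qed

lemma line_pair:
  assumes z: "z \<notin> \<real>" and det_P: "determinantal P (whittaker_kernel z (cnj z))"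
  shows "\<exists>M. whittaker_pair (Re z) (norm z) M (line_P z) (line_Q z) (Im z)
    (whittaker_amplitude z) (left_amplitude z) (whittaker_phase z)"
proof -
  note sys = line_system[OF z] and as = line_asymptotics[OF z] and nn = line_density_nonneg[OF z det_P]
  have \<rho>: "norm z > 0" using z by auto
  have \<beta>: "Im z \<noteq> 0" using z by (simp add: complex_is_Real_iff)
  obtain M1 where M1: "M1 \<ge> 0" "\<And>x. x > 0 \<Longrightarrow> \<bar>line_P z x\<bar> \<le> M1 * exp (- x / 4) \<and> \<bar>line_Q z x\<bar> \<le> M1 * exp (- x / 4)"
    using whittaker_system_bounded[OF whittaker_system_subset[OF sys] \<rho> nn as(1,2)] by force
  have "{0 <..} \<subseteq> uminus ` (- {0 :: real})" by (auto intro!: image_eqI[of _ _ "- x" for x])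
  note msys = whittaker_system_subset[OF whittaker_system_mirror[OF sys] this]
  have mnn: "0 \<le> scaled_density (- Re z) (norm z) (\<lambda>x. line_Q z (- x)) (\<lambda>x. - line_P z (- x)) x" if "x > 0" for x
    unfolding scaled_density_mirror using that by (intro nn) simp
  have mQ: "((\<lambda>x. line_Q z (- x) - log_wave (Im z) (whittaker_phase z * left_amplitude z) x) \<longlongrightarrow> 0) (at_right 0)"
    using as(4) unfolding filterlim_at_left_to_right minus_zero log_wave_minus .
  have mP: "((\<lambda>x. - line_P z (- x) - log_wave (Im z) (- left_amplitude z) x) \<longlongrightarrow> 0) (at_right 0)"
    using tendsto_minus[OF as(3)[unfolded filterlim_at_left_to_right minus_zero log_wave_minus]]
    unfolding log_wave_uminus by simp
  obtain M2 where M2: "M2 \<ge> 0" "\<And>x. x > 0 \<Longrightarrow> \<bar>line_Q z (- x)\<bar> \<le> M2 * exp (- x / 4) \<and> \<bar>- line_P z (- x)\<bar> \<le> M2 * exp (- x / 4)"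
    using whittaker_system_bounded[OF msys \<rho> mnn mQ mP] by blast
  define M where "M = max M1 M2"
  have bd: "\<bar>line_P z x\<bar> \<le> M * exp (- \<bar>x\<bar> / 4) \<and> \<bar>line_Q z x\<bar> \<le> M * exp (- \<bar>x\<bar> / 4)" if "x \<noteq> 0" for x
  proof -
    have le: "M1 * exp (- \<bar>x\<bar> / 4) \<le> M * exp (- \<bar>x\<bar> / 4)" "M2 * exp (- \<bar>x\<bar> / 4) \<le> M * exp (- \<bar>x\<bar> / 4)"
      unfolding M_def by (intro mult_right_mono; simp)+
    show ?thesis
    proof (cases "x > 0")
      case True
      then have "\<bar>x\<bar> = x" by simp
      then show ?thesis using M1(2)[OF True] le(1) by (metis order_trans)
    next
      case False
      then have "- x > 0" "\<bar>x\<bar> = - x" using that by simp_all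
      then show ?thesis using M2(2)[of "- x"] le(2) unfolding minus_minus abs_minus_cancel by (metis order_trans minus_minus)
    qed
  qed
  have "whittaker_pair (Re z) (norm z) M (line_P z) (line_Q z) (Im z)
    (whittaker_amplitude z) (left_amplitude z) (whittaker_phase z)"
  proof
    show "whittaker_system (Re z) (norm z) (line_P z) (line_Q z) (- {0})" by (rule sys)
    show "M \<ge> 0" using M1(1) by (simp add: M_def le_max_iff_disj)
    show "\<bar>line_P z x\<bar> \<le> M * exp (- \<bar>x\<bar> / 4)" "\<bar>line_Q z x\<bar> \<le> M * exp (- \<bar>x\<bar> / 4)" if "x \<noteq> 0" for x
      using bd[OF that] by auto
    show "norm z > 0" by (rule \<rho>)
    show "Im z \<noteq> 0" by (rule \<beta>)
    show "(norm z)\<^sup>2 = (Re z)\<^sup>2 + (Im z)\<^sup>2" by (rule cmod_power2)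
    show "whittaker_phase z = Complex (- Re z / norm z) (Im z / norm z)" by (rule whittaker_phase_def)
  qed (rule as left_amplitude_norm[OF z] amplitude_nonzero[OF z] amplitude_connection[OF z])+
  then show ?thesis by blast
qed

lemma exp_decay_inverse: "(u::real) > 0 \<Longrightarrow> exp (- u / 4) \<le> 4 / u"
proof -
  assume u: "u > 0"
  have "u / 4 \<le> exp (u / 4)" using exp_ge_add_one_self[of "u / 4"] by linarith
  then have "u * exp (- u / 4) \<le> 4" using u by (simp add: exp_minus field_simps)
  then show ?thesis using u by (simp add: field_simps)
qed

context decaying_pair begin

lemma density_bound:
  assumes x: "x \<noteq> 0"
  shows "H x / \<bar>x\<bar> \<le> (4 * ((2 * \<bar>\<rho>\<bar> + 2 * \<bar>a\<bar> + 4) * M\<^sup>2)) / x\<^sup>2"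
proof -
  let ?c = "(2 * \<bar>\<rho>\<bar> + 2 * \<bar>a\<bar> + 4) * M\<^sup>2"
  have "H x / \<bar>x\<bar> \<le> ?c * exp (- \<bar>x\<bar> / 4) / \<bar>x\<bar>"
    using H_bound[OF x] by (intro divide_right_mono) auto
  also have "\<dots> \<le> ?c * (4 / \<bar>x\<bar>) / \<bar>x\<bar>"
    using x by (intro divide_right_mono mult_left_mono exp_decay_inverse) auto
  also have "\<dots> = 4 * ?c / (\<bar>x\<bar> * \<bar>x\<bar>)" by simp
  also have "\<bar>x\<bar> * \<bar>x\<bar> = x\<^sup>2" by (simp add: power2_eq_square)
  finally show ?thesis .
qed

text \<open>From \<open>|k| \<le> 4 M\<^sup>2 exp (- s/4) / s\<close> with \<open>s = |x| + |y|\<close>: the exponential is bounded by 1 for the first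
  estimate and by \<open>4 / s\<close> for the second one.\<close>

lemma kernel_square_bounds:
  assumes x: "x \<noteq> 0" and y: "y \<noteq> 0"
  shows "(k x y)\<^sup>2 \<le> (256 * M ^ 4) / x\<^sup>2" and "(k x y)\<^sup>2 \<le> (256 * M ^ 4) / (x\<^sup>2 * y\<^sup>2)"
proof -
  define s where "s = \<bar>x\<bar> + \<bar>y\<bar>"
  have s: "s > 0" "\<bar>x\<bar> \<le> s" "\<bar>y\<bar> \<le> s" using x y by (auto simp: s_def)
  have k: "\<bar>k x y\<bar> \<le> 4 * M\<^sup>2 / s * exp (- s / 4)" using kernel_bound[OF x y] by (simp add: s_def)
  have sq: "u\<^sup>2 \<le> B / v\<^sup>2" if "\<bar>u\<bar> \<le> c / \<bar>v\<bar>" "c\<^sup>2 \<le> B" "v \<noteq> 0" for u v c B :: real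
  proof -
    have "u\<^sup>2 \<le> (c / \<bar>v\<bar>)\<^sup>2" using power_mono[OF that(1), of 2] by simp
    also have "\<dots> = c\<^sup>2 / v\<^sup>2" by (simp add: power_divide)
    also have "\<dots> \<le> B / v\<^sup>2" using that(2) by (intro divide_right_mono) auto
    finally show ?thesis .
  qed
  have M4: "(4 * M\<^sup>2)\<^sup>2 \<le> 256 * M ^ 4" "(16 * M\<^sup>2)\<^sup>2 \<le> 256 * M ^ 4"
    by (simp_all add: power_mult_distrib power_mult[symmetric])
  have "4 * M\<^sup>2 / s * exp (- s / 4) \<le> 4 * M\<^sup>2 / \<bar>x\<bar> * 1"
    using s x by (intro mult_mono divide_left_mono) auto
  then show "(k x y)\<^sup>2 \<le> (256 * M ^ 4) / x\<^sup>2"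
    using k by (intro sq[OF _ M4(1) x]) linarith
  have "4 * M\<^sup>2 / s * exp (- s / 4) \<le> 4 * M\<^sup>2 / s * (4 / s)"
    using s by (intro mult_left_mono exp_decay_inverse) auto
  also have "\<dots> = 16 * M\<^sup>2 / (s * s)" by simp
  also have "\<dots> \<le> 16 * M\<^sup>2 / (\<bar>x\<bar> * \<bar>y\<bar>)"
    using s x y by (intro divide_left_mono mult_mono) auto
  finally have "\<bar>k x y\<bar> \<le> 16 * M\<^sup>2 / \<bar>x * y\<bar>" using k by (simp add: abs_mult)
  then have "(k x y)\<^sup>2 \<le> (256 * M ^ 4) / (x * y)\<^sup>2"
    using x y by (intro sq[OF _ M4(2)]) auto
  then show "(k x y)\<^sup>2 \<le> (256 * M ^ 4) / (x\<^sup>2 * y\<^sup>2)" by (simp add: power_mult_distrib)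
qed

end

lemma whittaker_signed_kernel_process:
  assumes z: "z \<notin> \<real>" and det_P: "determinantal P (whittaker_kernel z (cnj z))"
  shows "\<exists>k r C. signed_kernel_process P (whittaker_kernel z (cnj z)) k r C"
proof -
  obtain M where "whittaker_pair (Re z) (norm z) M (line_P z) (line_Q z) (Im z)
    (whittaker_amplitude z) (left_amplitude z) (whittaker_phase z)"
    using line_pair[OF z det_P] by blast
  then interpret whittaker_pair "Re z" "norm z" M "line_P z" "line_Q z" "Im z"
    "whittaker_amplitude z" "left_amplitude z" "whittaker_phase z" .
  define c where "c = 4 * ((2 * \<bar>norm z\<bar> + 2 * \<bar>Re z\<bar> + 4) * M\<^sup>2)"
  define C where "C = c + 256 * M ^ 4"
  have c0: "c \<ge> 0" "256 * M ^ 4 \<ge> 0" by (auto simp: c_def)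
  have up: "u \<le> C / v" if "u \<le> c / v \<or> u \<le> 256 * M ^ 4 / v" "v \<ge> 0" for u v
  proof -
    have "c / v \<le> C / v" "256 * M ^ 4 / v \<le> C / v"
      using c0 that(2) by (intro divide_right_mono; simp add: C_def)+
    then show ?thesis using that(1) by linarith
  qed
  have "signed_kernel_process P (whittaker_kernel z (cnj z)) k (\<lambda>x. H x / \<bar>x\<bar>) C"
  proof
    show "determinantal P (whittaker_kernel z (cnj z))" by (rule det_P)
    show "whittaker_kernel z (cnj z) x x = of_real (H x / \<bar>x\<bar>)" if "x \<noteq> 0" for x
      by (rule whittaker_kernel_diagonal[OF z that])
    show "whittaker_kernel z (cnj z) x y * whittaker_kernel z (cnj z) y x = of_real (sgn x * sgn y * (k x y)\<^sup>2)"
      if "x \<noteq> 0" "y \<noteq> 0" "x \<noteq> y" for x y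
      using that k_sym[of y x] unfolding whittaker_kernel_def
      by (simp add: whittaker_kernel_off_line[OF z] power2_eq_square mult_ac)
    show "case_prod k \<in> borel_measurable (borel \<Otimes>\<^sub>M borel)"
      using k_measurable by (simp add: case_prod_beta')
    show "(\<lambda>x. H x / \<bar>x\<bar>) \<in> borel_measurable borel" unfolding scaled_density_def by measurable
    show "H x / \<bar>x\<bar> \<ge> 0" if "x \<noteq> 0" for x
      using line_density_nonneg[OF z det_P that] by simp
    show "(\<integral>\<^sup>+y. ennreal ((k x y)\<^sup>2) \<partial>lborel) = ennreal (H x / \<bar>x\<bar>)" if "x \<noteq> 0" for x
      by (rule kernel_square_nn[OF that])
    show "C \<ge> 0" using c0 by (simp add: C_def)
    show "H x / \<bar>x\<bar> \<le> C / x\<^sup>2" if "x \<noteq> 0" for x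
      using density_bound[OF that] by (intro up disjI1) (simp_all add: c_def)
    show "(k x y)\<^sup>2 \<le> C / x\<^sup>2" "(k x y)\<^sup>2 \<le> C / (x\<^sup>2 * y\<^sup>2)" if "x \<noteq> 0" "y \<noteq> 0" for x y
      using kernel_square_bounds[OF that] by (intro up disjI2; simp)+
  qed
  then show ?thesis by blast
qed

theorem theoremA:
  fixes z z' :: complex and P :: "real set measure" and B :: "real set"
  assumes "z \<notin> \<real>" and "z' = cnj z"
    and "determinantal P (whittaker_kernel z z')"
    and "B \<in> sets borel" and "B \<subseteq> Rstar" and "\<exists>\<delta>>0. \<forall>x\<in>B. \<delta> \<le> dist x 0"
  shows "(\<exists>N :: real set \<Rightarrow> int. N \<in> conf_space \<rightarrow>\<^sub>M count_space UNIV \<and>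
            (AE X in P. finite (B \<inter> X) \<and>
               int (card (B \<inter> X \<inter> {0<..})) - int (card (B \<inter> X \<inter> {..<0})) = N (X - B)))
       \<and> (B \<subseteq> {0<..} \<longrightarrow>
            (\<exists>N :: real set \<Rightarrow> nat. N \<in> conf_space \<rightarrow>\<^sub>M count_space UNIV \<and>
               (AE X in P. finite (B \<inter> X) \<and> card (B \<inter> X) = N (X - B))))
       \<and> (B \<subseteq> {..<0} \<longrightarrow>
            (\<exists>N :: real set \<Rightarrow> nat. N \<in> conf_space \<rightarrow>\<^sub>M count_space UNIV \<and>
               (AE X in P. finite (B \<inter> X) \<and> card (B \<inter> X) = N (X - B))))"
proof -
  obtain \<delta> where \<delta>: "\<delta> > 0" "\<And>x. x \<in> B \<Longrightarrow> \<delta> \<le> \<bar>x\<bar>"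
    using assms(6) by (auto simp: dist_real_def)
  obtain k r C where "signed_kernel_process P (whittaker_kernel z z') k r C"
    using whittaker_signed_kernel_process assms(1-3) by blast
  then obtain N :: "real set \<Rightarrow> int" where N: "N \<in> conf_space \<rightarrow>\<^sub>M count_space UNIV"
    and ae: "AE X in P. finite (B \<inter> X) \<and>
      int (card (B \<inter> X \<inter> {0<..})) - int (card (B \<inter> X \<inter> {..<0})) = N (X - B)"
    using signed_kernel_process.charge_rigidity[OF _ \<delta>] by blast
  have N': "(\<lambda>X. f (N X)) \<in> conf_space \<rightarrow>\<^sub>M count_space UNIV" for f :: "int \<Rightarrow> nat"
    by (rule measurable_compose[OF N]) simp
  show ?thesis
  proof (intro conjI impI)
    show "\<exists>N :: real set \<Rightarrow> int. N \<in> conf_space \<rightarrow>\<^sub>M count_space UNIV \<and>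
            (AE X in P. finite (B \<inter> X) \<and>
               int (card (B \<inter> X \<inter> {0<..})) - int (card (B \<inter> X \<inter> {..<0})) = N (X - B))"
      using N ae by blast
  next
    assume B: "B \<subseteq> {0<..}"
    have e: "B \<inter> X \<inter> {0<..} = B \<inter> X" "B \<inter> X \<inter> {..<0} = {}" for X
      using B by force+
    have "AE X in P. finite (B \<inter> X) \<and> card (B \<inter> X) = nat (N (X - B))"
      using ae unfolding e by eventually_elim auto
    then show "\<exists>N :: real set \<Rightarrow> nat. N \<in> conf_space \<rightarrow>\<^sub>M count_space UNIV \<and>
               (AE X in P. finite (B \<inter> X) \<and> card (B \<inter> X) = N (X - B))"
      using N'[of nat] by blast
  next
    assume B: "B \<subseteq> {..<0}"
    have e: "B \<inter> X \<inter> {0<..} = {}" "B \<inter> X \<inter> {..<0} = B \<inter> X" for X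
      using B by force+
    have "AE X in P. finite (B \<inter> X) \<and> card (B \<inter> X) = nat (- N (X - B))"
      using ae unfolding e by eventually_elim auto
    then show "\<exists>N :: real set \<Rightarrow> nat. N \<in> conf_space \<rightarrow>\<^sub>M count_space UNIV \<and>
               (AE X in P. finite (B \<inter> X) \<and> card (B \<inter> X) = N (X - B))"
      using N'[of "\<lambda>n. nat (- n)"] by blast
  qed
qed

end
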